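(* Let $d\ge2$ and fix any $\xi\in\mathbb S^{d-1}$. For every $\mathcal L\in\mathscr P$, there are at most countably many values of $h>0$ for which $\mathcal L\oplus h\mathbf 1_{\{t>0\}}\notin\mathscr P_{\mathrm{length}}(\xi)$.
   Context: $\mathscr P$ is the set of Borel probability measures on $[0,\infty)$; $\mathbb S^{d-1}$ is the Euclidean unit sphere in $\mathbb R^d$. If $\mathcal L\in\mathscr P$ is the law of $\tau_e$, then $\mathcal L\oplus h\mathbf 1_{\{t>0\}}$ denotes the law of $\tau_e+h\mathbf 1_{\{\tau_e>0\}}$. First-passage percolation on $\mathbb Z^d$, $d\ge2$, with a given edge-weight law in $\mathscr P$: the weights $(\tau_e)_{e\in E(\mathbb Z^d)}$ are i.i.d. with that law, indexed by undirected nearest-neighbor edges, on a complete probability space. For $x\in\mathbb R^d$, $[x]\in\mathbb Z^d$ is the unique integer point with $x\in[x]+[0,1)^d$. $\mathcal P(x,y)$ is the set of self-avoiding nearest-neighbor paths (viewed as sets of edges) from $[x]$ to $[y]$, $T(\gamma)=\sum_{e\in\gamma}\tau_e$, $T(x,y)=\inf_{\gamma\in\mathcal P(x,y)}T(\gamma)$, $\mathrm{Geo}(x,y)=\{\gamma\in\mathcal P(x,y):T(\gamma)=T(x,y)\}$. $|\gamma|_+=|\{e\in\gamma:\tau_e>0\}|$. Definition: a law belongs to $\mathscr P_{\mathrm{length}}(\xi)$ if, for the model with that edge-weight law, there is a deterministic constant $\lambda$ such that, almost surely, $\lim_{n\to\infty}|\gamma_n|_+/n=\lambda$ for any choice of $\gamma_n\in\mathrm{Geo}(0,n\xi)$.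 Limits $n\to\infty$ are along real $n$. *)

theory Defs
  imports "HOL-Probability.Probability"
begin

text \<open>The law of a single edge weight: a Borel probability measure on the nonnegative half-line,
  encoded as a Borel measure on the reals that charges only nonnegative numbers.\<close>

definition edge_laws :: "real measure set" where
  "edge_laws = {L. prob_space L \<and> sets L = sets borel \<and> (AE t in L. 0 \<le> t)}"

definition shift_law :: "real measure \<Rightarrow> real \<Rightarrow> real measure" where
  "shift_law L h = distr L borel (\<lambda>t. t + h * indicator {0<..} t)"

definition lattice_adj :: "int ^ 'd \<Rightarrow> int ^ 'd \<Rightarrow> bool" where
  "lattice_adj x y \<longleftrightarrow> (\<Sum>i\<in>UNIV. \<bar>x $ i - y $ i\<bar>) = 1"

definition lattice_edges :: "(int ^ 'd) set set" where
  "lattice_edges = {{x, y} |x y. lattice_adj x y}"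

definition lattice_point :: "real ^ 'd \<Rightarrow> int ^ 'd" where
  "lattice_point x = (\<chi> i. \<lfloor>x $ i\<rfloor>)"

lemma lattice_point_iff:
  "lattice_point x = z \<longleftrightarrow> (\<forall>i. x $ i - real_of_int (z $ i) \<in> {0..<1})"
  by (auto simp: lattice_point_def vec_eq_iff floor_eq_iff algebra_simps)

text \<open>Self-avoiding walks are nonempty lists of distinct vertices; the path is the set of
  edges traversed. In particular, the only path from a point to itself is the empty edge set.\<close>

definition self_avoiding_walk :: "(int ^ 'd) list \<Rightarrow> bool" where
  "self_avoiding_walk vs \<longleftrightarrow> vs \<noteq> [] \<and> distinct vs \<and> successively lattice_adj vs"

definition walk_edges :: "(int ^ 'd) list \<Rightarrow> (int ^ 'd) set set" where
  "walk_edges vs = {{vs ! i, vs ! Suc i} |i. Suc i < length vs}"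

definition fpp_paths :: "real ^ 'd \<Rightarrow> real ^ 'd \<Rightarrow> (int ^ 'd) set set set" where
  "fpp_paths x y = {walk_edges vs |vs. self_avoiding_walk vs
     \<and> hd vs = lattice_point x \<and> last vs = lattice_point y}"

definition passage_time_path :: "((int ^ 'd) set \<Rightarrow> real) \<Rightarrow> (int ^ 'd) set set \<Rightarrow> real" where
  "passage_time_path \<tau> \<gamma> = (\<Sum>e\<in>\<gamma>. \<tau> e)"

definition passage_time :: "((int ^ 'd) set \<Rightarrow> real) \<Rightarrow> real ^ 'd \<Rightarrow> real ^ 'd \<Rightarrow> real" where
  "passage_time \<tau> x y = (INF \<gamma>\<in>fpp_paths x y. passage_time_path \<tau> \<gamma>)"

definition Geo :: "((int ^ 'd) set \<Rightarrow> real) \<Rightarrow> real ^ 'd \<Rightarrow> real ^ 'd \<Rightarrow> (int ^ 'd) set set set" where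
  "Geo \<tau> x y = {\<gamma> \<in> fpp_paths x y. passage_time_path \<tau> \<gamma> = passage_time \<tau> x y}"

definition pos_length :: "((int ^ 'd) set \<Rightarrow> real) \<Rightarrow> (int ^ 'd) set set \<Rightarrow> nat" where
  "pos_length \<tau> \<gamma> = card {e \<in> \<gamma>. \<tau> e > 0}"

text \<open>The model is realized on the completed canonical product space, whose coordinates are
  the weights. An almost sure statement about the weights here transfers to
  every other probability space carrying i.i.d. weights with law \<open>L\<close>.\<close>

definition fpp_space :: "real measure \<Rightarrow> ((int ^ 'd) set \<Rightarrow> real) measure" where
  "fpp_space L = completion (Pi\<^sub>M lattice_edges (\<lambda>_. L))"

text \<open>Here \<open>n\<close> ranges over the positive reals, and the exceptional null set does not depend on the
  choice \<open>\<gamma>\<close> of geodesics.\<close>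

definition length_laws :: "real ^ 'd \<Rightarrow> real measure set" where
  "length_laws \<xi> = {L \<in> edge_laws. \<exists>l::real. AE \<tau> in fpp_space L.
     \<forall>\<gamma>. (\<forall>n>0. \<gamma> n \<in> Geo \<tau> 0 (n *\<^sub>R \<xi>)) \<longrightarrow>
       ((\<lambda>n::real. real (pos_length \<tau> (\<gamma> n)) / n) \<longlongrightarrow> l) at_top}"

end

theory Submission
  imports Defs
begin

text \<open>
  Let \<open>T h\<close> be the passage time when every positive weight is increased by \<open>h\<close>. A geodesic \<open>\<gamma>\<close> for
  \<open>T h\<close> is a competitor for \<open>T h'\<close>, so \<open>T h' \<le> T h + (h' - h) * \<bar>\<gamma>\<bar>\<^sub>+\<close>. If time constants \<open>g h\<close>
  exist, then asymptotically \<open>\<bar>\<gamma>\<bar>\<^sub>+ / n\<close> lies between the slopes of \<open>g\<close> to the right and to the left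
  of \<open>h\<close>. The gaps between these slopes are disjoint intervals for different \<open>h\<close>, hence only countably
  many are nondegenerate.

  Without moment assumptions, \<open>T h / n\<close> itself need not converge almost surely. Call an edge good if
  its weight is at most \<open>M\<close>. Around each site there is a shell, a connected set of sites
  joined by good edges and separating a cube from infinity, and the radius of the smallest one has
  very light tails: shells of one scale, centered along a large sphere, merge into a shell of the next
  scale, and two disjoint layers of centers square the failure probability. Capping
  the weights by the cost of walking along a shell yields an integrable stationary metric \<open>dst h\<close>. It
  agrees with \<open>T h\<close> up to \<open>o(n)\<close> and up to two end pieces, which have few edges. The existence
  of its time constant follows Steele's proof of the subadditive ergodic theorem; as \<open>\<xi>\<close> is arbitrary,
  the sites \<open>[n \<xi>]\<close> are additive only up to rounding, and a covering argument replaces the use of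
  Birkhoff's theorem.
\<close>

section \<open>Walks\<close>

text \<open>All values of \<open>h\<close> are compared on one field \<open>\<tau>\<close> of
  weights with law \<open>L\<close>: passing from \<open>h\<close> to \<open>h'\<close> changes the
  weight of an edge by exactly \<open>(h' - h) * pos_edge \<tau> e\<close>. Only at the very end are
  statements pulled back to weights with law \<open>shift_law L h\<close>. The obstacle to
  convergence of the uncapped time is local: the end sites may sit behind heavy edges whose cost has
  no moments. On \<open>regular\<close> configurations all sites within distance of order
  \<open>n\<close> have shells of radius at most of order \<open>n\<close> to the power
  \<open>1 / expo\<close>. The choice \<open>expo = 3 * CARD('d)\<close> makes the detour costs
  negligible against \<open>n\<close>, even when summed over a cube of that size. From there on the
  comparison with geodesics is deterministic. Rounding only costs a constant factor in the maximal
  inequality, the number of sites of the unit cube. This is harmless, because the inequality is used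
  for functions of small integral, or merely to obtain finiteness. Limits are identified at one
  suitable configuration, which suffices since liminf and limsup are almost surely constant.\<close>

fun steps :: "'a list \<Rightarrow> 'a set list" where
  "steps (x # y # p) = {x, y} # steps (y # p)"
| "steps p = []"

definition joins :: "int ^ 'd \<Rightarrow> int ^ 'd \<Rightarrow> (int ^ 'd) list \<Rightarrow> bool" where
  "joins x y p \<longleftrightarrow> p \<noteq> [] \<and> successively lattice_adj p \<and> hd p = x \<and> last p = y"

text \<open>Edges count with multiplicity, so that costs add up under concatenation of walks; on
  lists without repetition this is the passage time of the edge set.\<close>

definition cost :: "('a set \<Rightarrow> real) \<Rightarrow> 'a list \<Rightarrow> real" where
  "cost f p = sum_list (map f (steps p))"

lemma lattice_adj_sym: "lattice_adj x y \<longleftrightarrow> lattice_adj y x"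
  by (simp add: lattice_adj_def abs_minus_commute)

lemma steps_append: "steps (p @ u # q) = steps (p @ [u]) @ steps (u # q)"
  by (induction p rule: steps.induct) (auto simp: neq_Nil_conv)

lemma length_steps: "length (steps p) = length p - 1"
  by (induction p rule: steps.induct) auto

lemma steps_rev: "steps (rev p) = rev (steps p)"
proof (induction p rule: steps.induct)
  case (1 x y p)
  have "steps (rev (x # y # p)) = steps (rev p @ y # [x])" by simp
  also have "\<dots> = steps (rev p @ [y]) @ steps [y, x]" by (rule steps_append)
  also have "\<dots> = rev (steps (x # y # p))" using 1 by (simp add: insert_commute)
  finally show ?case .
qed auto

lemma steps_subset_Pow: "e \<in> set (steps p) \<Longrightarrow> e \<subseteq> set p"
  by (induction p rule: steps.induct) auto

lemma distinct_steps: "distinct p \<Longrightarrow> distinct (steps p)"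
proof (induction p rule: steps.induct)
  case (1 x y p)
  then show ?case using steps_subset_Pow[of "{x, y}" "y # p"] by auto
qed auto

lemma set_steps: "set (steps p) = {{p ! i, p ! Suc i} |i. Suc i < length p}"
proof (induction p rule: steps.induct)
  case (1 x y p)
  show ?case
  proof (intro equalityI subsetI)
    fix e assume "e \<in> set (steps (x # y # p))"
    then consider "e = {x, y}" | "e \<in> set (steps (y # p))" by auto
    then show "e \<in> {{(x # y # p) ! i, (x # y # p) ! Suc i} |i. Suc i < length (x # y # p)}"
    proof cases
      case 1
      then show ?thesis by (intro CollectI exI[of _ 0]) simp
    next
      case 2
      then obtain i where "e = {(y # p) ! i, (y # p) ! Suc i}" "Suc i < length (y # p)"
        using 1 by auto
      then show ?thesis by (intro CollectI exI[of _ "Suc i"]) simp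
    qed
  next
    fix e assume "e \<in> {{(x # y # p) ! i, (x # y # p) ! Suc i} |i. Suc i < length (x # y # p)}"
    then obtain i where i: "e = {(x # y # p) ! i, (x # y # p) ! Suc i}"
      "Suc i < length (x # y # p)" by auto
    show "e \<in> set (steps (x # y # p))"
    proof (cases i)
      case 0
      then show ?thesis using i by simp
    next
      case (Suc j)
      then have "e \<in> set (steps (y # p))" using 1 i by auto
      then show ?thesis by simp
    qed
  qed
qed auto

lemma walk_edges_eq: "walk_edges p = set (steps p)"
  by (simp add: walk_edges_def set_steps)

lemma steps_map: "steps (map f p) = map ((`) f) (steps p)"
  by (induction p rule: steps.induct) auto

lemma cost_single [simp]: "cost f [x] = 0"
  by (simp add: cost_def)

lemma cost_split: "cost f (p @ u # q) = cost f (p @ [u]) + cost f (u # q)"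
  unfolding cost_def by (subst steps_append) simp

lemma cost_rev: "cost f (rev p) = cost f p"
  by (simp add: cost_def steps_rev flip: rev_map)

lemma cost_mono_fun: "(\<And>e. e \<in> set (steps p) \<Longrightarrow> f e \<le> g e) \<Longrightarrow> cost f p \<le> cost g p"
  unfolding cost_def by (intro sum_list_mono) auto

lemma cost_nonneg: "(\<And>e. e \<in> set (steps p) \<Longrightarrow> 0 \<le> f e) \<Longrightarrow> 0 \<le> cost f p"
  unfolding cost_def by (intro sum_list_nonneg) auto

lemma cost_distinct: "distinct p \<Longrightarrow> cost f p = sum f (set (steps p))"
  unfolding cost_def by (simp add: sum_list_distinct_conv_sum_set distinct_steps)

lemma sum_steps_le_cost:
  assumes "\<And>e. e \<in> set (steps p) \<Longrightarrow> 0 \<le> f e"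
  shows "sum f (set (steps p)) \<le> cost f p"
proof -
  have "sum f (set xs) \<le> sum_list (map f xs)" if "\<And>x. x \<in> set xs \<Longrightarrow> 0 \<le> f x" for xs
    using that by (induction xs) (auto simp: sum.insert_if intro: add_increasing)
  then show ?thesis unfolding cost_def using assms by blast
qed

text \<open>Pieces that have been cut and reversed are compared as multisets of edges, so that the
  order of the steps does not matter.\<close>

lemma cost_mset_mono:
  assumes "mset (steps p) \<subseteq># mset (steps q)" "\<And>e. 0 \<le> f e"
  shows "cost f p \<le> cost f q"
proof -
  obtain A where A: "mset (steps q) = mset (steps p) + A"
    using assms(1) by (metis subset_mset.le_iff_add)
  have "cost f q = sum_mset (image_mset f (mset (steps q)))"
    by (simp add: cost_def sum_mset_sum_list flip: mset_map)
  also have "\<dots> = sum_mset (image_mset f (mset (steps p))) + sum_mset (image_mset f A)"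
    by (simp add: A)
  also have "sum_mset (image_mset f (mset (steps p))) = cost f p"
    by (simp add: cost_def sum_mset_sum_list flip: mset_map)
  moreover have "sum_mset (image_mset f A) \<ge> 0" using assms(2) by (induction A) auto
  ultimately show ?thesis by linarith
qed

lemma joins_nonempty: "joins x y p \<Longrightarrow> p \<noteq> []"
  by (simp add: joins_def)

lemma joins_single: "joins x x [x]"
  by (simp add: joins_def)

lemma joins_edge: "lattice_adj x y \<Longrightarrow> joins x y [x, y]"
  by (simp add: joins_def)

lemma joins_rev: "joins x y p \<Longrightarrow> joins y x (rev p)"
  by (auto simp: joins_def hd_rev last_rev lattice_adj_sym)

lemma joins_split_iff:
  "joins x y (p @ u # q) \<longleftrightarrow> joins x u (p @ [u]) \<and> joins u y (u # q)"
  by (auto simp: joins_def successively_append_iff successively_Cons hd_append)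

lemma joins_trans:
  assumes "joins x y p" "joins y z q"
  shows "joins x z (p @ tl q)" "steps (p @ tl q) = steps p @ steps q"
    "set (p @ tl q) = set p \<union> set q"
proof -
  obtain p' where p: "p = p' @ [y]"
    using assms(1) by (metis append_butlast_last_id joins_def)
  obtain q' where q: "q = y # q'"
    using assms(2) by (metis hd_Cons_tl joins_def)
  have pq: "p @ tl q = p' @ y # q'" by (simp add: p q)
  show "joins x z (p @ tl q)"
    unfolding pq by (rule iffD2[OF joins_split_iff]) (use assms in \<open>simp add: p q\<close>)
  show "steps (p @ tl q) = steps p @ steps q" unfolding pq by (subst steps_append) (simp add: p q)
  show "set (p @ tl q) = set p \<union> set q" unfolding pq by (auto simp: p q)
qed

lemma joins_split:
  assumes "joins x y p" "u \<in> set p"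
  obtains p1 p2 where "joins x u p1" "joins u y p2" "steps p = steps p1 @ steps p2"
    "set p = set p1 \<union> set p2"
proof -
  obtain a b where p: "p = a @ u # b" using assms(2) by (meson split_list)
  have "joins x u (a @ [u])" "joins u y (u # b)"
    using assms(1) joins_split_iff[of x y a u b] by (simp_all add: p)
  then show thesis
    using that[of "a @ [u]" "u # b"] by (auto simp: p steps_append[of a u b])
qed

lemma joins_edges_lattice:
  assumes "joins x y p" shows "set (steps p) \<subseteq> lattice_edges"
proof -
  have "successively lattice_adj p \<Longrightarrow> set (steps p) \<subseteq> lattice_edges" for p :: "(int ^ 'a) list"
    by (induction p rule: steps.induct) (auto simp: lattice_edges_def)
  then show ?thesis using assms by (simp add: joins_def)
qed

text \<open>A shortest walk among those using only edges and sites of \<open>p\<close> visits no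
  site twice, since the stretch between two visits could be cut out.\<close>

lemma loop_erasure:
  assumes "joins x y p"
  obtains q where "joins x y q" "distinct q" "set (steps q) \<subseteq> set (steps p)" "set q \<subseteq> set p"
proof -
  define P where "P q \<longleftrightarrow> joins x y q \<and> set (steps q) \<subseteq> set (steps p) \<and> set q \<subseteq> set p" for q
  define q where "q = arg_min length P"
  have "P p" using assms by (simp add: P_def)
  then have Pq: "P q" unfolding q_def by (rule arg_min_natI)
  have min: "length q \<le> length r" if "P r" for r
    unfolding q_def using that by (rule arg_min_nat_le)
  have "distinct q"
  proof (rule ccontr)
    assume "\<not> distinct q"
    then obtain a b c u where q: "q = a @ [u] @ b @ [u] @ c" using not_distinct_decomp by blast
    have j: "joins x y (a @ u # c)"
    proof -
      have "joins x y (a @ u # (b @ u # c))" using Pq by (simp add: P_def q)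
      then have "joins x u (a @ [u])" "joins u y ((u # b) @ u # c)"
        using joins_split_iff[of x y a u "b @ u # c"] by simp_all
      then have "joins u y (u # c)" using joins_split_iff[of u y "u # b" u c] by simp
      with \<open>joins x u (a @ [u])\<close> show ?thesis using joins_split_iff[of x y a u c] by simp
    qed
    have "steps q = steps (a @ [u]) @ steps (u # b @ [u] @ c)"
      using steps_append[of a u "b @ u # c"] by (simp add: q)
    moreover have "steps (u # b @ [u] @ c) = steps ((u # b) @ [u]) @ steps (u # c)"
      using steps_append[of "u # b" u c] by simp
    moreover have "steps (a @ u # c) = steps (a @ [u]) @ steps (u # c)" by (rule steps_append)
    ultimately have "P (a @ u # c)" using Pq j unfolding P_def q by auto
    from min[OF this] show False by (simp add: q)
  qed
  then show thesis using that Pq unfolding P_def by blast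
qed

definition linked :: "(int ^ 'd) set set \<Rightarrow> (int ^ 'd) set \<Rightarrow> int ^ 'd \<Rightarrow> int ^ 'd \<Rightarrow> bool" where
  "linked G S u v \<longleftrightarrow> (\<exists>p. joins u v p \<and> set p \<subseteq> S \<and> set (steps p) \<subseteq> G)"

lemma linked_refl: "u \<in> S \<Longrightarrow> linked G S u u"
  unfolding linked_def by (rule exI[of _ "[u]"]) (auto simp: joins_single)

lemma linked_sym: "linked G S u v \<Longrightarrow> linked G S v u"
  unfolding linked_def by (metis joins_rev set_rev steps_rev)

lemma linked_trans: "linked G S u v \<Longrightarrow> linked G S v w \<Longrightarrow> linked G S u w"
proof -
  assume "linked G S u v" "linked G S v w"
  then obtain p q where "joins u v p" "set p \<subseteq> S" "set (steps p) \<subseteq> G"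
    "joins v w q" "set q \<subseteq> S" "set (steps q) \<subseteq> G"
    unfolding linked_def by blast
  then show "linked G S u w"
    unfolding linked_def using joins_trans[of u v p w q] by (intro exI[of _ "p @ tl q"]) simp
qed

lemma linked_mono: "linked G S u v \<Longrightarrow> G \<subseteq> G' \<Longrightarrow> S \<subseteq> S' \<Longrightarrow> linked G' S' u v"
  unfolding linked_def by (meson subset_trans)

lemma linked_edge:
  "lattice_adj u v \<Longrightarrow> u \<in> S \<Longrightarrow> v \<in> S \<Longrightarrow> {u, v} \<in> G \<Longrightarrow> linked G S u v"
  unfolding linked_def by (rule exI[of _ "[u, v]"]) (auto simp: joins_edge)

lemma linked_distinct:
  assumes "linked G S u v"
  obtains p where "joins u v p" "distinct p" "set p \<subseteq> S" "set (steps p) \<subseteq> G"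
proof -
  obtain p where p: "joins u v p" "set p \<subseteq> S" "set (steps p) \<subseteq> G"
    using assms unfolding linked_def by blast
  obtain q where "joins u v q" "distinct q" "set (steps q) \<subseteq> set (steps p)" "set q \<subseteq> set p"
    using p(1) by (rule loop_erasure)
  then show thesis using that p by blast
qed

text \<open>A self-avoiding walk inside \<open>S\<close> has at most \<open>card S\<close>
  edges.\<close>

lemma cost_linked_le:
  assumes "linked G S u v" "finite S" "0 \<le> b" "\<And>e. e \<in> G \<Longrightarrow> f e \<le> b"
  obtains p where "joins u v p" "set p \<subseteq> S" "set (steps p) \<subseteq> G" "cost f p \<le> b * card S"
proof -
  obtain p where p: "joins u v p" "distinct p" "set p \<subseteq> S" "set (steps p) \<subseteq> G"
    using assms(1) by (rule linked_distinct)
  have "cost f p \<le> cost (\<lambda>_. b) p" using p assms(4) by (intro cost_mono_fun) auto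
  also have "\<dots> = b * length (steps p)" by (simp add: cost_def sum_list_triv)
  also have "\<dots> \<le> b * card S"
  proof -
    have "length (steps p) \<le> length p" by (simp add: length_steps)
    also have "\<dots> = card (set p)" using p(2) by (simp add: distinct_card)
    also have "\<dots> \<le> card S" using p(3) assms(2) by (simp add: card_mono)
    finally show ?thesis using assms(3) by (intro mult_left_mono) auto
  qed
  finally show thesis using that p by blast
qed

lemma cost_steps_append: "steps p = steps p1 @ steps p2 \<Longrightarrow> cost f p = cost f p1 + cost f p2"
  by (simp add: cost_def)

section \<open>Shells\<close>

text \<open>The supremum norm, whose balls are the cubes below.\<close>

definition infn :: "int ^ 'd \<Rightarrow> int" where
  "infn x = Max (range (\<lambda>i. \<bar>x $ i\<bar>))"

lemma infn_le_iff: "infn x \<le> r \<longleftrightarrow> (\<forall>i. \<bar>x $ i\<bar> \<le> r)"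
  unfolding infn_def by (subst Max_le_iff) auto

lemma comp_le_infn: "\<bar>x $ i\<bar> \<le> infn x"
  using infn_le_iff[of x "infn x"] by blast

lemma infn_attained: obtains i where "\<bar>x $ i\<bar> = infn x"
proof -
  have "infn x \<in> range (\<lambda>i. \<bar>x $ i\<bar>)" unfolding infn_def by (rule Max_in) auto
  then show thesis using that by auto
qed

lemma infn_nonneg: "0 \<le> infn x"
  using comp_le_infn[of x undefined] abs_ge_zero order_trans by blast

lemma infn_triangle: "infn (x + y) \<le> infn x + infn y"
  unfolding infn_le_iff
proof
  fix i show "\<bar>(x + y) $ i\<bar> \<le> infn x + infn y"
    using comp_le_infn[of x i] comp_le_infn[of y i] by simp
qed

lemma infn_minus [simp]: "infn (- x) = infn x"
  by (simp add: infn_def)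

lemma infn_minus_commute: "infn (x - y) = infn (y - x)"
  by (metis infn_minus minus_diff_eq)

lemma infn_zero [simp]: "infn 0 = 0"
  by (simp add: infn_def)

lemma infn_axis [simp]: "infn (axis i k) = \<bar>k\<bar>"
proof (rule antisym)
  show "infn (axis i k) \<le> \<bar>k\<bar>" by (simp add: infn_le_iff axis_def)
  show "\<bar>k\<bar> \<le> infn (axis i k)" using comp_le_infn[of "axis i k" i] by (simp add: axis_def)
qed

lemma infn_smult: "0 \<le> r \<Longrightarrow> infn (r *s z) = r * infn z"
proof (rule antisym)
  assume r: "0 \<le> r"
  show "infn (r *s z) \<le> r * infn z"
    using r by (auto simp: infn_le_iff abs_mult comp_le_infn mult_left_mono)
  obtain i where "\<bar>z $ i\<bar> = infn z" by (rule infn_attained)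
  then show "r * infn z \<le> infn (r *s z)"
    using comp_le_infn[of "r *s z" i] r by (simp add: abs_mult)
qed

definition cube :: "int ^ 'd \<Rightarrow> int \<Rightarrow> (int ^ 'd) set" where
  "cube x r = {y. infn (y - x) \<le> r}"

lemma cube_eq_Pi: "cube x r = vec_lambda ` (Pi UNIV (\<lambda>i. {x $ i - r .. x $ i + r}))"
proof (intro equalityI subsetI)
  fix y assume "y \<in> cube x r"
  then have "\<bar>y $ i - x $ i\<bar> \<le> r" for i by (auto simp: cube_def infn_le_iff)
  then have "y $ i \<in> {x $ i - r .. x $ i + r}" for i by (simp add: abs_le_iff)(smt (verit))
  then show "y \<in> vec_lambda ` (Pi UNIV (\<lambda>i. {x $ i - r .. x $ i + r}))"
    by (intro image_eqI[of _ _ "vec_nth y"]) auto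
next
  fix y assume "y \<in> vec_lambda ` (Pi UNIV (\<lambda>i. {x $ i - r .. x $ i + r}))"
  then obtain f where f: "f \<in> Pi UNIV (\<lambda>i. {x $ i - r .. x $ i + r})" "y = vec_lambda f" by blast
  have "\<bar>f i - x $ i\<bar> \<le> r" for i using Pi_mem[OF f(1), of i] by auto
  then show "y \<in> cube x r" by (simp add: f(2) cube_def infn_le_iff)
qed

lemma finite_cube [simp]: "finite (cube x r)"
  and card_cube: "0 \<le> r \<Longrightarrow> card (cube (x :: int ^ 'd) r) = nat (2 * r + 1) ^ CARD('d)"
proof -
  have P: "Pi UNIV F = PiE UNIV F" for F :: "'d \<Rightarrow> int set" by (simp add: PiE_UNIV_domain Pi_def)
  show "finite (cube x r)" for x :: "int ^ 'a"
    unfolding cube_eq_Pi by (simp add: finite_PiE flip: PiE_UNIV_domain)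
  have "inj (vec_lambda :: _ \<Rightarrow> int ^ 'd)" by (auto intro: injI simp: vec_lambda_inject)
  then have "card (cube x r) = card (Pi\<^sub>E UNIV (\<lambda>i. {x $ i - r .. x $ i + r}))"
    unfolding cube_eq_Pi P by (intro card_image) (auto intro: inj_on_subset)
  then show "card (cube x r) = nat (2 * r + 1) ^ CARD('d)" by (simp add: card_PiE)
qed

lemma infn_adj: "lattice_adj x y \<Longrightarrow> infn (x - y) \<le> 1"
  unfolding infn_le_iff lattice_adj_def
  by (metis (mono_tags, lifting) UNIV_I abs_ge_zero finite member_le_sum vector_minus_component)

text \<open>Discrete intermediate value theorem: \<open>f\<close> rises by at most one per step and
  so cannot jump over \<open>r\<close>.\<close>

lemma walk_intermediate:
  fixes f :: "_ \<Rightarrow> int"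
  assumes "successively lattice_adj p" "p \<noteq> []" "f (hd p) \<le> r" "r \<le> f (last p)"
    "\<And>x y. lattice_adj x y \<Longrightarrow> f y \<le> f x + 1"
  shows "\<exists>y\<in>set p. f y = r"
  using assms(1-4)
proof (induction p rule: steps.induct)
  case (1 x y p)
  show ?case
  proof (cases "f x = r")
    case False
    then have "f y \<le> r" using 1 assms(5)[of x y] by auto
    then show ?thesis using 1 by auto
  qed auto
qed auto

lemma joins_intermediate:
  assumes "joins u v p" "infn (u - x) \<le> r" "r \<le> infn (v - x)"
  obtains y where "y \<in> set p" "infn (y - x) = r"
proof -
  have "\<exists>y\<in>set p. infn (y - x) = r"
  proof (rule walk_intermediate)
    fix a b :: "int ^ 'a" assume "lattice_adj a b"
    then have "infn (b - a) \<le> 1" using infn_adj infn_minus_commute by metis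
    moreover have "infn (b - x) \<le> infn (b - a) + infn (a - x)"
      using infn_triangle[of "b - a" "a - x"] by simp
    ultimately show "infn (b - x) \<le> infn (a - x) + 1" by simp
  qed (use assms in \<open>auto simp: joins_def\<close>)
  then show thesis using that by blast
qed

section \<open>Connectivity by unit steps in boxes and on spheres\<close>

lemma lattice_adj_axis: "\<bar>s\<bar> = 1 \<Longrightarrow> lattice_adj x (x + axis i s)"
  by (simp add: lattice_adj_def axis_def if_distrib[of abs] cong: if_cong)

lemma axis_zero [simp]: "axis i 0 = (0 :: ('a::zero) ^ 'd)"
  by (simp add: axis_def vec_eq_iff)

lemma linked_ray:
  assumes "\<bar>s\<bar> = 1"
  shows "linked UNIV {x + axis i (s * int j) |j. j \<le> n} x (x + axis i (s * int n))"
proof (induction n)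
  case 0
  then show ?case using linked_refl[of x "{x}"] by simp
next
  case (Suc n)
  let ?S = "{x + axis i (s * int j) |j. j \<le> Suc n}"
  have eq: "x + axis i (s * int n) + axis i s = x + axis i (s * int (Suc n))"
    by (simp add: vec_eq_iff axis_def algebra_simps)
  have "linked UNIV ?S x (x + axis i (s * int n))"
    using Suc by (rule linked_mono) (auto intro: le_SucI)
  moreover have "linked UNIV ?S (x + axis i (s * int n)) (x + axis i (s * int (Suc n)))"
    using lattice_adj_axis[OF assms, of "x + axis i (s * int n)" i] unfolding eq
    by (rule linked_edge) (blast intro: le_SucI, blast, blast)
  ultimately show ?case by (rule linked_trans)
qed

text \<open>Kept apart from \<open>linked\<close> because its induction rule carries an arbitrary
  relation \<open>Q\<close> from positive unit steps to all pairs. \<open>Q\<close> may be a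
  relation between points, but also one between the shells centered at these points.\<close>

definition chain :: "(int ^ 'd) set \<Rightarrow> ((int ^ 'd) \<times> (int ^ 'd)) set" where
  "chain S = {(x, y). x \<in> S \<and> y \<in> S \<and> (\<exists>i. y = x + axis i 1 \<or> x = y + axis i 1)}\<^sup>*"

lemma chain_sym: "(x, y) \<in> chain S \<Longrightarrow> (y, x) \<in> chain S"
  unfolding chain_def by (rule symD[OF sym_rtrancl]) (auto simp: sym_def)

lemma chain_trans: "(x, y) \<in> chain S \<Longrightarrow> (y, z) \<in> chain S \<Longrightarrow> (x, z) \<in> chain S"
  unfolding chain_def by (rule rtrancl_trans)

lemma chain_refl [simp]: "(x, x) \<in> chain S"
  by (simp add: chain_def)

lemma chain_induct:
  assumes "(x, y) \<in> chain S" "x \<in> S"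
    "\<And>x. x \<in> S \<Longrightarrow> Q x x"
    "\<And>x y z. x \<in> S \<Longrightarrow> y \<in> S \<Longrightarrow> z \<in> S \<Longrightarrow> Q x y \<Longrightarrow> Q y z \<Longrightarrow> Q x z"
    "\<And>x y. x \<in> S \<Longrightarrow> y \<in> S \<Longrightarrow> Q x y \<Longrightarrow> Q y x"
    "\<And>x i. x \<in> S \<Longrightarrow> x + axis i 1 \<in> S \<Longrightarrow> Q x (x + axis i 1)"
  shows "Q x y"
proof -
  have "y \<in> S \<and> Q x y"
    using assms(1) unfolding chain_def
  proof (induction rule: rtrancl_induct)
    case base
    then show ?case using assms(2,3) by blast
  next
    case (step y z)
    then have "y \<in> S" "z \<in> S" "Q y z" using assms(5,6) by auto
    then show ?case using step.IH assms(2,4) by blast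
  qed
  then show ?thesis by blast
qed

definition upd :: "int ^ 'd \<Rightarrow> 'd \<Rightarrow> int \<Rightarrow> int ^ 'd" where
  "upd x i k = (\<chi> j. if j = i then k else x $ j)"

lemma upd_nth [simp]: "upd x i k $ j = (if j = i then k else x $ j)"
  by (simp add: upd_def)

lemma chain_up:
  assumes "\<And>k. a \<le> k \<Longrightarrow> k \<le> a + int n \<Longrightarrow> upd x i k \<in> S"
  shows "(upd x i a, upd x i (a + int n)) \<in> chain S"
  using assms
proof (induction n)
  case (Suc n)
  have "upd x i (a + int (Suc n)) = upd x i (a + int n) + axis i 1"
    by (simp add: vec_eq_iff axis_def)
  moreover have "upd x i (a + int n) \<in> S" "upd x i (a + int (Suc n)) \<in> S"
    by (rule Suc.prems; simp)+
  ultimately have "(upd x i (a + int n), upd x i (a + int (Suc n))) \<in> chain S"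
    unfolding chain_def by (intro r_into_rtrancl) auto
  moreover have "(upd x i a, upd x i (a + int n)) \<in> chain S" by (rule Suc.IH) (use Suc.prems in simp)
  ultimately show ?case using chain_trans by blast
qed simp

lemma chain_upd:
  assumes "\<And>k. min (x $ i) b \<le> k \<Longrightarrow> k \<le> max (x $ i) b \<Longrightarrow> upd x i k \<in> S"
  shows "(x, upd x i b) \<in> chain S"
proof -
  have x: "upd x i (x $ i) = x" by (simp add: vec_eq_iff)
  show ?thesis
  proof (cases "x $ i \<le> b")
    case True
    then have "b = x $ i + int (nat (b - x $ i))" by simp
    then show ?thesis using chain_up[of "x $ i" "nat (b - x $ i)" x i S] assms x by auto
  next
    case False
    then have "x $ i = b + int (nat (x $ i - b))" by simp
    then show ?thesis using chain_up[of b "nat (x $ i - b)" x i S] assms x False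
      by (auto intro: chain_sym)
  qed
qed

text \<open>The coordinates of \<open>x\<close> are replaced by those of \<open>y\<close> one at a
  time; all points on the way lie in the box spanned by \<open>x\<close> and
  \<open>y\<close>.\<close>

lemma chain_replace:
  fixes x y :: "int ^ 'd"
  assumes "\<And>z. (\<forall>i. min (x $ i) (y $ i) \<le> z $ i \<and> z $ i \<le> max (x $ i) (y $ i)) \<Longrightarrow> z \<in> S"
  shows "(x, y) \<in> chain S"
proof -
  have "(x, \<chi> i. if i \<in> J then y $ i else x $ i) \<in> chain S" if "finite J" for J :: "'d set"
    using that
  proof (induction J rule: finite_induct)
    case empty
    then show ?case by simp
  next
    case (insert j J)
    let ?z = "\<chi> i. if i \<in> J then y $ i else x $ i"
    have "(?z, upd ?z j (y $ j)) \<in> chain S"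
      using insert.hyps(2) by (intro chain_upd assms) auto
    moreover have "upd ?z j (y $ j) = (\<chi> i. if i \<in> insert j J then y $ i else x $ i)"
      by (auto simp: vec_eq_iff)
    ultimately show ?case using chain_trans[OF insert.IH] by simp
  qed
  from this[of UNIV] show ?thesis by simp
qed

lemma chain_cube:
  assumes "u \<in> cube x r" "v \<in> cube x r"
  shows "(u, v) \<in> chain (cube x r)"
proof (rule chain_replace)
  fix z assume z: "\<forall>i. min (u $ i) (v $ i) \<le> z $ i \<and> z $ i \<le> max (u $ i) (v $ i)"
  show "z \<in> cube x r"
    unfolding cube_def mem_Collect_eq infn_le_iff
  proof
    fix i
    have "\<bar>u $ i - x $ i\<bar> \<le> r" "\<bar>v $ i - x $ i\<bar> \<le> r"
      using assms by (auto simp: cube_def infn_le_iff)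
    then show "\<bar>(z - x) $ i\<bar> \<le> r" using z[rule_format, of i] by auto
  qed
qed

lemma chain_linked:
  assumes "(u, v) \<in> chain S" "u \<in> S" "\<And>u v. u \<in> S \<Longrightarrow> v \<in> S \<Longrightarrow> lattice_adj u v \<Longrightarrow> {u, v} \<in> G"
  shows "linked G S u v"
  using assms(1,2)
proof (rule chain_induct[where Q = "linked G S"])
  show "linked G S x (x + axis i 1)" if "x \<in> S" "x + axis i 1 \<in> S" for x i
  proof -
    have "lattice_adj x (x + axis i 1)" by (rule lattice_adj_axis) simp
    then show ?thesis using that assms(3) by (intro linked_edge) auto
  qed
qed (auto intro: linked_refl linked_sym linked_trans)

lemma linked_cube: "u \<in> cube x r \<Longrightarrow> v \<in> cube x r \<Longrightarrow> linked UNIV (cube x r) u v"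
  by (intro chain_linked chain_cube) auto

text \<open>Fixing a coordinate of modulus \<open>r\<close>, the other ones can be moved freely within the sphere. As
  there are at least two coordinates, every point can be moved to the corner \<open>(r, \<dots>, r)\<close>.\<close>

lemma chain_sphere:
  fixes u v :: "int ^ 'd"
  assumes d: "CARD('d) \<ge> 2" and "infn u = r" "infn v = r"
  shows "(u, v) \<in> chain {z. infn z = r}"
proof -
  have r: "0 \<le> r" using assms(2) infn_nonneg by auto
  have corner: "(u, \<chi> i. r) \<in> chain {z. infn z = r}" if u: "infn u = r" for u :: "int ^ 'd"
  proof -
    have memI: "z \<in> {z. infn z = r}" if "\<And>j. \<bar>z $ j\<bar> \<le> r" "\<bar>z $ i\<bar> = r" for z :: "int ^ 'd" and i
      using that infn_le_iff[of z r] comp_le_infn[of z i] by (auto intro!: antisym)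
    obtain i where i: "\<bar>u $ i\<bar> = r" using u infn_attained by metis
    have ur: "\<bar>u $ j\<bar> \<le> r" for j using u comp_le_infn[of u j] by simp
    define w :: "int ^ 'd" where "w = (\<chi> j. if j = i then u $ i else r)"
    have "(u, w) \<in> chain {z. infn z = r}"
    proof (rule chain_replace, rule memI[of _ i])
      fix z assume z: "\<forall>i. min (u $ i) (w $ i) \<le> z $ i \<and> z $ i \<le> max (u $ i) (w $ i)"
      show "\<bar>z $ j\<bar> \<le> r" for j
        using z[rule_format, of j] ur[of j] r by (auto simp: w_def split: if_splits)
      have "z $ i = u $ i" using z[rule_format, of i] by (simp add: w_def)
      then show "\<bar>z $ i\<bar> = r" using i by simp
    qed
    moreover obtain k where k: "k \<noteq> i"
      using d by (metis UNIV_I card_2_iff' card_le_Suc0_iff_eq finite not_less_eq_eq numeral_2_eq_2)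
    have "(w, \<chi> i. r) \<in> chain {z. infn z = r}"
    proof (rule chain_replace, rule memI[of _ k])
      fix z assume z: "\<forall>i. min (w $ i) ((\<chi> i. r) $ i) \<le> z $ i \<and> z $ i \<le> max (w $ i) ((\<chi> i. r) $ i)"
      show "\<bar>z $ j\<bar> \<le> r" for j
        using z[rule_format, of j] ur[of j] r by (auto simp: w_def split: if_splits)
      show "\<bar>z $ k\<bar> = r" using z[rule_format, of k] k r by (simp add: w_def)
    qed
    ultimately show ?thesis by (rule chain_trans)
  qed
  show ?thesis using corner[OF assms(2)] corner[OF assms(3)] chain_sym chain_trans by blast
qed

text \<open>Separation refers to all lattice walks, whereas connectedness uses edges of
  \<open>G\<close> only. Confining the shell to the annulus between radii \<open>r\<close> and
  \<open>2 * r\<close> makes its existence a local event.\<close>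

definition shell :: "(int ^ 'd) set set \<Rightarrow> int ^ 'd \<Rightarrow> int \<Rightarrow> (int ^ 'd) set \<Rightarrow> bool" where
  "shell G x r S \<longleftrightarrow> S \<subseteq> cube x (2 * r) - cube x r \<and> (\<forall>u\<in>S. \<forall>v\<in>S. linked G S u v) \<and>
     (\<forall>u\<in>cube x r. \<forall>v. v \<notin> cube x (2 * r) \<longrightarrow> (\<forall>p. joins u v p \<longrightarrow> set p \<inter> S \<noteq> {}))"

definition has_shell :: "(int ^ 'd) set set \<Rightarrow> int ^ 'd \<Rightarrow> int \<Rightarrow> bool" where
  "has_shell G x r \<longleftrightarrow> (\<exists>S. shell G x r S)"

lemma shell_hit:
  assumes "shell G x r S" "u \<in> cube x r" "v \<notin> cube x (2 * r)" "joins u v p"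
  obtains y where "y \<in> set p" "y \<in> S"
  using assms unfolding shell_def by blast

text \<open>The straight ray from the center leaves the cube of radius \<open>2 * r\<close> and
  therefore has to cross the shell.\<close>

lemma shell_ray:
  assumes "shell G x r S" "0 \<le> r" "\<bar>s\<bar> = 1"
  obtains t where "r < t" "t \<le> 2 * r" "x + axis i (s * t) \<in> S"
proof -
  define n where "n = nat (2 * r + 1)"
  obtain p where p: "joins x (x + axis i (s * int n)) p"
      "set p \<subseteq> {x + axis i (s * int j) |j. j \<le> n}"
    using linked_ray[OF assms(3), of x i n] unfolding linked_def by blast
  have "x \<in> cube x r" using assms(2) by (simp add: cube_def)
  moreover have "x + axis i (s * int n) \<notin> cube x (2 * r)"
    using assms by (simp add: cube_def abs_mult n_def)
  ultimately obtain y where y: "y \<in> set p" "y \<in> S" using shell_hit[OF assms(1) _ _ p(1)] by blast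
  then obtain j where j: "y = x + axis i (s * int j)" using p(2) by blast
  have "y \<in> cube x (2 * r) - cube x r" using y(2) assms(1) by (auto simp: shell_def)
  then show thesis using that[of "int j"] y(2) j assms(3) by (simp add: cube_def abs_mult)
qed

text \<open>This locality yields both the measurability of shell events and their independence for
  distant centers.\<close>

lemma has_shell_local: "has_shell G x r \<longleftrightarrow> has_shell (G \<inter> Pow (cube x (2 * r))) x r"
proof -
  have "linked (G \<inter> Pow (cube x (2 * r))) S u v"
    if "linked G S u v" "S \<subseteq> cube x (2 * r)" for S u v
    using that steps_subset_Pow unfolding linked_def by blast
  moreover have "linked G S u v" if "linked (G \<inter> Pow (cube x (2 * r))) S u v" for S u v
    using that by (rule linked_mono) auto
  ultimately have "shell G x r S \<longleftrightarrow> shell (G \<inter> Pow (cube x (2 * r))) x r S" for S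
    unfolding shell_def by blast
  then show ?thesis by (simp add: has_shell_def)
qed

text \<open>At scale one the sphere of radius 2 serves as a shell: it is connected, and a walk
  leaving the cube of radius 2 has to pass through it.\<close>

lemma shell_base:
  fixes x :: "int ^ 'd"
  assumes d: "CARD('d) \<ge> 2" and G: "lattice_edges \<inter> Pow (cube x 2) \<subseteq> G"
  shows "shell G x 1 {y. infn (y - x) = 2}"
  unfolding shell_def
proof (intro conjI ballI allI impI)
  let ?S = "{y. infn (y - x) = 2}"
  show "?S \<subseteq> cube x (2 * 1) - cube x 1" by (auto simp: cube_def)
  show "linked G ?S u v" if "u \<in> ?S" "v \<in> ?S" for u v
  proof -
    have "(u - x, v - x) \<in> chain {z. infn z = 2}" using that by (intro chain_sphere[OF d]) auto
    then have "linked G ?S (x + (u - x)) (x + (v - x))"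
    proof (rule chain_induct[where Q = "\<lambda>a b. linked G ?S (x + a) (x + b)"])
      fix a :: "int ^ 'd" and i assume a: "a \<in> {z. infn z = 2}" "a + axis i 1 \<in> {z. infn z = 2}"
      have adj: "lattice_adj (x + a) (x + (a + axis i 1))"
        using lattice_adj_axis[of 1 "x + a" i] by (simp add: add.assoc)
      then have "{x + a, x + (a + axis i 1)} \<in> lattice_edges" by (auto simp: lattice_edges_def)
      then show "linked G ?S (x + a) (x + (a + axis i 1))"
        using a G by (intro linked_edge[OF adj]) (auto simp: cube_def)
    qed (use that in \<open>auto intro: linked_refl linked_sym linked_trans\<close>)
    then show ?thesis by simp
  qed
  fix u v p assume "u \<in> cube x 1" "v \<notin> cube x (2 * 1)" "joins u v p"
  then obtain y where "y \<in> set p" "infn (y - x) = 2"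
    by (elim joins_intermediate[of u v p x 2]) (auto simp: cube_def)
  then show "set p \<inter> ?S \<noteq> {}" by blast
qed

text \<open>Shells around neighbouring centers intersect: each of them is connected and meets the axis
  through both centers once inside and once outside the other shell.\<close>

lemma shells_intersect:
  assumes S: "shell G c r S" and T: "shell G (c + axis i r) r T" and r: "0 \<le> r"
  shows "S \<inter> T \<noteq> {}"
proof -
  obtain t where t: "r < t" "t \<le> 2 * r" "c + axis i (1 * t) \<in> S"
    using shell_ray[OF S r, of 1 i] by auto
  obtain t' where t': "r < t'" "t' \<le> 2 * r" "c + axis i (-1 * t') \<in> S"
    using shell_ray[OF S r, of "-1" i] by auto
  obtain p where p: "joins (c + axis i (1 * t)) (c + axis i (-1 * t')) p" "set p \<subseteq> S"
    using S t(3) t'(3) unfolding shell_def linked_def by blast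
  have "axis i t - axis i r = (axis i (t - r) :: int ^ 'a)"
    "axis i (- t') - axis i r = (axis i (- t' - r) :: int ^ 'a)"
    by (simp_all add: axis_def vec_eq_iff)
  then have "c + axis i (1 * t) \<in> cube (c + axis i r) r"
    "c + axis i (-1 * t') \<notin> cube (c + axis i r) (2 * r)"
    using t t' by (simp_all add: cube_def)
  then obtain y where "y \<in> set p" "y \<in> T" using shell_hit[OF T _ _ p(1)] by blast
  then show ?thesis using p(2) by blast
qed

text \<open>The centers lie at distance \<open>r * \<rho>\<close> from \<open>x\<close>, and a small
  shell strays from its center by at most \<open>2 * r\<close>. For \<open>\<rho>\<close> between 13
  and 18 the union therefore stays between the radii \<open>11 * r\<close> and
  \<open>20 * r\<close>. It is connected because shells of neighbouring centers intersect. It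
  separates because a crossing walk comes within \<open>r\<close> of some center and ends more than
  \<open>2 * r\<close> away from it.\<close>

lemma shell_multiscale:
  fixes x :: "int ^ 'd"
  assumes d: "CARD('d) \<ge> 2" and r: "1 \<le> r" and \<rho>: "13 \<le> \<rho>" "\<rho> \<le> 18"
    and S: "\<And>z. infn z = \<rho> \<Longrightarrow> shell G (x + r *s z) r (S z)"
  shows "shell G x (10 * r) (\<Union>z\<in>{z. infn z = \<rho>}. S z)"
  unfolding shell_def
proof (intro conjI ballI allI impI)
  let ?U = "\<Union>z\<in>{z. infn z = \<rho>}. S z"
  have r\<rho>: "13 * r \<le> r * \<rho>" "r * \<rho> \<le> 18 * r" using r \<rho> by (auto simp: mult.commute)
  show "?U \<subseteq> cube x (2 * (10 * r)) - cube x (10 * r)"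
  proof
    fix y assume "y \<in> ?U"
    then obtain z where z: "infn z = \<rho>" "y \<in> S z" by auto
    then have "infn (y - (x + r *s z)) \<le> 2 * r" using S[OF z(1)] by (auto simp: shell_def cube_def)
    moreover have "infn (y - x) \<le> infn (y - (x + r *s z)) + infn (r *s z)"
      using infn_triangle[of "y - (x + r *s z)" "r *s z"] by simp
    moreover have "infn (r *s z) \<le> infn (y - x) + infn (y - (x + r *s z))"
      using infn_triangle[of "y - x" "- (y - (x + r *s z))"] by (simp only: infn_minus) simp
    moreover have "infn (r *s z) = r * \<rho>" using infn_smult[of r z] r z(1) by simp
    ultimately have "infn (y - x) \<le> 2 * (10 * r)" "10 * r < infn (y - x)"
      using r\<rho> r by linarith+
    then show "y \<in> cube x (2 * (10 * r)) - cube x (10 * r)" by (simp add: cube_def)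
  qed
  show "linked G ?U u v" if uv: "u \<in> ?U" "v \<in> ?U" for u v
  proof -
    have same: "linked G ?U u v" if "infn z = \<rho>" "u \<in> S z" "v \<in> S z" for z u v
      using S[OF that(1)] that unfolding shell_def by (blast intro: linked_mono)
    have ne: "S z \<noteq> {}" if "infn z = \<rho>" for z
      using shell_ray[OF S[OF that], of 1] r by fastforce
    obtain z z' where z: "infn z = \<rho>" "u \<in> S z" "infn z' = \<rho>" "v \<in> S z'" using uv by auto
    have "(z, z') \<in> chain {z. infn z = \<rho>}" using z by (intro chain_sphere[OF d]) auto
    then have "\<forall>u\<in>S z. \<forall>v\<in>S z'. linked G ?U u v"
    proof (rule chain_induct[where Q = "\<lambda>z z'. \<forall>u\<in>S z. \<forall>v\<in>S z'. linked G ?U u v"])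
      fix a :: "int ^ 'd" and i assume a: "a \<in> {z. infn z = \<rho>}" "a + axis i 1 \<in> {z. infn z = \<rho>}"
      have "x + r *s (a + axis i 1) = x + r *s a + axis i r"
        by (simp add: vec_eq_iff axis_def algebra_simps)
      then have "shell G (x + r *s a + axis i r) r (S (a + axis i 1))"
        using S[of "a + axis i 1"] a(2) by (metis mem_Collect_eq)
      then have "S a \<inter> S (a + axis i 1) \<noteq> {}"
        using a(1) r by (intro shells_intersect[OF S]) auto
      then obtain w where "w \<in> S a" "w \<in> S (a + axis i 1)" by blast
      then show "\<forall>u\<in>S a. \<forall>v\<in>S (a + axis i 1). linked G ?U u v"
        by (intro ballI linked_trans[OF same[of a _ w] same[of "a + axis i 1" w]])
          (use a in \<open>simp_all only: mem_Collect_eq\<close>)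
    next
      fix a b c assume "a \<in> {z. infn z = \<rho>}" "b \<in> {z. infn z = \<rho>}"
        and *: "\<forall>u\<in>S a. \<forall>v\<in>S b. linked G ?U u v" "\<forall>u\<in>S b. \<forall>v\<in>S c. linked G ?U u v"
      then obtain w where "w \<in> S b" using ne by blast
      then show "\<forall>u\<in>S a. \<forall>v\<in>S c. linked G ?U u v" using * linked_trans by blast
    next
      show "\<forall>u\<in>S b. \<forall>v\<in>S a. linked G ?U u v" if "\<forall>u\<in>S a. \<forall>v\<in>S b. linked G ?U u v" for a b
        using that linked_sym by blast
    qed (use z same in auto)
    then show ?thesis using z by blast
  qed
  fix u v p assume u: "u \<in> cube x (10 * r)" and v: "v \<notin> cube x (2 * (10 * r))" and p: "joins u v p"
  obtain y where y: "y \<in> set p" "infn (y - x) = r * \<rho>"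
    using p u v r\<rho> by (elim joins_intermediate[of u v p x "r * \<rho>"]) (auto simp: cube_def)
  define q where "q = y - x"
  \<comment> \<open>This rounds \<open>q / r\<close> towards zero in every coordinate. A coordinate
    of modulus \<open>r * \<rho>\<close> becomes one of modulus exactly \<open>\<rho>\<close>, so
    that \<open>z\<close> is one of the given centers, and the rounding error is less than
    \<open>r\<close>.\<close>
  define z :: "int ^ 'd" where "z = (\<chi> i. if 0 \<le> q $ i then q $ i div r else - ((- q $ i) div r))"
  have abs_z: "\<bar>z $ i\<bar> = \<bar>q $ i\<bar> div r" for i
    using r pos_imp_zdiv_nonneg_iff[of r] by (auto simp: z_def)
  have "infn z = \<rho>"
  proof (rule antisym)
    show "infn z \<le> \<rho>"
      unfolding infn_le_iff abs_z
    proof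
      fix i have "\<bar>q $ i\<bar> \<le> r * \<rho>" using comp_le_infn[of q i] y(2) by (simp add: q_def)
      then have "\<bar>q $ i\<bar> div r \<le> (r * \<rho>) div r" using r by (intro zdiv_mono1) auto
      then show "\<bar>q $ i\<bar> div r \<le> \<rho>" using r by simp
    qed
    obtain i where "\<bar>q $ i\<bar> = r * \<rho>" using infn_attained y(2) unfolding q_def by metis
    then show "\<rho> \<le> infn z" using comp_le_infn[of z i] abs_z[of i] r by simp
  qed
  have "y \<in> cube (x + r *s z) r"
    unfolding cube_def mem_Collect_eq infn_le_iff
  proof
    fix i
    have "(y - (x + r *s z)) $ i = q $ i - r * z $ i" by (simp add: q_def)
    moreover have "\<bar>q $ i - r * z $ i\<bar> \<le> r"
    proof (cases "0 \<le> q $ i")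
      case True
      then have "q $ i - r * z $ i = q $ i mod r" by (simp add: z_def minus_mult_div_eq_mod)
      then show ?thesis using r pos_mod_bound[of r "q $ i"] pos_mod_sign[of r "q $ i"] by linarith
    next
      case False
      then have "- (q $ i - r * z $ i) = (- q $ i) mod r"
        using minus_mult_div_eq_mod[of "- q $ i" r] by (simp add: z_def)
      then show ?thesis using r pos_mod_bound[of r "- q $ i"] pos_mod_sign[of r "- q $ i"] by linarith
    qed
    ultimately show "\<bar>(y - (x + r *s z)) $ i\<bar> \<le> r" by simp
  qed
  moreover have "v \<notin> cube (x + r *s z) (2 * r)"
  proof -
    have "infn (v - x) \<le> infn (v - (x + r *s z)) + infn (r *s z)"
      using infn_triangle[of "v - (x + r *s z)" "r *s z"] by simp
    moreover have "infn (r *s z) = r * \<rho>" using infn_smult[of r z] r \<open>infn z = \<rho>\<close> by simp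
    moreover have "20 * r < infn (v - x)" using v by (simp add: cube_def)
    ultimately have "2 * r < infn (v - (x + r *s z))" using r\<rho> by linarith
    then show ?thesis by (simp add: cube_def)
  qed
  moreover obtain p1 p2 where "joins y v p2" "set p = set p1 \<union> set p2"
    using joins_split[OF p y(1)] by metis
  ultimately obtain w where "w \<in> set p" "w \<in> S z"
    using shell_hit[OF S[OF \<open>infn z = \<rho>\<close>]] by (metis UnI2)
  then show "set p \<inter> ?U \<noteq> {}" using \<open>infn z = \<rho>\<close> by blast
qed

section \<open>Translations of edges, walks and shells\<close>

definition tr :: "int ^ 'd \<Rightarrow> (int ^ 'd) set \<Rightarrow> (int ^ 'd) set" where
  "tr v e = (\<lambda>y. y + v) ` e"

lemma tr_tr [simp]: "tr u (tr v e) = tr (v + u) e"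
  by (auto simp: tr_def image_image add.assoc)

lemma tr_zero [simp]: "tr 0 e = e"
  by (simp add: tr_def)

lemma joins_translate_imp:
  assumes "joins x y p" shows "joins (x + v) (y + v) (map (\<lambda>y. y + v) p)"
  using assms unfolding joins_def
  by (auto simp: successively_map hd_map last_map lattice_adj_def)

lemma joins_translate:
  "joins (x + v) (y + v) p \<longleftrightarrow> (\<exists>q. joins x y q \<and> p = map (\<lambda>y. y + v) q)"
proof
  assume "joins (x + v) (y + v) p"
  from joins_translate_imp[OF this, of "- v"] have "joins x y (map (\<lambda>y. y + - v) p)" by simp
  moreover have "p = map (\<lambda>y. y + v) (map (\<lambda>y. y + - v) p)" by (simp add: comp_def)
  ultimately show "\<exists>q. joins x y q \<and> p = map (\<lambda>y. y + v) q" by blast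
qed (auto intro: joins_translate_imp)

lemma tr_lattice_edges [simp]: "tr v e \<in> lattice_edges \<longleftrightarrow> e \<in> lattice_edges"
proof -
  have *: "tr v e \<in> lattice_edges" if e: "e \<in> lattice_edges" for e :: "(int ^ 'd) set" and v
  proof -
    obtain x y where "e = {x, y}" "lattice_adj x y" using e unfolding lattice_edges_def by blast
    then have "tr v e = {x + v, y + v}" "lattice_adj (x + v) (y + v)"
      by (simp_all add: tr_def lattice_adj_def)
    then show ?thesis unfolding lattice_edges_def by blast
  qed
  show ?thesis using *[of e v] *[of "tr v e" "- v"] by auto
qed

lemma linked_translate:
  assumes "linked (tr v -` G) S a b" shows "linked G ((\<lambda>y. y + v) ` S) (a + v) (b + v)"
proof -
  obtain p where "joins a b p" "set p \<subseteq> S" "set (steps p) \<subseteq> tr v -` G"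
    using assms unfolding linked_def by blast
  then show ?thesis unfolding linked_def
    by (intro exI[of _ "map (\<lambda>y. y + v) p"])
      (auto simp: joins_translate_imp steps_map tr_def vimage_def)
qed

lemma cube_translate: "y + v \<in> cube (x + v) r \<longleftrightarrow> y \<in> cube x r"
  by (simp add: cube_def)

text \<open>The preimage of \<open>G\<close> under \<open>tr v\<close> is the edge set
  \<open>G\<close> as seen from \<open>v\<close>.\<close>

lemma shell_translate:
  assumes "shell (tr v -` G) x r S" shows "shell G (x + v) r ((\<lambda>y. y + v) ` S)"
  unfolding shell_def
proof (intro conjI ballI allI impI)
  show "(\<lambda>y. y + v) ` S \<subseteq> cube (x + v) (2 * r) - cube (x + v) r"
    using assms by (auto simp: shell_def cube_translate)
  show "linked G ((\<lambda>y. y + v) ` S) a b" if "a \<in> (\<lambda>y. y + v) ` S" "b \<in> (\<lambda>y. y + v) ` S" for a b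
  proof -
    obtain a' b' where ab: "a = a' + v" "b = b' + v" "a' \<in> S" "b' \<in> S" using \<open>a \<in> _\<close> \<open>b \<in> _\<close> by blast
    then have "linked (tr v -` G) S a' b'" using assms unfolding shell_def by blast
    then show ?thesis unfolding ab by (rule linked_translate)
  qed
  fix a b p assume a: "a \<in> cube (x + v) r" "b \<notin> cube (x + v) (2 * r)" "joins a b p"
  then obtain q where q: "joins (a - v) (b - v) q" "p = map (\<lambda>y. y + v) q"
    using joins_translate[of "a - v" v "b - v" p] by auto
  have "a - v \<in> cube x r" "b - v \<notin> cube x (2 * r)"
    using a cube_translate[of "a - v" v x] cube_translate[of "b - v" v x] by auto
  then obtain y where "y \<in> set q" "y \<in> S" using shell_hit[OF assms _ _ q(1)] by blast
  then show "set p \<inter> (\<lambda>y. y + v) ` S \<noteq> {}" by (auto simp: q(2))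
qed

lemma has_shell_translate: "has_shell G (x + v) r \<longleftrightarrow> has_shell (tr v -` G) x r"
proof
  assume "has_shell G (x + v) r"
  moreover have "G = tr (- v) -` (tr v -` G)" by (auto simp: vimage_def)
  ultimately have "has_shell (tr v -` G) (x + v + - v) r"
    using shell_translate unfolding has_shell_def by metis
  then show "has_shell (tr v -` G) x r" by simp
qed (use shell_translate in \<open>unfold has_shell_def, blast\<close>)

section \<open>Probability of shells\<close>

text \<open>The ratio of consecutive terms is \<open>B * (1 / 2) ^ (2 ^ k)\<close>, which tends to
  zero. Thus the failure probabilities beat cube volumes of any fixed power of
  \<open>10 ^ k\<close>.\<close>

lemma summable_doubly_exponential:
  fixes B :: real
  assumes "0 \<le> B"
  shows "summable (\<lambda>k. B ^ k * (1 / 2) ^ (2 ^ k))"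
proof -
  have "(\<lambda>n. B * (1 / 2) ^ n) \<longlonglongrightarrow> B * 0" by (intro tendsto_intros LIMSEQ_realpow_zero) auto
  then have "eventually (\<lambda>n. B * (1 / 2) ^ n < 1 / 2) sequentially"
    by (rule order_tendstoD) auto
  then obtain N where N: "\<And>n. n \<ge> N \<Longrightarrow> B * (1 / 2) ^ n < 1 / 2"
    unfolding eventually_sequentially by blast
  show ?thesis
  proof (rule summable_ratio_test[of "1 / 2" N])
    fix n assume n: "N \<le> n"
    have "(1 / 2 :: real) ^ (2 ^ n) \<le> (1 / 2) ^ n"
      by (intro power_decreasing) (auto simp: less_imp_le)
    then have "B * (1 / 2) ^ (2 ^ n) \<le> 1 / 2"
      using N[OF n] mult_left_mono[OF _ assms, of "(1 / 2) ^ (2 ^ n)" "(1 / 2) ^ n"] by linarith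
    then have "(B * (1 / 2) ^ (2 ^ n)) * (B ^ n * (1 / 2) ^ (2 ^ n))
        \<le> 1 / 2 * (B ^ n * (1 / 2) ^ (2 ^ n))"
      using assms by (intro mult_right_mono) auto
    moreover have "B ^ Suc n * (1 / 2) ^ (2 ^ Suc n) = (B * (1 / 2) ^ (2 ^ n)) * (B ^ n * (1 / 2) ^
        (2 ^ n))"
      by (simp add: power_mult[symmetric] mult_2 power_add)
    moreover have norm: "norm (B ^ m * (1 / 2) ^ (2 ^ m)) = B ^ m * (1 / 2) ^ (2 ^ m)" for m
      using assms by (simp add: abs_mult)
    ultimately show "norm (B ^ Suc n * (1 / 2) ^ (2 ^ Suc n)) \<le> 1 / 2 * norm (B ^ n * (1 / 2) ^ (2 ^ n))"
      unfolding norm by linarith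
  qed simp
qed

section \<open>Events depending on finitely many edges, and independence of disjoint
  coordinates\<close>

lemma measurable_finite_Collect:
  assumes "finite F" "\<And>e. e \<in> F \<Longrightarrow> Measurable.pred N (P e)"
  shows "Measurable.pred N (\<lambda>\<tau>. Q {e \<in> F. P e \<tau>})"
proof -
  \<comment> \<open>The random set takes only finitely many values \<open>D\<close>; splitting
    according to them needs no measurability of \<open>Q\<close>.\<close>
  have "Q {e \<in> F. P e \<tau>} \<longleftrightarrow> (\<exists>D\<in>Pow F. Q D \<and> (\<forall>e\<in>F. P e \<tau> \<longleftrightarrow> e \<in> D))" for \<tau>
  proof
    assume "Q {e \<in> F. P e \<tau>}"
    then show "\<exists>D\<in>Pow F. Q D \<and> (\<forall>e\<in>F. P e \<tau> \<longleftrightarrow> e \<in> D)" by (intro bexI[of _ "{e \<in> F. P e \<tau>}"]) auto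
  next
    assume "\<exists>D\<in>Pow F. Q D \<and> (\<forall>e\<in>F. P e \<tau> \<longleftrightarrow> e \<in> D)"
    then obtain D where "D \<subseteq> F" "Q D" "\<forall>e\<in>F. P e \<tau> \<longleftrightarrow> e \<in> D" by auto
    moreover from this have "{e \<in> F. P e \<tau>} = D" by auto
    ultimately show "Q {e \<in> F. P e \<tau>}" by simp
  qed
  moreover have "Measurable.pred N (\<lambda>\<tau>. \<exists>D\<in>Pow F. Q D \<and> (\<forall>e\<in>F. P e \<tau> \<longleftrightarrow> e \<in> D))"
    using assms
    by (intro pred_intros_finite pred_intros_logic pred_intros_countable_bounded) auto
  ultimately show ?thesis by simp
qed

lemma indep_vars_coordinates:
  assumes M: "\<And>i. prob_space (N i)" and I: "I \<noteq> {}"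
  shows "prob_space.indep_vars (PiM I N) N (\<lambda>i \<omega>. \<omega> i) I"
proof -
  interpret product_prob_space N I by (simp add: product_prob_space_def product_prob_space_axioms_def
    product_sigma_finite_def M prob_space_imp_sigma_finite)
  interpret P: prob_space "PiM I N" by (rule prob_space_PiM) (rule M)
  show ?thesis
  proof (subst P.indep_vars_iff_distr_eq_PiM'[OF I])
    show "(\<lambda>\<omega>. \<omega> i) \<in> measurable (PiM I N) (N i)" if "i \<in> I" for i using that by simp
    have "distr (PiM I N) (PiM I N) (\<lambda>x. \<lambda>i\<in>I. x i) = distr (PiM I N) (PiM I N) (\<lambda>x. x)"
      by (intro distr_cong) (auto simp: space_PiM PiE_def extensional_restrict)
    also have "\<dots> = PiM I N" by (simp add: distr_id2)
    also have "\<dots> = (\<Pi>\<^sub>M i\<in>I. distr (PiM I N) (N i) (\<lambda>\<omega>. \<omega> i))"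
      by (intro PiM_cong) (auto simp: PiM_component)
    finally show "distr (PiM I N) (PiM I N) (\<lambda>x. \<lambda>i\<in>I. x i) =
      (\<Pi>\<^sub>M i\<in>I. distr (PiM I N) (N i) (\<lambda>\<omega>. \<omega> i))" .
  qed
qed

lemma indep_disjoint_coordinates:
  assumes M: "\<And>i. prob_space (N i)" and I: "I \<noteq> {}" and IJ: "A \<inter> B = {}" "A \<subseteq> I" "B \<subseteq> I"
    and XY: "X \<in> sets (PiM A N)" "Y \<in> sets (PiM B N)"
  shows "measure (PiM I N) {\<omega> \<in> space (PiM I N). restrict \<omega> A \<in> X \<and> restrict \<omega> B \<in> Y} =
    measure (PiM I N) {\<omega> \<in> space (PiM I N). restrict \<omega> A \<in> X} *
    measure (PiM I N) {\<omega> \<in> space (PiM I N). restrict \<omega> B \<in> Y}"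
proof -
  interpret P: prob_space "PiM I N" by (rule prob_space_PiM) (rule M)
  from P.indep_varD[OF P.indep_var_restrict[OF indep_vars_coordinates[OF M I] IJ] XY]
  show ?thesis by (simp add: vimage_def Int_def conj_commute)
qed

lemma lattice_edges_nonempty: "lattice_edges \<noteq> {}"
proof -
  have "lattice_adj (0 :: int ^ 'd) (0 + axis undefined 1)" by (rule lattice_adj_axis) simp
  then have "{0 :: int ^ 'd, 0 + axis undefined 1} \<in> lattice_edges" unfolding lattice_edges_def by blast
  then show ?thesis by blast
qed

text \<open>\<open>tail\<close> starts the induction over scales. The factor
  \<open>2 ^ (5 ^ CARD('d))\<close> crudely bounds the number of edges in a cube of radius 2, as
  edges are subsets of its \<open>5 ^ CARD('d)\<close> sites. \<open>37 ^ CARD('d)\<close> is the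
  number of sites in a cube of radius 18; it is squared because two centers are chosen.
  \<open>D\<close> fixes the dimension.\<close>

locale fpp_law =
  fixes L :: "real measure" and M :: real and D :: "'d::finite itself"
  assumes edge_law: "L \<in> edge_laws" and dim: "CARD('d) \<ge> 2" and M_ge_1: "1 \<le> M"
    and tail: "measure L {M<..} * (2 ^ (5 ^ CARD('d)) * (37 ^ CARD('d))\<^sup>2) \<le> 1 / 2"
begin

abbreviation PM :: "((int ^ 'd) set \<Rightarrow> real) measure" where
  "PM \<equiv> Pi\<^sub>M lattice_edges (\<lambda>_. L)"

sublocale L: prob_space L
  using edge_law by (simp add: edge_laws_def)

sublocale P: prob_space PM
  by (rule prob_space_PiM) (rule L.prob_space_axioms)

lemma sets_L [measurable_cong, simp]: "sets L = sets borel"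
  using edge_law by (simp add: edge_laws_def)

lemma space_L [simp]: "space L = UNIV"
  using sets_eq_imp_space_eq[OF sets_L] by simp

definition good :: "((int ^ 'd) set \<Rightarrow> real) \<Rightarrow> (int ^ 'd) set set" where
  "good \<tau> = {e \<in> lattice_edges. \<tau> e \<le> M}"

definition near_edges :: "nat \<Rightarrow> int ^ 'd \<Rightarrow> (int ^ 'd) set set" where
  "near_edges k x = lattice_edges \<inter> Pow (cube x (2 * 10 ^ k))"

lemma near_edges_subset: "near_edges k x \<subseteq> lattice_edges"
  and finite_near_edges [simp]: "finite (near_edges k x)"
  by (auto simp: near_edges_def)

lemma has_shell_near: "has_shell (good \<tau>) x (10 ^ k) \<longleftrightarrow>
    has_shell {e \<in> near_edges k x. \<tau> e \<le> M} x (10 ^ k)"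
proof -
  have "good \<tau> \<inter> Pow (cube x (2 * 10 ^ k)) = {e \<in> near_edges k x. \<tau> e \<le> M}"
    by (auto simp: good_def near_edges_def)
  then show ?thesis using has_shell_local[of "good \<tau>" x "10 ^ k"] by simp
qed

lemma measurable_shell_near:
  assumes "near_edges k x \<subseteq> I"
  shows "Measurable.pred (Pi\<^sub>M I (\<lambda>_. L)) (\<lambda>\<tau>. has_shell {e \<in> near_edges k x. \<tau> e \<le> M} x (10 ^ k))"
proof (rule measurable_finite_Collect[where Q = "\<lambda>G. has_shell G x (10 ^ k)"])
  fix e assume "e \<in> near_edges k x"
  then have [measurable]: "(\<lambda>\<tau>. \<tau> e) \<in> measurable (Pi\<^sub>M I (\<lambda>_. L)) borel"
    using assms measurable_component_singleton[of e I "\<lambda>_. L"] by auto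
  show "Measurable.pred (Pi\<^sub>M I (\<lambda>_. L)) (\<lambda>\<tau>. \<tau> e \<le> M)" by measurable
qed simp

lemma measurable_shell [measurable]:
  "Measurable.pred PM (\<lambda>\<tau>. has_shell (good \<tau>) x (10 ^ k))"
  unfolding has_shell_near by (rule measurable_shell_near[OF near_edges_subset])

definition no_shell :: "nat \<Rightarrow> int ^ 'd \<Rightarrow> ((int ^ 'd) set \<Rightarrow> real) set" where
  "no_shell k x = {\<tau> \<in> space PM. \<not> has_shell (good \<tau>) x (10 ^ k)}"

lemma no_shell_sets [measurable]: "no_shell k x \<in> sets PM"
  unfolding no_shell_def by measurable

text \<open>The cubes of radius \<open>2 * 10 ^ k\<close> that decide the two events are
  disjoint.\<close>

lemma no_shell_indep:
  assumes "4 * 10 ^ k < infn (x - y)"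
  shows "P.prob (no_shell k x \<inter> no_shell k y) = P.prob (no_shell k x) * P.prob (no_shell k y)"
proof -
  let ?B = "\<lambda>x. {\<tau> \<in> space (Pi\<^sub>M (near_edges k x) (\<lambda>_. L)).
    \<not> has_shell {e \<in> near_edges k x. \<tau> e \<le> M} x (10 ^ k)}"
  have eq: "\<tau> \<in> no_shell k x \<longleftrightarrow> restrict \<tau> (near_edges k x) \<in> ?B x" if "\<tau> \<in> space PM" for x \<tau>
  proof -
    have "{e \<in> near_edges k x. restrict \<tau> (near_edges k x) e \<le> M} = {e \<in> near_edges k x. \<tau> e \<le> M}"
      by auto
    moreover have "restrict \<tau> (near_edges k x) \<in> space (Pi\<^sub>M (near_edges k x) (\<lambda>_. L))"
      by (auto simp: space_PiM)
    ultimately show ?thesis using that by (simp add: no_shell_def has_shell_near)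
  qed
  have sub: "no_shell k x \<subseteq> space PM" for x by (auto simp: no_shell_def)
  have eqs: "no_shell k x = {\<tau> \<in> space PM. restrict \<tau> (near_edges k x) \<in> ?B x}" for x
    using eq sub by blast
  have "near_edges k x \<inter> near_edges k y = {}"
  proof (rule ccontr)
    assume "near_edges k x \<inter> near_edges k y \<noteq> {}"
    then obtain e where e: "e \<in> lattice_edges" "e \<subseteq> cube x (2 * 10 ^ k)" "e \<subseteq> cube y (2 * 10 ^ k)"
      by (auto simp: near_edges_def)
    then obtain z where "z \<in> e" by (auto simp: lattice_edges_def)
    then have "infn (z - x) \<le> 2 * 10 ^ k" "infn (z - y) \<le> 2 * 10 ^ k" using e by (auto simp: cube_def)
    moreover have "infn (x - y) \<le> infn (- (z - x)) + infn (z - y)"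
      using infn_triangle[of "- (z - x)" "z - y"] by simp
    ultimately show False using assms by (simp only: infn_minus)
  qed
  moreover have "?B x \<in> sets (Pi\<^sub>M (near_edges k x) (\<lambda>_. L))" for x
    using measurable_shell_near[of k x "near_edges k x"] by measurable
  ultimately have "measure PM {\<omega> \<in> space PM. restrict \<omega> (near_edges k x) \<in> ?B x
      \<and> restrict \<omega> (near_edges k y) \<in> ?B y} =
    measure PM {\<omega> \<in> space PM. restrict \<omega> (near_edges k x) \<in> ?B x} *
    measure PM {\<omega> \<in> space PM. restrict \<omega> (near_edges k y) \<in> ?B y}"
    by (intro indep_disjoint_coordinates near_edges_subset L.prob_space_axioms lattice_edges_nonempty)
  moreover have "no_shell k x \<inter> no_shell k y =
      {\<omega> \<in> space PM. restrict \<omega> (near_edges k x) \<in> ?B x \<and> restrict \<omega> (near_edges k y) \<in> ?B y}"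
    using eq sub by blast
  ultimately show ?thesis using eqs by simp
qed

lemma no_shell_base: "P.prob (no_shell 0 x) \<le> 2 ^ (5 ^ CARD('d)) * measure L {M<..}"
proof -
  let ?E = "\<lambda>e. {\<tau> \<in> space PM. M < \<tau> e}"
  have E: "?E e \<in> sets PM" "P.prob (?E e) = measure L {M<..}" if "e \<in> near_edges 0 x" for e
  proof -
    have e: "e \<in> lattice_edges" using that near_edges_subset by auto
    then have [measurable]: "(\<lambda>\<tau>. \<tau> e) \<in> measurable PM borel"
      using measurable_component_singleton[of e lattice_edges "\<lambda>_. L"] by simp
    show "?E e \<in> sets PM" by measurable
    interpret product_prob_space "\<lambda>_. L" "lattice_edges :: (int ^ 'd) set set"
      by (simp add: product_prob_space_def product_prob_space_axioms_def
        product_sigma_finite_def L.prob_space_axioms L.sigma_finite_measure_axioms)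
    have "P.prob (?E e) = measure (distr PM L (\<lambda>\<tau>. \<tau> e)) {M<..}"
      using e by (subst measure_distr) (auto simp: vimage_def Int_def conj_commute)
    then show "P.prob (?E e) = measure L {M<..}" using PiM_component[OF e] by simp
  qed
  have "no_shell 0 x \<subseteq> (\<Union>e\<in>near_edges 0 x. ?E e)"
  proof
    fix \<tau> assume \<tau>: "\<tau> \<in> no_shell 0 x"
    show "\<tau> \<in> (\<Union>e\<in>near_edges 0 x. ?E e)"
    proof (rule ccontr)
      assume "\<tau> \<notin> (\<Union>e\<in>near_edges 0 x. ?E e)"
      then have "lattice_edges \<inter> Pow (cube x 2) \<subseteq> good \<tau>"
        using \<tau> by (auto simp: near_edges_def good_def no_shell_def not_less)
      then have "has_shell (good \<tau>) x 1" using shell_base[OF dim] unfolding has_shell_def by blast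
      then show False using \<tau> by (simp add: no_shell_def)
    qed
  qed
  then have "P.prob (no_shell 0 x) \<le> P.prob (\<Union>e\<in>near_edges 0 x. ?E e)"
    using E(1) by (intro P.finite_measure_mono) auto
  also have "\<dots> \<le> (\<Sum>e\<in>near_edges 0 x. P.prob (?E e))"
    using E(1) by (intro P.finite_measure_subadditive_finite) auto
  also have "\<dots> = card (near_edges 0 x) * measure L {M<..}" using E(2) by simp
  also have "\<dots> \<le> 2 ^ (5 ^ CARD('d)) * measure L {M<..}"
  proof (rule mult_right_mono)
    have "card (near_edges 0 x) \<le> card (Pow (cube x 2))"
      by (intro card_mono) (auto simp: near_edges_def)
    also have "\<dots> = 2 ^ (5 ^ CARD('d))" by (simp add: card_Pow card_cube)
    finally show "real (card (near_edges 0 x)) \<le> 2 ^ (5 ^ CARD('d))"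
      by (metis of_nat_le_iff of_nat_numeral of_nat_power)
  qed simp
  finally show ?thesis .
qed

text \<open>No shell at scale \<open>10 ^ (k + 1)\<close> forces a failure at scale \<open>10 ^ k\<close> in each of two far apart
  layers of centers, so that the failure probabilities are squared from one scale to the next.\<close>

lemma no_shell_step: "no_shell (Suc k) x \<subseteq>
    (\<Union>z\<in>{z. infn z = 13}. \<Union>z'\<in>{z. infn z = 18}. no_shell k (x + 10 ^ k *s z) \<inter> no_shell k (x + 10 ^
        k *s z'))"
proof
  fix \<tau> assume \<tau>: "\<tau> \<in> no_shell (Suc k) x"
  have "\<exists>z. infn z = \<rho> \<and> \<tau> \<in> no_shell k (x + 10 ^ k *s z)" if \<rho>: "13 \<le> \<rho>" "\<rho> \<le> 18" for \<rho>
  proof (rule ccontr)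
    assume "\<nexists>z. infn z = \<rho> \<and> \<tau> \<in> no_shell k (x + 10 ^ k *s z)"
    then have "\<forall>z. \<exists>S. infn z = \<rho> \<longrightarrow> shell (good \<tau>) (x + 10 ^ k *s z) (10 ^ k) S"
      using \<tau> by (auto simp: no_shell_def has_shell_def)
    then obtain S where "\<And>z. infn z = \<rho> \<Longrightarrow> shell (good \<tau>) (x + 10 ^ k *s z) (10 ^ k) (S z)"
      by metis
    from shell_multiscale[OF dim _ \<rho> this] have "has_shell (good \<tau>) x (10 * 10 ^ k)"
      by (auto simp: has_shell_def)
    then show False using \<tau> by (simp add: no_shell_def)
  qed
  from this[of 13] this[of 18] show "\<tau> \<in> (\<Union>z\<in>{z. infn z = 13}. \<Union>z'\<in>{z. infn z = 18}.
      no_shell k (x + 10 ^ k *s z) \<inter> no_shell k (x + 10 ^ k *s z'))"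
    by auto
qed

text \<open>With \<open>N = 37 ^ CARD('d)\<close> there are at most \<open>N * N\<close> pairs of
  failing centers, and each pair has probability at most the square of the bound at scale
  \<open>k\<close>. The denominator \<open>N\<^sup>2\<close> is chosen so that this reproduces the
  bound at the next scale.\<close>

lemma prob_no_shell: "P.prob (no_shell k x) \<le> (1 / 2) ^ (2 ^ k) / (37 ^ CARD('d))\<^sup>2"
proof (induction k arbitrary: x)
  case 0
  have "P.prob (no_shell 0 x) * (37 ^ CARD('d))\<^sup>2 \<le> 2 ^ (5 ^ CARD('d)) * measure L {M<..} * (37 ^
      CARD('d))\<^sup>2"
    by (intro mult_right_mono no_shell_base) auto
  also have "\<dots> \<le> 1 / 2" using tail by (simp add: mult_ac)
  finally show ?case by (simp add: pos_le_divide_eq)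
next
  case (Suc k)
  define N :: real where "N = 37 ^ CARD('d)"
  define q :: real where "q = (1 / 2) ^ (2 ^ k) / N\<^sup>2"
  have q0: "0 \<le> q" by (simp add: q_def)
  let ?S = "\<lambda>\<rho>::int. {z :: int ^ 'd. infn z = \<rho>}"
  let ?I = "\<lambda>z z'. no_shell k (x + 10 ^ k *s z) \<inter> no_shell k (x + 10 ^ k *s z')"
  have sub: "?S \<rho> \<subseteq> cube 0 18" if "\<rho> \<le> 18" for \<rho> using that by (auto simp: cube_def)
  have fin: "finite (?S \<rho>)" if "\<rho> \<le> 18" for \<rho>
    using finite_subset[OF sub[OF that]] by simp
  have card: "real (card (?S \<rho>)) \<le> N" if "\<rho> \<le> 18" for \<rho>
  proof -
    have "card (?S \<rho>) \<le> card (cube (0 :: int ^ 'd) 18)" by (intro card_mono sub that) simp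
    also have "\<dots> = 37 ^ CARD('d)" by (simp add: card_cube)
    finally show ?thesis unfolding N_def by (metis of_nat_le_iff of_nat_numeral of_nat_power)
  qed
  have I: "P.prob (?I z z') \<le> q * q" if z: "infn z = 13" "infn z' = 18" for z z'
  proof -
    \<comment> \<open>The layers are \<open>18 - 13 = 5\<close> units of \<open>10 ^ k\<close>
      apart, more than the 4 units that independence requires.\<close>
    have "5 * 10 ^ k \<le> infn ((x + 10 ^ k *s z) - (x + 10 ^ k *s z'))"
    proof -
      have "infn z' \<le> infn (z' - z) + infn z" using infn_triangle[of "z' - z" z] by simp
      then have "5 \<le> infn (z - z')" using z infn_minus_commute[of z z'] by simp
      moreover have "(x + 10 ^ k *s z) - (x + 10 ^ k *s z') = 10 ^ k *s (z - z')"
        by (simp add: vec_eq_iff algebra_simps)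
      moreover have "infn (10 ^ k *s (z - z')) = 10 ^ k * infn (z - z')" by (rule infn_smult) simp
      ultimately show ?thesis by simp
    qed
    then have "P.prob (?I z z') = P.prob (no_shell k (x + 10 ^ k *s z)) * P.prob (no_shell k (x + 10
        ^ k *s z'))"
      by (intro no_shell_indep) (smt (verit) zero_less_power)
    also have "\<dots> \<le> q * q" using Suc.IH q0 by (intro mult_mono) (auto simp: q_def N_def)
    finally show ?thesis .
  qed
  have "P.prob (no_shell (Suc k) x) \<le> P.prob (\<Union>z\<in>?S 13. \<Union>z'\<in>?S 18. ?I z z')"
    by (intro P.finite_measure_mono no_shell_step sets.finite_UN fin) auto
  also have "\<dots> \<le> (\<Sum>z\<in>?S 13. P.prob (\<Union>z'\<in>?S 18. ?I z z'))"
    by (intro P.finite_measure_subadditive_finite fin) (auto intro!: sets.finite_UN fin)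
  also have "\<dots> \<le> (\<Sum>z\<in>?S 13. \<Sum>z'\<in>?S 18. P.prob (?I z z'))"
    by (intro sum_mono P.finite_measure_subadditive_finite fin) auto
  also have "\<dots> \<le> (\<Sum>z\<in>?S 13. \<Sum>z'\<in>?S 18. q * q)" using I by (intro sum_mono) auto
  also have "\<dots> = (card (?S 13) * card (?S 18)) * (q * q)" by simp
  also have "\<dots> \<le> (N * N) * (q * q)"
    unfolding of_nat_mult using q0
    by (intro mult_right_mono mult_mono card) (simp_all add: N_def)
  also have "\<dots> = (1 / 2) ^ (2 ^ Suc k) / N\<^sup>2"
    by (simp add: q_def N_def power2_eq_square mult_2 power_add)
  finally show ?case by (simp add: N_def)
qed

lemma prob_no_shell_le: "P.prob (no_shell k x) \<le> (1 / 2) ^ (2 ^ k)"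
proof -
  have "(1 / 2) ^ (2 ^ k) / (37 ^ CARD('d))\<^sup>2 \<le> (1 / 2 :: real) ^ (2 ^ k) / 1"
    by (intro divide_left_mono) (auto intro: one_le_power)
  then show ?thesis using prob_no_shell[of k x] by simp
qed

text \<open>Costs inside a cube of radius of order \<open>10 ^ k\<close> will be of order
  \<open>10 ^ (2 * CARD('d) * k)\<close>: its volume times a detour cost of the same order. The
  exponent has to exceed \<open>2 * CARD('d)\<close> so that this is small against
  \<open>10 ^ (expo * k)\<close>.\<close>

definition expo :: nat where
  "expo = 3 * CARD('d)"

text \<open>Shells of radius of order \<open>10 ^ k\<close> exist simultaneously around all sites up
  to a much larger distance. All later comparisons within a single configuration rest on this
  property alone.\<close>

definition regular :: "((int ^ 'd) set \<Rightarrow> real) \<Rightarrow> bool" where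
  "regular \<tau> \<longleftrightarrow> (\<exists>k0. \<forall>k\<ge>k0. \<forall>x\<in>cube 0 (10 ^ (expo * k)). has_shell (good \<tau>) x (10 ^ k))"

text \<open>Borel-Cantelli: the number of centers grows exponentially in \<open>k\<close>, while the
  failure probability is doubly exponentially small.\<close>

lemma AE_regular: "AE \<tau> in PM. regular \<tau>"
proof -
  define A where "A k = (\<Union>x\<in>cube 0 (10 ^ (expo * k)). no_shell k x)" for k
  have A[measurable]: "A k \<in> sets PM" for k unfolding A_def by (intro sets.finite_UN) auto
  have prob: "P.prob (A k) \<le> 3 ^ CARD('d) * ((10 ^ (expo * CARD('d))) ^ k * (1 / 2) ^ (2 ^ k))" for k
  proof -
    have "P.prob (A k) \<le> (\<Sum>x\<in>cube 0 (10 ^ (expo * k)). P.prob (no_shell k x))"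
      unfolding A_def by (intro P.finite_measure_subadditive_finite) auto
    also have "\<dots> \<le> (\<Sum>x\<in>cube (0 :: int ^ 'd) (10 ^ (expo * k)). (1 / 2) ^ (2 ^ k))"
      by (intro sum_mono prob_no_shell_le)
    also have "\<dots> = card (cube (0 :: int ^ 'd) (10 ^ (expo * k))) * (1 / 2) ^ (2 ^ k)" by simp
    also have "\<dots> \<le> (3 ^ CARD('d) * (10 ^ (expo * CARD('d))) ^ k) * (1 / 2) ^ (2 ^ k)"
    proof (rule mult_right_mono)
      have "real (card (cube (0 :: int ^ 'd) (10 ^ (expo * k)))) = (2 * 10 ^ (expo * k) + 1) ^ CARD('d)"
        by (simp add: card_cube nat_add_distrib nat_mult_distrib nat_power_eq add.commute)
      also have "\<dots> \<le> (3 * 10 ^ (expo * k)) ^ CARD('d)" by (intro power_mono) auto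
      also have "\<dots> = 3 ^ CARD('d) * (10 ^ (expo * CARD('d))) ^ k"
        by (simp add: power_mult_distrib mult_ac flip: power_mult)
      finally show "real (card (cube (0 :: int ^ 'd) (10 ^ (expo * k))))
          \<le> 3 ^ CARD('d) * (10 ^ (expo * CARD('d))) ^ k" .
    qed simp
    finally show ?thesis by (simp add: mult_ac)
  qed
  have "summable (\<lambda>k. P.prob (A k))"
    using prob by (intro summable_comparison_test[OF _ summable_mult[OF summable_doubly_exponential]])
      (auto intro!: exI[of _ 0])
  then have "AE \<tau> in PM. eventually (\<lambda>k. \<tau> \<in> space PM - A k) sequentially"
    by (intro borel_cantelli_AE1) (auto simp: P.emeasure_eq_measure)
  then show ?thesis
  proof (rule AE_mp, intro AE_I2 impI)
    fix \<tau> assume "eventually (\<lambda>k. \<tau> \<in> space PM - A k) sequentially"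
    then show "regular \<tau>"
      unfolding regular_def eventually_sequentially A_def no_shell_def by auto
  qed
qed

end

lemma ex_tail_bound:
  assumes "L \<in> edge_laws" "0 < C"
  shows "\<exists>M\<ge>1. measure L {M<..} * C \<le> 1 / 2"
proof -
  interpret prob_space L using assms(1) by (simp add: edge_laws_def)
  have [simp]: "sets L = sets borel" using assms(1) by (simp add: edge_laws_def)
  have "(\<lambda>n. measure L {real n<..}) \<longlonglongrightarrow> measure L (\<Inter>n. {real n<..})"
    by (intro finite_Lim_measure_decseq) (auto simp: decseq_def)
  moreover have "(\<Inter>n. {real n<..}) = {}" using reals_Archimedean2 by (auto intro: less_asym)
  ultimately have "(\<lambda>n. measure L {real n<..} * C) \<longlonglongrightarrow> 0 * C" by (intro tendsto_mult) auto
  then have "eventually (\<lambda>n. measure L {real n<..} * C < 1 / 2) sequentially"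
    by (rule order_tendstoD) auto
  then have "eventually (\<lambda>n. measure L {real n<..} * C < 1 / 2 \<and> n \<ge> 1) sequentially"
    using eventually_ge_at_top by (rule eventually_conj)
  then obtain n where "measure L {real n<..} * C < 1 / 2" "n \<ge> 1"
    unfolding eventually_sequentially by blast
  then show ?thesis by (intro exI[of _ "real n"]) auto
qed

section \<open>Ergodicity of the lattice shifts\<close>

lemma tr_inj: "inj (tr v)"
  by (rule inj_on_inverseI[where g = "tr (- v)"]) simp

text \<open>Each visit to a site is charged by at most the two adjacent steps. The first site is
  charged only once, and the term \<open>f (hd p)\<close> records this for the induction.\<close>

lemma cost_sum_vertices_le:
  assumes "p \<noteq> []" "\<And>x. 0 \<le> f x"
  shows "cost (\<lambda>e. \<Sum>x\<in>e. f x) p + f (hd p) \<le> 2 * sum_list (map f p)"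
  using assms(1)
proof (induction p rule: steps.induct)
  case (1 x y p)
  have "(\<Sum>x\<in>{x, y}. f x) \<le> f x + f y" using assms(2)[of x] assms(2)[of y] by (cases "x = y") auto
  then show ?case using 1 by (simp add: cost_def)
qed (use assms(2) in \<open>auto simp: cost_def\<close>)

lemma ex_joins: obtains p where "joins x y p"
  using linked_cube[of x x "infn (y - x)" y] infn_nonneg[of "y - x"]
  by (auto simp: cube_def linked_def)

context fpp_law
begin

text \<open>The configuration as seen from the site \<open>v\<close>; the restriction to
  \<open>lattice_edges\<close> keeps it in the product space.\<close>

definition shift :: "int ^ 'd \<Rightarrow> ((int ^ 'd) set \<Rightarrow> real) \<Rightarrow> (int ^ 'd) set \<Rightarrow> real" where
  "shift v \<tau> = (\<lambda>e\<in>lattice_edges. \<tau> (tr v e))"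

lemma distr_shift: "distr PM PM (shift v) = PM"
  unfolding shift_def
  by (rule distr_PiM_reindex[where M = "\<lambda>_. L"])
    (auto intro: L.prob_space_axioms inj_on_subset[OF tr_inj])

lemma measurable_shift [measurable]: "shift v \<in> measurable PM PM"
  unfolding shift_def by (intro measurable_restrict measurable_component_singleton) simp

lemma prob_shift:
  assumes "A \<in> sets PM"
  shows "P.prob {\<tau> \<in> space PM. shift v \<tau> \<in> A} = P.prob A"
proof -
  have "P.prob {\<tau> \<in> space PM. shift v \<tau> \<in> A} = measure (distr PM PM (shift v)) A"
    using assms by (subst measure_distr) (auto simp: vimage_def Int_def conj_commute)
  then show ?thesis by (simp add: distr_shift)
qed

lemma integral_shift:
  fixes f :: "_ \<Rightarrow> real"
  assumes "f \<in> borel_measurable PM"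
  shows "(\<integral>\<tau>. f (shift v \<tau>) \<partial>PM) = (\<integral>\<tau>. f \<tau> \<partial>PM)"
  using integral_distr[OF measurable_shift assms, of v] by (simp add: distr_shift)

lemma integrable_shift:
  fixes f :: "_ \<Rightarrow> real"
  assumes "integrable PM f"
  shows "integrable PM (\<lambda>\<tau>. f (shift v \<tau>))"
  by (rule integrable_distr[OF measurable_shift[of v]]) (simp only: distr_shift assms)

lemma shift_space: "\<tau> \<in> space PM \<Longrightarrow> shift v \<tau> \<in> space PM"
  using measurable_space[OF measurable_shift] .

section \<open>Zero-one law for shift-invariant events, by approximation with cylinder
  events\<close>

definition depends_on :: "((int ^ 'd) set \<Rightarrow> real) set \<Rightarrow> (int ^ 'd) set set \<Rightarrow> bool" where
  "depends_on C J \<longleftrightarrow> (\<forall>\<tau>\<in>space PM. \<forall>\<tau>'\<in>space PM. (\<forall>e\<in>J. \<tau> e = \<tau>' e) \<longrightarrow> (\<tau> \<in> C \<longleftrightarrow> \<tau>' \<in> C))"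

lemma depends_onD:
  assumes "depends_on C J" "\<tau> \<in> space PM" "\<tau>' \<in> space PM" "\<And>e. e \<in> J \<Longrightarrow> \<tau> e = \<tau>' e"
  shows "\<tau> \<in> C \<longleftrightarrow> \<tau>' \<in> C"
  using assms unfolding depends_on_def by blast

text \<open>Extending weights on \<open>J\<close> by zero is a measurable map into the full space,
  and \<open>X\<close> is the preimage of \<open>C\<close> under it.\<close>

lemma depends_on_restrict:
  assumes "C \<in> sets PM" "depends_on C J" "J \<subseteq> lattice_edges"
  obtains X where "X \<in> sets (Pi\<^sub>M J (\<lambda>_. L))" "C = {\<tau> \<in> space PM. restrict \<tau> J \<in> X}"
proof -
  let ?ext = "\<lambda>\<omega>. \<lambda>e\<in>lattice_edges. if e \<in> J then \<omega> e else 0 :: real"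
  have ext: "?ext \<in> measurable (Pi\<^sub>M J (\<lambda>_. L)) PM"
  proof (rule measurable_restrict)
    fix e :: "(int ^ 'd) set" assume "e \<in> lattice_edges"
    show "(\<lambda>\<omega>. if e \<in> J then \<omega> e else 0) \<in> measurable (Pi\<^sub>M J (\<lambda>_. L)) L"
      by (cases "e \<in> J") auto
  qed
  have sub: "C \<subseteq> space PM" using assms(1) by (rule sets.sets_into_space)
  have "\<tau> \<in> C \<longleftrightarrow> restrict \<tau> J \<in> ?ext -` C \<inter> space (Pi\<^sub>M J (\<lambda>_. L))" if \<tau>: "\<tau> \<in> space PM" for \<tau>
  proof -
    have r: "restrict \<tau> J \<in> space (Pi\<^sub>M J (\<lambda>_. L))" by (simp add: space_PiM)
    then have "?ext (restrict \<tau> J) \<in> space PM" using measurable_space[OF ext] by blast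
    moreover have "\<forall>e\<in>J. \<tau> e = ?ext (restrict \<tau> J) e" using assms(3) by auto
    ultimately have "\<tau> \<in> C \<longleftrightarrow> ?ext (restrict \<tau> J) \<in> C"
      using assms(2) \<tau> unfolding depends_on_def by blast
    then show ?thesis using r by simp
  qed
  then have "C = {\<tau> \<in> space PM. restrict \<tau> J \<in> ?ext -` C \<inter> space (Pi\<^sub>M J (\<lambda>_. L))}"
    using sub by blast
  then show thesis using that measurable_sets[OF ext assms(1)] by blast
qed

lemma depends_on_indep:
  assumes "B \<in> sets PM" "depends_on B I" "I \<subseteq> lattice_edges"
    and "C \<in> sets PM" "depends_on C J" "J \<subseteq> lattice_edges" and "I \<inter> J = {}"
  shows "P.prob (B \<inter> C) = P.prob B * P.prob C"
proof -
  obtain X where X: "X \<in> sets (Pi\<^sub>M I (\<lambda>_. L))" "B = {\<tau> \<in> space PM. restrict \<tau> I \<in> X}"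
    using assms(1-3) by (rule depends_on_restrict)
  obtain Y where Y: "Y \<in> sets (Pi\<^sub>M J (\<lambda>_. L))" "C = {\<tau> \<in> space PM. restrict \<tau> J \<in> Y}"
    using assms(4-6) by (rule depends_on_restrict)
  have "B \<inter> C = {\<tau> \<in> space PM. restrict \<tau> I \<in> X \<and> restrict \<tau> J \<in> Y}" using X(2) Y(2) by auto
  then show ?thesis
    using indep_disjoint_coordinates[OF L.prob_space_axioms lattice_edges_nonempty assms(7,3,6) X(1)
        Y(1)]
    by (simp add: X(2) Y(2))
qed

definition approximable :: "((int ^ 'd) set \<Rightarrow> real) set \<Rightarrow> bool" where
  "approximable A \<longleftrightarrow> (\<forall>\<epsilon>>0. \<exists>C J. C \<in> sets PM \<and> finite J \<and> J \<subseteq> lattice_edges \<and> depends_on C J \<and>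
     P.prob ((A - C) \<union> (C - A)) < \<epsilon>)"

lemma approximableE:
  assumes "approximable A" "0 < \<epsilon>"
  obtains C J where "C \<in> sets PM" "finite J" "J \<subseteq> lattice_edges" "depends_on C J"
    "P.prob ((A - C) \<union> (C - A)) < \<epsilon>"
  using assms unfolding approximable_def by metis

text \<open>The union is truncated at a finite \<open>n\<close> at the price of
  \<open>\<epsilon> / 2\<close>; the other half is shared by the approximations of the first
  \<open>n\<close> sets.\<close>

lemma approximable_Union:
  fixes A :: "nat \<Rightarrow> _"
  assumes A: "\<And>i. A i \<in> sets PM" and ap: "\<And>i. approximable (A i)"
  shows "approximable (\<Union>i. A i)"
  unfolding approximable_def
proof (intro allI impI)
  fix \<epsilon> :: real assume \<epsilon>: "0 < \<epsilon>"
  let ?U = "\<Union>i. A i"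
  have "(\<lambda>n. P.prob (\<Union>i<n. A i)) \<longlonglongrightarrow> P.prob (\<Union>n. \<Union>i<n. A i)"
    using A by (intro P.finite_Lim_measure_incseq) (auto simp: incseq_def intro: less_le_trans)
  moreover have "(\<Union>n. \<Union>i<n. A i) = ?U" by auto
  ultimately have "eventually (\<lambda>n. P.prob ?U - \<epsilon> / 2 < P.prob (\<Union>i<n. A i)) sequentially"
    using \<epsilon> by (intro order_tendstoD) auto
  then obtain n where n: "P.prob ?U - \<epsilon> / 2 < P.prob (\<Union>i<n. A i)"
    unfolding eventually_sequentially by blast
  have "\<forall>i. \<exists>C J. C \<in> sets PM \<and> finite J \<and> J \<subseteq> lattice_edges \<and> depends_on C J \<and>
      P.prob ((A i - C) \<union> (C - A i)) < \<epsilon> / (2 * (n + 1))"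
    using ap \<epsilon> unfolding approximable_def by simp
  then obtain C J where C: "\<And>i. C i \<in> sets PM" and J: "\<And>i. finite (J i)" "\<And>i. J i \<subseteq> lattice_edges"
    and dep: "\<And>i. depends_on (C i) (J i)"
    and AC: "\<And>i. P.prob ((A i - C i) \<union> (C i - A i)) < \<epsilon> / (2 * (n + 1))"
    by metis
  let ?C = "\<Union>i<n. C i"
  let ?\<Delta> = "\<lambda>i. (A i - C i) \<union> (C i - A i)"
  have "(?U - ?C) \<union> (?C - ?U) \<subseteq> (?U - (\<Union>i<n. A i)) \<union> (\<Union>i<n. ?\<Delta> i)" by auto
  then have "P.prob ((?U - ?C) \<union> (?C - ?U)) \<le> P.prob ((?U - (\<Union>i<n. A i)) \<union> (\<Union>i<n. ?\<Delta> i))"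
    using A C by (intro P.finite_measure_mono) auto
  also have "\<dots> \<le> P.prob (?U - (\<Union>i<n. A i)) + P.prob (\<Union>i<n. ?\<Delta> i)"
    using A C by (intro measure_Un_le) auto
  also have "P.prob (?U - (\<Union>i<n. A i)) = P.prob ?U - P.prob (\<Union>i<n. A i)"
    using A by (intro P.finite_measure_Diff) auto
  also have "P.prob (\<Union>i<n. ?\<Delta> i) \<le> (\<Sum>i<n. P.prob (?\<Delta> i))"
    using A C by (intro P.finite_measure_subadditive_finite) auto
  also have "\<dots> \<le> (\<Sum>i<n. \<epsilon> / (2 * (n + 1)))" using AC by (intro sum_mono less_imp_le)
  also have "\<dots> \<le> \<epsilon> / 2" using \<epsilon> by (simp add: field_simps)
  finally have "P.prob ((?U - ?C) \<union> (?C - ?U)) < \<epsilon>" using n by linarith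
  moreover have "depends_on ?C (\<Union>i<n. J i)"
    unfolding depends_on_def
  proof (intro ballI impI)
    fix \<tau> \<tau>' assume \<tau>: "\<tau> \<in> space PM" "\<tau>' \<in> space PM" "\<forall>e\<in>(\<Union>i<n. J i). \<tau> e = \<tau>' e"
    have "\<tau> \<in> C i \<longleftrightarrow> \<tau>' \<in> C i" if "i < n" for i
    proof -
      have "\<forall>e\<in>J i. \<tau> e = \<tau>' e" using \<tau>(3) that by auto
      then show ?thesis by (intro depends_onD[OF dep \<tau>(1,2)]) blast
    qed
    then show "\<tau> \<in> ?C \<longleftrightarrow> \<tau>' \<in> ?C" by auto
  qed
  moreover have "finite (\<Union>i<n. J i)" "(\<Union>i<n. J i) \<subseteq> lattice_edges" using J by auto
  moreover have "?C \<in> sets PM" using C by auto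
  ultimately show "\<exists>C J. C \<in> sets PM \<and> finite J \<and> J \<subseteq> lattice_edges \<and> depends_on C J \<and>
     P.prob ((?U - C) \<union> (C - ?U)) < \<epsilon>"
    by blast
qed

text \<open>The approximable events contain the generating cylinders and are closed under
  complements and countable unions.\<close>

lemma sets_approximable:
  assumes "A \<in> sets PM"
  shows "approximable A"
proof -
  have "A \<in> sigma_sets (\<Pi>\<^sub>E i\<in>lattice_edges. space L) (prod_algebra lattice_edges (\<lambda>_. L))"
    using assms by (simp add: sets_PiM)
  then have "A \<in> sets PM \<and> approximable A"
  proof (induction rule: sigma_sets.induct)
    case (Basic A)
    then obtain J E where A: "A = prod_emb lattice_edges (\<lambda>_. L) J (\<Pi>\<^sub>E j\<in>J. E j)"
      and J: "finite J" "J \<subseteq> lattice_edges" "\<And>i. i \<in> J \<Longrightarrow> E i \<in> sets L"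
      by (rule prod_algebraE) blast
    have "A \<in> sets PM" unfolding A using J by (intro sets_PiM_I) auto
    moreover have "depends_on A J"
      unfolding A depends_on_def prod_emb_def by (auto simp: space_PiM PiE_iff)
    ultimately show ?case unfolding approximable_def using J by (auto intro!: exI[of _ A])
  next
    case Empty
    then show ?case unfolding approximable_def depends_on_def by (auto intro!: exI[of _ "{}"])
  next
    case (Compl A)
    then have A: "A \<in> sets PM" by blast
    have sp: "(\<Pi>\<^sub>E i\<in>lattice_edges. space L) = space PM" by (simp add: space_PiM)
    have "\<exists>C J. C \<in> sets PM \<and> finite J \<and> J \<subseteq> lattice_edges \<and> depends_on C J \<and>
       P.prob (((space PM - A) - C) \<union> (C - (space PM - A))) < \<epsilon>" if "0 < \<epsilon>" for \<epsilon>
    proof -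
      obtain C J where C: "C \<in> sets PM" "finite J" "J \<subseteq> lattice_edges" "depends_on C J"
        "P.prob ((A - C) \<union> (C - A)) < \<epsilon>"
        using Compl \<open>0 < \<epsilon>\<close> by (elim conjE approximableE)
      have "((space PM - A) - (space PM - C)) \<union> ((space PM - C) - (space PM - A)) = (A - C) \<union> (C - A)"
        using sets.sets_into_space[OF A] sets.sets_into_space[OF C(1)] by blast
      then have "P.prob (((space PM - A) - (space PM - C)) \<union> ((space PM - C) - (space PM - A))) < \<epsilon>"
        using C(5) by (simp only:)
      moreover have "depends_on (space PM - C) J" using C(4) unfolding depends_on_def by blast
      ultimately show ?thesis using C(1-3)
        by (intro exI[of _ "space PM - C"] exI[of _ J] conjI sets.compl_sets)
    qed
    then show ?case unfolding sp approximable_def using A by blast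
  next
    case (Union A)
    then show ?case using approximable_Union[of A] by blast
  qed
  then show ?thesis by blast
qed

lemma prob_symm_diff:
  assumes "A \<in> sets PM" "B \<in> sets PM"
  shows "\<bar>P.prob A - P.prob B\<bar> \<le> P.prob ((A - B) \<union> (B - A))"
proof -
  have *: "P.prob A \<le> P.prob B + P.prob ((A - B) \<union> (B - A))" if "A \<in> sets PM" "B \<in> sets PM" for A B
  proof -
    have "P.prob A \<le> P.prob (B \<union> ((A - B) \<union> (B - A)))"
      using that by (intro P.finite_measure_mono) auto
    also have "\<dots> \<le> P.prob B + P.prob ((A - B) \<union> (B - A))"
      using that by (intro measure_Un_le) auto
    finally show ?thesis .
  qed
  show ?thesis using *[OF assms] *[OF assms(2,1)] by (simp add: Un_commute abs_le_iff)
qed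

text \<open>\<open>K\<close> bounds the norm of all sites on edges of \<open>J\<close>, and
  \<open>v\<close> is longer than \<open>2 * K\<close>.\<close>

lemma ex_disjoint_shift:
  assumes "finite J" "J \<subseteq> lattice_edges"
  obtains v :: "int ^ 'd" where "J \<inter> tr v ` J = {}"
proof -
  have fin: "finite (\<Union>J)"
    using assms by (auto simp: lattice_edges_def)
  define K where "K = (\<Sum>w\<in>\<Union>J. infn w)"
  have K: "infn w \<le> K" if "w \<in> \<Union>J" for w
    unfolding K_def using that fin infn_nonneg by (intro member_le_sum) auto
  define v :: "int ^ 'd" where "v = axis undefined (2 * \<bar>K\<bar> + 1)"
  have "J \<inter> tr v ` J = {}"
  proof (rule ccontr)
    assume "J \<inter> tr v ` J \<noteq> {}"
    then obtain e where e: "e \<in> J" "tr v e \<in> J" by auto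
    obtain x where x: "x \<in> e" using e assms(2) by (auto simp: lattice_edges_def)
    then have "infn (x + v) \<le> K" "infn x \<le> K" using e by (auto intro!: K simp: tr_def)
    moreover have "infn v \<le> infn (x + v) + infn (- x)" using infn_triangle[of "x + v" "- x"] by simp
    ultimately show False by (simp only: infn_minus) (simp add: v_def)
  qed
  then show thesis by (rule that)
qed

text \<open>Let \<open>C\<close> be a cylinder event close to \<open>A\<close>. A far translate of
  \<open>C\<close> is independent of \<open>C\<close>, while \<open>A\<close> almost coincides with
  its translate. Hence the probability of \<open>A\<close> is arbitrarily close to its own
  square.\<close>

lemma zero_one_shift:
  assumes A: "A \<in> sets PM" and inv: "\<And>v. AE \<tau> in PM. shift v \<tau> \<in> A \<longleftrightarrow> \<tau> \<in> A"
  shows "P.prob A = 0 \<or> P.prob A = 1"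
proof -
  have small: "\<bar>P.prob A - P.prob A * P.prob A\<bar> \<le> 4 * \<epsilon>" if \<epsilon>: "0 < \<epsilon>" for \<epsilon>
  proof -
    obtain C J where C: "C \<in> sets PM" "finite J" "J \<subseteq> lattice_edges" "depends_on C J"
      and AC: "P.prob ((A - C) \<union> (C - A)) < \<epsilon>"
      by (rule approximableE[OF sets_approximable[OF A] \<epsilon>])
    obtain v where v: "J \<inter> tr v ` J = {}" by (rule ex_disjoint_shift[OF C(2,3)])
    let ?s = "\<lambda>B. {\<tau> \<in> space PM. shift v \<tau> \<in> B}"
    have s: "?s B \<in> sets PM" if "B \<in> sets PM" for B using that by measurable
    have "depends_on (?s C) (tr v ` J)"
      unfolding depends_on_def
    proof (intro ballI impI)
      fix \<tau> \<tau>' assume \<tau>: "\<tau> \<in> space PM" "\<tau>' \<in> space PM" "\<forall>e\<in>tr v ` J. \<tau> e = \<tau>' e"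
      then have "\<forall>e\<in>J. shift v \<tau> e = shift v \<tau>' e" using C(3) by (auto simp: shift_def)
      then have "shift v \<tau> \<in> C \<longleftrightarrow> shift v \<tau>' \<in> C"
        using \<tau>(1,2) by (intro depends_onD[OF C(4)] shift_space) auto
      then show "\<tau> \<in> ?s C \<longleftrightarrow> \<tau>' \<in> ?s C" using \<tau> by simp
    qed
    then have "P.prob (C \<inter> ?s C) = P.prob C * P.prob (?s C)"
      using C v s by (intro depends_on_indep[of C J "?s C" "tr v ` J"]) auto
    then have CC: "P.prob (C \<inter> ?s C) = P.prob C * P.prob C" by (simp add: prob_shift C)
    have "P.prob A = P.prob (A \<inter> ?s A)"
      using inv[of v] A s by (intro P.finite_measure_eq_AE) auto
    moreover have "\<bar>P.prob (A \<inter> ?s A) - P.prob (C \<inter> ?s C)\<bar> \<le> 2 * \<epsilon>"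
    proof -
      let ?\<Delta> = "(A - C) \<union> (C - A)"
      have \<Delta>: "?\<Delta> \<in> sets PM" using A C by auto
      have "\<bar>P.prob (A \<inter> ?s A) - P.prob (C \<inter> ?s C)\<bar> \<le>
          P.prob ((A \<inter> ?s A - C \<inter> ?s C) \<union> (C \<inter> ?s C - A \<inter> ?s A))"
        using A C s by (intro prob_symm_diff) auto
      also have "\<dots> \<le> P.prob (?\<Delta> \<union> ?s ?\<Delta>)"
        using A C s[OF \<Delta>] by (intro P.finite_measure_mono) auto
      also have "\<dots> \<le> P.prob ?\<Delta> + P.prob (?s ?\<Delta>)"
        using \<Delta> s[OF \<Delta>] by (intro measure_Un_le) auto
      also have "\<dots> \<le> 2 * \<epsilon>" using AC unfolding prob_shift[OF \<Delta>] by simp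
      finally show ?thesis .
    qed
    moreover have "\<bar>P.prob A - P.prob C\<bar> \<le> \<epsilon>" using prob_symm_diff[OF A C(1)] AC by simp
    moreover have "\<bar>P.prob C * P.prob C - P.prob A * P.prob A\<bar> \<le> 2 * \<bar>P.prob A - P.prob C\<bar>"
    proof -
      have "P.prob C * P.prob C - P.prob A * P.prob A = (P.prob C + P.prob A) * (P.prob C - P.prob A)"
        by (simp add: algebra_simps)
      moreover have "\<bar>P.prob C + P.prob A\<bar> \<le> 2"
        using P.prob_le_1[of C] P.prob_le_1[of A] measure_nonneg[of PM C] measure_nonneg[of PM A]
            by linarith
      ultimately show ?thesis
        by (simp add: abs_mult abs_minus_commute mult_right_mono)
    qed
    ultimately have "\<bar>P.prob A - P.prob C * P.prob C\<bar> \<le> 2 * \<epsilon>"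
      "\<bar>P.prob C * P.prob C - P.prob A * P.prob A\<bar> \<le> 2 * \<epsilon>"
      using CC by simp_all
    moreover have "\<bar>a - c\<bar> \<le> 4 * \<epsilon>" if "\<bar>a - b\<bar> \<le> 2 * \<epsilon>" "\<bar>b - c\<bar> \<le> 2 * \<epsilon>" for a b c :: real
      using that by linarith
    ultimately show ?thesis by blast
  qed
  have "P.prob A = P.prob A * P.prob A"
  proof (rule ccontr)
    assume "P.prob A \<noteq> P.prob A * P.prob A"
    then show False using small[of "\<bar>P.prob A - P.prob A * P.prob A\<bar> / 8"] by simp
  qed
  then show ?thesis by auto
qed

text \<open>The constant is the supremum of the rational levels below which \<open>F\<close> almost
  surely does not fall. Every level event is almost invariant, so it has probability zero or
  one.\<close>

lemma AE_constant:
  fixes F :: "_ \<Rightarrow> ereal"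
  assumes F[measurable]: "F \<in> borel_measurable PM" and inv: "\<And>v. AE \<tau> in PM. F (shift v \<tau>) = F \<tau>"
  obtains c where "AE \<tau> in PM. F \<tau> = c"
proof -
  define Q where "Q = {q :: rat. P.prob {\<tau> \<in> space PM. F \<tau> < ereal (of_rat q)} = 0}"
  define c where "c = Sup ((\<lambda>q. ereal (of_rat q)) ` Q)"
  have zo: "P.prob {\<tau> \<in> space PM. F \<tau> < ereal (of_rat q)} = 0 \<or>
      P.prob {\<tau> \<in> space PM. F \<tau> < ereal (of_rat q)} = 1" for q
  proof (rule zero_one_shift)
    show "AE \<tau> in PM. shift v \<tau> \<in> {\<tau> \<in> space PM. F \<tau> < ereal (of_rat q)} \<longleftrightarrow>
      \<tau> \<in> {\<tau> \<in> space PM. F \<tau> < ereal (of_rat q)}" for v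
      using inv[of v] AE_space by eventually_elim (auto simp: shift_space)
  qed measurable
  have 0: "AE \<tau> in PM. \<not> F \<tau> < ereal (of_rat q)" if "q \<in> Q" for q
    using that by (subst AE_iff_measurable[OF _ refl]) (auto simp: Q_def P.emeasure_eq_measure)
  have 1: "AE \<tau> in PM. F \<tau> < ereal (of_rat q)" if "q \<notin> Q" for q
  proof -
    have "P.prob {\<tau> \<in> space PM. F \<tau> < ereal (of_rat q)} = 1" using that zo[of q] by (simp add: Q_def)
    from P.AE_prob_1[OF this] show ?thesis by eventually_elim simp
  qed
  have "AE \<tau> in PM. (\<forall>q. (q \<in> Q \<longrightarrow> \<not> F \<tau> < ereal (of_rat q)) \<and> (q \<notin> Q \<longrightarrow> F \<tau> < ereal (of_rat q)))"
    unfolding AE_all_countable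
  proof
    show "AE \<tau> in PM. (q \<in> Q \<longrightarrow> \<not> F \<tau> < ereal (of_rat q)) \<and> (q \<notin> Q \<longrightarrow> F \<tau> < ereal (of_rat q))" for q
      using 0[of q] 1[of q] by (cases "q \<in> Q") simp_all
  qed
  then have "AE \<tau> in PM. F \<tau> = c"
  proof (rule AE_mp, intro AE_I2 impI)
    fix \<tau> assume *: "\<forall>q. (q \<in> Q \<longrightarrow> \<not> F \<tau> < ereal (of_rat q)) \<and> (q \<notin> Q \<longrightarrow> F \<tau> < ereal (of_rat q))"
    show "F \<tau> = c"
    proof (rule antisym)
      show "c \<le> F \<tau>" unfolding c_def using * by (auto intro!: Sup_least simp: not_less)
      show "F \<tau> \<le> c"
      proof (rule ccontr)
        assume "\<not> F \<tau> \<le> c"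
        then have "c < F \<tau>" by simp
        then obtain r where r: "c < ereal r" "ereal r < F \<tau>" using ereal_dense2 by blast
        obtain r' where r': "ereal r < ereal r'" "ereal r' < F \<tau>" using ereal_dense2[OF r(2)] by blast
        then have "r < r'" by simp
        then obtain q where q': "r < of_rat q" "of_rat q < r'" using of_rat_dense by blast
        have q: "c < ereal (of_rat q)" using less_trans[OF r(1), of "ereal (of_rat q)"] q'(1) by simp
        moreover have "ereal (of_rat q) < F \<tau>"
          using less_trans[OF _ r'(2), of "ereal (of_rat q)"] q'(2) by simp
        ultimately have q: "c < ereal (of_rat q)" "ereal (of_rat q) < F \<tau>" by simp_all
        then have "q \<in> Q" using * by (metis order.asym)
        then have "ereal (of_rat q) \<le> c" unfolding c_def by (auto intro: Sup_upper)
        then show False using q by simp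
      qed
    qed
  qed
  then show thesis by (rule that)
qed

end

section \<open>Capped passage times\<close>

context fpp_law
begin

text \<open>On \<open>regular\<close> configurations every site has a shell at some scale, so the
  minimum is attained.\<close>

definition rad :: "int ^ 'd \<Rightarrow> ((int ^ 'd) set \<Rightarrow> real) \<Rightarrow> nat" where
  "rad x \<tau> = (LEAST k. has_shell (good \<tau>) x (10 ^ k))"

text \<open>The number of sites in the cube of radius \<open>2 * 10 ^ rad x \<tau>\<close>, which
  contains the smallest shell around \<open>x\<close>.\<close>

definition vol :: "int ^ 'd \<Rightarrow> ((int ^ 'd) set \<Rightarrow> real) \<Rightarrow> real" where
  "vol x \<tau> = (4 * 10 ^ rad x \<tau> + 1) ^ CARD('d)"

text \<open>Nonpositive values are sent to \<open>0\<close>, so that for \<open>h \<ge> 0\<close>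
  the weights are nonnegative in every configuration and not only almost surely.\<close>

definition wt :: "real \<Rightarrow> real \<Rightarrow> real" where
  "wt h a = (if 0 < a then a + h else 0)"

text \<open>The cost \<open>(M + h) * vol x\<close> is enough to walk along the smallest shell around \<open>x\<close>. Capping the
  weights by these detour costs makes the passage times integrable.\<close>

definition capped :: "real \<Rightarrow> ((int ^ 'd) set \<Rightarrow> real) \<Rightarrow> (int ^ 'd) set \<Rightarrow> real" where
  "capped h \<tau> e = min (wt h (\<tau> e)) (\<Sum>x\<in>e. (M + h) * vol x \<tau>)"

text \<open>The infimum runs over all walks, not only self-avoiding ones, so that the triangle
  inequality follows by concatenation.\<close>

definition dst :: "real \<Rightarrow> ((int ^ 'd) set \<Rightarrow> real) \<Rightarrow> int ^ 'd \<Rightarrow> int ^ 'd \<Rightarrow> real" where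
  "dst h \<tau> x y = (INF p\<in>{p. joins x y p}. cost (capped h \<tau>) p)"

lemma rad_le: "has_shell (good \<tau>) x (10 ^ k) \<Longrightarrow> rad x \<tau> \<le> k"
  unfolding rad_def by (rule Least_le)

lemma has_shell_rad: "has_shell (good \<tau>) x (10 ^ k) \<Longrightarrow> has_shell (good \<tau>) x (10 ^ rad x \<tau>)"
  unfolding rad_def by (rule LeastI)

lemma vol_ge_1: "1 \<le> vol x \<tau>"
  unfolding vol_def by (intro one_le_power) simp

lemma vol_nonneg: "0 \<le> vol x \<tau>"
  using vol_ge_1[of x \<tau>] by simp

lemma vol_le: "rad x \<tau> \<le> k \<Longrightarrow> vol x \<tau> \<le> (5 * 10 ^ k) ^ CARD('d)"
proof -
  assume "rad x \<tau> \<le> k"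
  then have "(10 :: real) ^ rad x \<tau> \<le> 10 ^ k" by (intro power_increasing) auto
  moreover have "(1 :: real) \<le> 10 ^ k" by simp
  ultimately have "4 * 10 ^ rad x \<tau> + 1 \<le> 5 * (10 :: real) ^ k" by linarith
  then show ?thesis unfolding vol_def by (intro power_mono) auto
qed

lemma wt_nonneg: "0 \<le> h \<Longrightarrow> 0 \<le> wt h a"
  by (simp add: wt_def)

lemma detour_nonneg: "0 \<le> h \<Longrightarrow> 0 \<le> (M + h) * vol x \<tau>"
  using M_ge_1 vol_nonneg[of x \<tau>] by simp

lemma capped_nonneg: "0 \<le> h \<Longrightarrow> 0 \<le> capped h \<tau> e"
  unfolding capped_def by (simp add: wt_nonneg detour_nonneg sum_nonneg)

lemma capped_le_wt: "capped h \<tau> e \<le> wt h (\<tau> e)"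
  by (simp add: capped_def)

lemma good_shift: "good (shift v \<tau>) = tr v -` good \<tau>"
  by (auto simp: good_def shift_def)

lemma has_shell_shift: "has_shell (good (shift v \<tau>)) x r \<longleftrightarrow> has_shell (good \<tau>) (x + v) r"
  by (simp add: has_shell_translate good_shift)

lemma vol_shift: "vol x (shift v \<tau>) = vol (x + v) \<tau>"
  by (simp add: vol_def rad_def has_shell_shift)

lemma measurable_rad [measurable]: "rad x \<in> measurable PM (count_space UNIV)"
  unfolding rad_def by measurable

lemma measurable_vol [measurable]: "vol x \<in> borel_measurable PM"
proof -
  have "vol x = (\<lambda>k. (4 * 10 ^ k + 1) ^ CARD('d)) \<circ> rad x" by (auto simp: vol_def)
  then show ?thesis by (simp add: measurable_comp[OF measurable_rad])
qed

text \<open>If \<open>rad x \<tau> = Suc k\<close>, then scale \<open>k\<close> fails, and the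
  single term of index \<open>k\<close> already dominates \<open>vol x \<tau>\<close>.\<close>

lemma vol_le_suminf:
  "ennreal (vol x \<tau>) \<le> ennreal (5 ^ CARD('d)) +
     (\<Sum>k. ennreal ((5 * 10 ^ Suc k) ^ CARD('d)) * indicator {\<tau>. \<not> has_shell (good \<tau>) x (10 ^ k)} \<tau>)"
proof (cases "rad x \<tau>")
  case 0
  then have "vol x \<tau> = 5 ^ CARD('d)" by (simp add: vol_def)
  then show ?thesis by (simp add: add_increasing2)
next
  case (Suc k)
  let ?f = "\<lambda>k. ennreal ((5 * 10 ^ Suc k) ^ CARD('d)) * indicator {\<tau>. \<not> has_shell (good \<tau>) x (10 ^ k)} \<tau>"
  have "\<not> has_shell (good \<tau>) x (10 ^ k)"
    using Suc not_less_Least[of k "\<lambda>k. has_shell (good \<tau>) x (10 ^ k)"] by (simp add: rad_def)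
  then have "ennreal (vol x \<tau>) \<le> ?f k" using vol_le[of x \<tau> "Suc k"] Suc by (simp add: ennreal_leI)
  also have "\<dots> = sum ?f {k}"
    by (simp only: sum.insert finite.emptyI empty_iff sum.empty not_False_eq_True add_0_right)
  also have "\<dots> \<le> suminf ?f" by (rule sum_le_suminf) auto
  finally show ?thesis by (simp add: add_increasing)
qed

text \<open>\<open>vol x\<close> is exponential in \<open>rad x\<close>, whereas the probability
  that scale \<open>k\<close> fails is doubly exponentially small.\<close>

lemma integrable_vol: "integrable PM (vol x)"
proof (rule integrableI_bounded)
  have pow: "((5 :: real) * 10 ^ Suc k) ^ CARD('d) = 50 ^ CARD('d) * (10 ^ CARD('d)) ^ k" for k
  proof -
    have "((5 :: real) * 10 ^ Suc k) ^ CARD('d) = (50 * 10 ^ k) ^ CARD('d)" by simp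
    also have "\<dots> = 50 ^ CARD('d) * (10 ^ k) ^ CARD('d)" by (rule power_mult_distrib)
    also have "((10 :: real) ^ k) ^ CARD('d) = (10 ^ CARD('d)) ^ k"
      unfolding power_mult[symmetric] by (simp only: mult.commute)
    finally show ?thesis .
  qed
  let ?g = "\<lambda>k. (5 * 10 ^ Suc k) ^ CARD('d) * P.prob (no_shell k x)"
  have sum: "summable ?g"
  proof (rule summable_comparison_test[OF _ summable_mult[OF summable_doubly_exponential]])
    show "\<exists>N. \<forall>k\<ge>N. norm (?g k) \<le> 50 ^ CARD('d) * ((10 ^ CARD('d)) ^ k * (1 / 2) ^ 2 ^ k)"
      using prob_no_shell_le[of _ x] unfolding pow
      by (auto simp: mult.assoc intro!: mult_left_mono)
  qed simp
  have "(\<integral>\<^sup>+ \<tau>. ennreal (norm (vol x \<tau>)) \<partial>PM) \<le> (\<integral>\<^sup>+ \<tau>. ennreal (5 ^ CARD('d)) +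
     (\<Sum>k. ennreal ((5 * 10 ^ Suc k) ^ CARD('d)) * indicator (no_shell k x) \<tau>) \<partial>PM)"
  proof (rule nn_integral_mono)
    fix \<tau> assume "\<tau> \<in> space PM"
    then have "indicator (no_shell k x) \<tau> = (indicator {\<tau>. \<not> has_shell (good \<tau>) x (10 ^ k)} \<tau> ::
        ennreal)" for k
      by (auto simp: no_shell_def indicator_def)
    then show "ennreal (norm (vol x \<tau>)) \<le> ennreal (5 ^ CARD('d)) +
        (\<Sum>k. ennreal ((5 * 10 ^ Suc k) ^ CARD('d)) * indicator (no_shell k x) \<tau>)"
      using vol_le_suminf[of x \<tau>] vol_nonneg[of x \<tau>] by simp
  qed
  also have "\<dots> = ennreal (5 ^ CARD('d)) +
     (\<Sum>k. \<integral>\<^sup>+ \<tau>. ennreal ((5 * 10 ^ Suc k) ^ CARD('d)) * indicator (no_shell k x) \<tau> \<partial>PM)"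
    by (simp add: nn_integral_add nn_integral_suminf P.emeasure_space_1)
  also have "\<dots> = ennreal (5 ^ CARD('d)) + (\<Sum>k. ennreal (?g k))"
    by (simp add: nn_integral_cmult_indicator P.emeasure_eq_measure ennreal_mult'')
  also have "(\<Sum>k. ennreal (?g k)) = ennreal (suminf ?g)"
    by (rule suminf_ennreal_eq[OF _ summable_sums[OF sum]]) simp
  also have "ennreal (5 ^ CARD('d)) + ennreal (suminf ?g) < \<infinity>"
    unfolding infinity_ennreal_def by (simp only: ennreal_add_less_top ennreal_less_top simp_thms)
  finally show "(\<integral>\<^sup>+ \<tau>. ennreal (norm (vol x \<tau>)) \<partial>PM) < \<infinity>" .
qed measurable

section \<open>The capped metric: measurability, metric properties, stationarity,
  integrability\<close>

lemma measurable_capped: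
  assumes "e \<in> lattice_edges"
  shows "(\<lambda>\<tau>. capped h \<tau> e) \<in> borel_measurable PM"
proof -
  have [measurable]: "(\<lambda>\<tau>. \<tau> e) \<in> borel_measurable PM"
    using measurable_component_singleton[OF assms, of "\<lambda>_. L"]
    unfolding measurable_cong_sets[OF refl sets_L] .
  show ?thesis unfolding capped_def wt_def by measurable
qed

lemma measurable_dst [measurable]: "(\<lambda>\<tau>. dst h \<tau> x y) \<in> borel_measurable PM"
  unfolding dst_def
proof (rule borel_measurable_cINF_real)
  fix p assume "p \<in> {p. joins x y p}"
  then have "set (steps p) \<subseteq> lattice_edges" using joins_edges_lattice by auto
  then have "(\<lambda>\<tau>. \<Sum>i = 0..<length (steps p). capped h \<tau> (steps p ! i)) \<in> borel_measurable PM"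
    using nth_mem by (intro borel_measurable_sum measurable_capped) auto
  then show "(\<lambda>\<tau>. cost (capped h \<tau>) p) \<in> borel_measurable PM"
    by (simp add: cost_def sum_list_sum_nth)
qed simp

lemma dst_bdd: "0 \<le> h \<Longrightarrow> bdd_below ((\<lambda>p. cost (capped h \<tau>) p) ` A)"
  using cost_nonneg capped_nonneg by (intro bdd_belowI2[of _ 0]) blast

lemma dst_le: "0 \<le> h \<Longrightarrow> joins x y p \<Longrightarrow> dst h \<tau> x y \<le> cost (capped h \<tau>) p"
  unfolding dst_def by (rule cINF_lower[OF dst_bdd]) auto

lemma dst_approx:
  assumes "0 \<le> h" "0 < \<epsilon>"
  obtains p where "joins x y p" "cost (capped h \<tau>) p < dst h \<tau> x y + \<epsilon>"
proof -
  have "{p. joins x y p} \<noteq> {}" using ex_joins[of x y] by blast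
  then have "\<exists>p\<in>{p. joins x y p}. cost (capped h \<tau>) p < dst h \<tau> x y + \<epsilon>"
    using assms by (subst cINF_less_iff[symmetric, OF _ dst_bdd]) (auto simp: dst_def)
  then show thesis using that by blast
qed

lemma dst_nonneg: "0 \<le> h \<Longrightarrow> 0 \<le> dst h \<tau> x y"
  unfolding dst_def
proof (rule cINF_greatest)
  show "{p. joins x y p} \<noteq> {}" using ex_joins[of x y] by blast
qed (intro cost_nonneg capped_nonneg)

lemma dst_refl: "0 \<le> h \<Longrightarrow> dst h \<tau> x x = 0"
  using dst_le[OF _ joins_single[of x], of h \<tau>] dst_nonneg[of h \<tau> x x] by simp

lemma dst_triangle:
  assumes "0 \<le> h" shows "dst h \<tau> x z \<le> dst h \<tau> x y + dst h \<tau> y z"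
proof (rule field_le_epsilon)
  fix \<epsilon> :: real assume "0 < \<epsilon>"
  then have e: "0 < \<epsilon> / 2" by simp
  obtain p where p: "joins x y p" "cost (capped h \<tau>) p < dst h \<tau> x y + \<epsilon> / 2"
    using dst_approx[OF assms e] by blast
  obtain q where q: "joins y z q" "cost (capped h \<tau>) q < dst h \<tau> y z + \<epsilon> / 2"
    using dst_approx[OF assms e] by blast
  have "dst h \<tau> x z \<le> cost (capped h \<tau>) (p @ tl q)"
    using joins_trans(1)[OF p(1) q(1)] by (rule dst_le[OF assms])
  also have "\<dots> = cost (capped h \<tau>) p + cost (capped h \<tau>) q"
    by (rule cost_steps_append[OF joins_trans(2)[OF p(1) q(1)]])
  finally show "dst h \<tau> x z \<le> dst h \<tau> x y + dst h \<tau> y z + \<epsilon>" using p q by linarith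
qed

lemma dst_sym: "0 \<le> h \<Longrightarrow> dst h \<tau> x y = dst h \<tau> y x"
proof -
  assume h: "0 \<le> h"
  have "dst h \<tau> x y \<le> dst h \<tau> y x" for x y
    unfolding dst_def[of h \<tau> y x]
  proof (rule cINF_greatest)
    fix p assume "p \<in> {p. joins y x p}"
    then have "dst h \<tau> x y \<le> cost (capped h \<tau>) (rev p)" using h joins_rev by (intro dst_le) auto
    then show "dst h \<tau> x y \<le> cost (capped h \<tau>) p" by (simp add: cost_rev)
  qed (use ex_joins[of y x] in blast)
  from antisym[OF this this] show ?thesis .
qed

text \<open>Along a self-avoiding walk inside the cube, each site is charged its detour cost by at
  most two edges.\<close>

lemma dst_le_cube:
  assumes "0 \<le> h" "u \<in> cube x r" "v \<in> cube x r"
  shows "dst h \<tau> u v \<le> 2 * (\<Sum>y\<in>cube x r. (M + h) * vol y \<tau>)"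
proof -
  let ?f = "\<lambda>y. (M + h) * vol y \<tau>"
  obtain p where p: "joins u v p" "distinct p" "set p \<subseteq> cube x r"
    using linked_cube[OF assms(2,3)] by (rule linked_distinct)
  have f0: "0 \<le> ?f y" for y by (rule detour_nonneg[OF assms(1)])
  have "dst h \<tau> u v \<le> cost (capped h \<tau>) p" using assms(1) p(1) by (rule dst_le)
  also have "\<dots> \<le> cost (\<lambda>e. \<Sum>y\<in>e. ?f y) p" by (intro cost_mono_fun) (simp add: capped_def)
  also have "\<dots> \<le> 2 * sum_list (map ?f p)"
    using cost_sum_vertices_le[of p ?f, OF joins_nonempty[OF p(1)] f0] f0[of "hd p"] by linarith
  also have "sum_list (map ?f p) = sum ?f (set p)" using p(2) by (rule sum_list_distinct_conv_sum_set)
  also have "\<dots> \<le> sum ?f (cube x r)" using f0 p(3) by (intro sum_mono2) auto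
  finally show ?thesis by simp
qed

lemma capped_shift: "e \<in> lattice_edges \<Longrightarrow> capped h (shift v \<tau>) e = capped h \<tau> (tr v e)"
  unfolding capped_def vol_shift by (simp add: shift_def tr_def sum.reindex)

lemma dst_shift: "dst h (shift v \<tau>) x y = dst h \<tau> (x + v) (y + v)"
proof -
  have "{p. joins (x + v) (y + v) p} = map (\<lambda>y. y + v) ` {q. joins x y q}"
    by (auto simp: joins_translate)
  moreover have "cost (capped h \<tau>) (map (\<lambda>y. y + v) q) = cost (capped h (shift v \<tau>)) q" if
      "joins x y q" for q
  proof -
    have "\<forall>e\<in>set (steps q). capped h \<tau> ((\<lambda>y. y + v) ` e) = capped h (shift v \<tau>) e"
      using joins_edges_lattice[OF that] capped_shift unfolding tr_def by auto
    then show ?thesis by (simp add: cost_def steps_map comp_def cong: map_cong)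
  qed
  ultimately show ?thesis
    unfolding dst_def by (simp add: image_image cong: image_cong_simp)
qed

lemma integrable_dst:
  assumes "0 \<le> h" shows "integrable PM (\<lambda>\<tau>. dst h \<tau> x y)"
proof (rule Bochner_Integration.integrable_bound)
  let ?r = "infn (y - x)"
  show "integrable PM (\<lambda>\<tau>. 2 * (\<Sum>z\<in>cube x ?r. (M + h) * vol z \<tau>))"
    using integrable_vol by simp
  have "dst h \<tau> x y \<le> 2 * (\<Sum>z\<in>cube x ?r. (M + h) * vol z \<tau>)" for \<tau>
    using infn_nonneg[of "y - x"] by (intro dst_le_cube assms) (auto simp: cube_def)
  then show "AE \<tau> in PM. norm (dst h \<tau> x y) \<le> norm (2 * (\<Sum>z\<in>cube x ?r. (M + h) * vol z \<tau>))"
    using dst_nonneg[OF assms] by (intro AE_I2) (smt (verit) real_norm_def)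
qed measurable

section \<open>The scale belonging to a distance, and smallness of local passage times\<close>

definition scale :: "real \<Rightarrow> nat" where
  "scale n = (LEAST k. 10 * n \<le> 10 ^ (expo * k))"

lemma expo_ge: "6 \<le> expo"
  using dim by (simp add: expo_def)

lemma scale_ge: "10 * n \<le> 10 ^ (expo * scale n)"
proof -
  obtain k where "10 * n < 10 ^ k" using real_arch_pow[of 10 "10 * n"] by auto
  also have "(10 :: real) ^ k \<le> 10 ^ (expo * k)" using expo_ge by (intro power_increasing) auto
  finally have "10 * n \<le> 10 ^ (expo * k)" by simp
  then show ?thesis unfolding scale_def by (rule LeastI)
qed

text \<open>By minimality of \<open>scale n\<close>, the power \<open>10 ^ (expo * scale n)\<close>
  is comparable to \<open>n\<close> up to constants.\<close>

lemma scale_le: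
  assumes "1 \<le> n" shows "(10 :: real) ^ (expo * scale n) \<le> 10 ^ Suc expo * n"
proof (cases "scale n")
  case 0
  have "1 * 1 \<le> 10 ^ Suc expo * n" using assms by (intro mult_mono one_le_power) auto
  then show ?thesis using 0 by simp
next
  case (Suc k)
  have "\<not> 10 * n \<le> 10 ^ (expo * k)"
    using not_less_Least[of k "\<lambda>k. 10 * n \<le> 10 ^ (expo * k)"] Suc by (simp add: scale_def)
  then show ?thesis using Suc by (simp add: power_add not_le less_imp_le)
qed

lemma filterlim_scale: "filterlim scale at_top at_top"
  unfolding filterlim_at_top
proof
  fix K
  show "eventually (\<lambda>n. K \<le> scale n) at_top"
    using eventually_gt_at_top[of "10 ^ (expo * K)"]
  proof eventually_elim
    case (elim n)
    show ?case
    proof (rule ccontr)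
      assume "\<not> K \<le> scale n"
      then have "expo * scale n \<le> expo * K" by simp
      then have "(10 :: real) ^ (expo * scale n) \<le> 10 ^ (expo * K)" by (intro power_increasing) auto
      moreover have "0 \<le> n" using elim by (smt (verit) zero_le_power)
      ultimately show False using elim scale_ge[of n] by linarith
    qed
  qed
qed

text \<open>Since \<open>expo\<close> exceeds \<open>2 * CARD('d)\<close> by at least one, the power
  on the left is smaller than \<open>10 ^ (expo * scale n)\<close>, and thus than a multiple of
  \<open>n\<close>, by a factor of at least \<open>10 ^ scale n\<close>.\<close>

lemma scale_small: 
  assumes "0 < \<epsilon>"
  shows "eventually (\<lambda>n. C * 10 ^ (2 * CARD('d) * scale n) \<le> \<epsilon> * n) at_top"
proof -
  have "(\<lambda>k. \<bar>C\<bar> * 10 ^ Suc expo * (1 / 10) ^ k) \<longlonglongrightarrow> \<bar>C\<bar> * 10 ^ Suc expo * 0"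
    by (intro tendsto_intros LIMSEQ_realpow_zero) auto
  then have "eventually (\<lambda>k. \<bar>C\<bar> * 10 ^ Suc expo * (1 / 10) ^ k < \<epsilon>) sequentially"
    using assms by (intro order_tendstoD) auto
  then have "eventually (\<lambda>n. \<bar>C\<bar> * 10 ^ Suc expo * (1 / 10) ^ scale n < \<epsilon>) at_top"
    using filterlim_scale by (rule eventually_compose_filterlim)
  then show ?thesis
    using eventually_ge_at_top[of 1]
  proof eventually_elim
    case (elim n)
    let ?k = "scale n"
    have "C * 10 ^ (2 * CARD('d) * ?k) \<le> \<bar>C\<bar> * 10 ^ (2 * CARD('d) * ?k)" by (intro mult_right_mono) auto
    also have "\<dots> \<le> \<bar>C\<bar> * (10 ^ (expo * ?k) * (1 / 10) ^ ?k)"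
    proof (intro mult_left_mono)
      have "(10 :: real) ^ (2 * CARD('d) * ?k) * 10 ^ ?k \<le> 10 ^ (expo * ?k)"
        unfolding power_add[symmetric] using dim
        by (intro power_increasing) (auto simp: expo_def algebra_simps)
      then show "(10 :: real) ^ (2 * CARD('d) * ?k) \<le> 10 ^ (expo * ?k) * (1 / 10) ^ ?k"
        by (simp add: power_one_over field_simps)
    qed auto
    also have "\<dots> \<le> \<bar>C\<bar> * ((10 ^ Suc expo * n) * (1 / 10) ^ ?k)"
      using scale_le[OF elim(2)] by (intro mult_left_mono mult_right_mono) auto
    also have "\<dots> = (\<bar>C\<bar> * 10 ^ Suc expo * (1 / 10) ^ ?k) * n" by (simp add: mult_ac)
    also have "\<dots> \<le> \<epsilon> * n" using elim by (intro mult_right_mono) auto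
    finally show ?case .
  qed
qed

text \<open>The radius \<open>20 * 10 ^ scale n\<close> is that of the cubes containing shells one
  scale higher. Regularity bounds the volume of the cube and the detour cost at each of its sites by
  multiples of \<open>10 ^ (CARD('d) * scale n)\<close>.\<close>

lemma dst_small:
  assumes reg: "regular \<tau>" and h: "0 \<le> h" and \<epsilon>: "0 < \<epsilon>"
  shows "eventually (\<lambda>n. \<forall>u v. of_int (infn u) \<le> 4 * n \<longrightarrow> infn (v - u) \<le> 20 * 10 ^ scale n \<longrightarrow>
    dst h \<tau> u v \<le> \<epsilon> * n) at_top"
proof -
  obtain k0 where k0: "\<And>k x. k0 \<le> k \<Longrightarrow> x \<in> cube 0 (10 ^ (expo * k)) \<Longrightarrow> has_shell (good \<tau>) x (10 ^ k)"
    using reg unfolding regular_def by blast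
  \<comment> \<open>\<open>205 = 41 * 5\<close>: the cube has at most \<open>41 * 10 ^ k\<close>
    sites per side for \<open>k = scale n\<close>, and \<open>vol_le\<close> contributes the factor
    5.\<close>
  define C where "C = 2 * (M + h) * 205 ^ CARD('d)"
  have "eventually (\<lambda>n. max 1 k0 \<le> scale n) at_top"
    using filterlim_scale unfolding filterlim_at_top by blast
  then show ?thesis using scale_small[OF \<epsilon>, of C]
  proof eventually_elim
    case (elim n)
    let ?k = "scale n"
    show ?case
    proof (intro allI impI)
      fix u v :: "int ^ 'd"
      assume u: "of_int (infn u) \<le> 4 * n" and v: "infn (v - u) \<le> 20 * 10 ^ ?k"
      have vol: "vol y \<tau> \<le> (5 * 10 ^ ?k) ^ CARD('d)" if y: "y \<in> cube u (20 * 10 ^ ?k)" for y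
      proof -
        have "infn y \<le> infn (y - u) + infn u" using infn_triangle[of "y - u" u] by simp
        also have "infn (y - u) \<le> 20 * 10 ^ ?k" using y by (simp add: cube_def)
        finally have "infn y \<le> 20 * 10 ^ ?k + infn u" by simp
        then have "real_of_int (infn y) \<le> real_of_int (20 * 10 ^ ?k + infn u)"
          by (simp only: of_int_le_iff)
        then have "real_of_int (infn y) \<le> 20 * 10 ^ ?k + 4 * n" using u by simp
        also have "4 * n \<le> 4 / 10 * 10 ^ (expo * ?k)" using scale_ge[of n] by simp
        also have "20 * 10 ^ ?k \<le> 2 / 10 * (10 :: real) ^ (expo * ?k)"
        proof -
          have "6 * ?k \<le> expo * ?k" using expo_ge by (rule mult_le_mono1)
          moreover have "1 \<le> ?k" using elim by simp
          ultimately have "?k + 2 \<le> expo * ?k" by linarith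
          then have "(10 :: real) ^ (?k + 2) \<le> 10 ^ (expo * ?k)" by (intro power_increasing) auto
          then show ?thesis by (simp add: power_add)
        qed
        finally have "real_of_int (infn y) \<le> 6 / 10 * 10 ^ (expo * ?k)" by simp
        also have "\<dots> \<le> 1 * 10 ^ (expo * ?k)" by (intro mult_right_mono) auto
        finally have "infn y \<le> 10 ^ (expo * ?k)" by simp
        then have "has_shell (good \<tau>) y (10 ^ ?k)" using elim by (intro k0) (auto simp: cube_def)
        then show ?thesis by (intro vol_le rad_le)
      qed
      have "dst h \<tau> u v \<le> 2 * (\<Sum>y\<in>cube u (20 * 10 ^ ?k). (M + h) * vol y \<tau>)"
        using v by (intro dst_le_cube h) (auto simp: cube_def)
      also have "\<dots> \<le> 2 * (\<Sum>y\<in>cube u (20 * 10 ^ ?k). (M + h) * (5 * 10 ^ ?k) ^ CARD('d))"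
        using vol h M_ge_1 by (intro mult_left_mono sum_mono) auto
      also have "\<dots> = real (card (cube u (20 * 10 ^ ?k))) * (2 * (M + h) * (5 * 10 ^ ?k) ^ CARD('d))"
        by simp
      also have "\<dots> \<le> (41 * 10 ^ ?k) ^ CARD('d) * (2 * (M + h) * (5 * 10 ^ ?k) ^ CARD('d))"
      proof (rule mult_right_mono)
        have "real (card (cube u (20 * 10 ^ ?k))) = (40 * 10 ^ ?k + 1) ^ CARD('d)"
          by (simp add: card_cube nat_add_distrib nat_mult_distrib nat_power_eq add.commute)
        also have "\<dots> \<le> (41 * 10 ^ ?k) ^ CARD('d)" by (intro power_mono) auto
        finally show "real (card (cube u (20 * 10 ^ ?k))) \<le> (41 * 10 ^ ?k) ^ CARD('d)" .
      qed (use h M_ge_1 in auto)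
      also have "\<dots> = C * 10 ^ (2 * CARD('d) * ?k)"
      proof -
        have prod: "(41 * x) ^ n * (5 * x) ^ n = 205 ^ n * (x ^ n * x ^ n)" for x :: real and n
        proof -
          have "(205 :: real) ^ n = 41 ^ n * 5 ^ n" using power_mult_distrib[of "41 :: real" 5 n] by simp
          then show ?thesis unfolding power_mult_distrib by (simp only: mult_ac)
        qed
        have "(10 ^ ?k) ^ CARD('d) * (10 ^ ?k) ^ CARD('d) = (10 :: real) ^ (2 * CARD('d) * ?k)"
          unfolding power_mult[symmetric] power_add[symmetric] by (simp add: algebra_simps)
        then have "(41 * 10 ^ ?k) ^ CARD('d) * (5 * 10 ^ ?k) ^ CARD('d) =
            205 ^ CARD('d) * (10 :: real) ^ (2 * CARD('d) * ?k)"
          unfolding prod by (simp only:)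
        then show ?thesis unfolding C_def by (simp only: mult_ac)
      qed
      also have "\<dots> \<le> \<epsilon> * n" using elim by simp
      finally show "dst h \<tau> u v \<le> \<epsilon> * n" .
    qed
  qed
qed

end

section \<open>Time constants\<close>

text \<open>Jump along pairs \<open>(i, i + l)\<close> with \<open>F i (i + l) \<le> \<beta> * l\<close> as long as the jump stays within the
  interval, and walk by unit steps otherwise.\<close>

lemma greedy_subadditive:
  fixes F :: "nat \<Rightarrow> nat \<Rightarrow> real" and a b :: "nat \<Rightarrow> real"
  assumes tri: "\<And>i j k. F i k \<le> F i j + F j k" and refl: "\<And>i. F i i = 0"
    and a: "\<And>i. F i (Suc i) \<le> a i" "\<And>i. 0 \<le> a i" and b: "\<And>i. 0 \<le> b i" and \<beta>: "0 \<le> \<beta>"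
    and jump: "\<And>i. F i (Suc i) \<le> b i \<or> (\<exists>l\<in>{1..N}. F i (i + l) \<le> \<beta> * real l)"
    and "i \<le> n"
  shows "F i n \<le> \<beta> * real (n - i) + sum b {i..<n} + sum a {j\<in>{i..<n}. n < j + N}"
  using \<open>i \<le> n\<close>
proof (induction "n - i" arbitrary: i rule: less_induct)
  case less
  show ?case
  proof (cases "i = n")
    case True
    then show ?thesis by (simp add: refl)
  next
    case False
    then have i: "i < n" using less by simp
    have IH: "F (i + l) n \<le> \<beta> * real (n - (i + l)) + sum b {i + l..<n} + sum a {j\<in>{i + l..<n}. n < j
        + N}"
      if "1 \<le> l" "i + l \<le> n" for l
      using less(1)[of "i + l"] that i by simp
    have asub: "sum a {j\<in>{i + l..<n}. n < j + N} \<le> sum a {j\<in>{i..<n}. n < j + N}" for l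
      using a(2) by (intro sum_mono2) auto
    have bsub: "sum b {i + l..<n} \<le> sum b {i..<n}" for l using b by (intro sum_mono2) auto
    have bsplit: "sum b {i..<n} = b i + sum b {i + 1..<n}" using i
        by (simp add: sum.atLeast_Suc_lessThan)
    have \<beta>mono: "\<beta> * real (n - (i + l)) \<le> \<beta> * real (n - i)" for l
      using \<beta> by (intro mult_left_mono) auto
    consider "F i (Suc i) \<le> b i" | l where "l \<in> {1..N}" "F i (i + l) \<le> \<beta> * real l" using jump by blast
    then show ?thesis
    proof cases
      case 1
      then show ?thesis using IH[of 1] i tri[of i n "Suc i"] asub[of 1] bsplit \<beta>mono[of 1] by simp
    next
      case (2 l)
      show ?thesis
      proof (cases "i + l \<le> n")
        case True
        then have "\<beta> * real (n - i) = \<beta> * real l + \<beta> * real (n - (i + l))"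
          by (simp add: distrib_left[symmetric] flip: of_nat_add)
        then show ?thesis using IH[of l] 2 True tri[of i n "i + l"] asub[of l] bsub[of l] by simp
      next
        case False
        \<comment> \<open>A jump of length at most \<open>N\<close> that overshoots \<open>n\<close>
          starts at one of the last indices, so its unit step is paid for by the last sum.\<close>
        then have "{j\<in>{i..<n}. n < j + N} = insert i {j\<in>{i + 1..<n}. n < j + N}" using i 2(1) by auto
        then have "sum a {j\<in>{i..<n}. n < j + N} = a i + sum a {j\<in>{i + 1..<n}. n < j + N}" by simp
        then show ?thesis
          using IH[of 1] i tri[of i n "Suc i"] a(1)[of i] bsub[of 1] \<beta>mono[of 1] by simp
      qed
    qed
  qed
qed

text \<open>Scanning from the left, every index of \<open>I\<close> not yet covered opens a block on
  which \<open>u\<close> has average at least \<open>\<delta>\<close>. These blocks are disjoint,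
  cover \<open>I\<close> up to \<open>K\<close>, and do not reach beyond
  \<open>K + N\<close>.\<close>

lemma greedy_covering:
  fixes u :: "nat \<Rightarrow> real"
  assumes u: "\<And>k. 0 \<le> u k" and \<delta>: "0 \<le> \<delta>"
    and I: "\<And>i. i \<in> I \<Longrightarrow> \<exists>n\<in>{1..N}. \<delta> * real n \<le> sum u {i..<i + n}"
  shows "\<delta> * real (card (I \<inter> {i..<K})) \<le> sum u {i..<K + N}"
proof (induction "K - i" arbitrary: i rule: less_induct)
  case less
  consider "K \<le> i" | "i < K" "i \<notin> I" | "i < K" "i \<in> I" by linarith
  then show ?case
  proof cases
    case 1
    then show ?thesis using u by (simp add: sum_nonneg)
  next
    case 2
    then have "I \<inter> {i..<K} = I \<inter> {Suc i..<K}" using le_eq_less_or_eq by auto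
    then have "\<delta> * real (card (I \<inter> {i..<K})) \<le> sum u {Suc i..<K + N}" using less[of "Suc i"] 2 by simp
    also have "\<dots> \<le> sum u {i..<K + N}" using u by (intro sum_mono2) auto
    finally show ?thesis .
  next
    case 3
    then obtain n where n: "n \<in> {1..N}" "\<delta> * real n \<le> sum u {i..<i + n}" using I by blast
    have "card (I \<inter> {i..<K}) \<le> card ({i..<i + n} \<union> I \<inter> {i + n..<K})"
      by (intro card_mono) auto
    also have "\<dots> \<le> n + card (I \<inter> {i + n..<K})"
      using card_Un_le[of "{i..<i + n}" "I \<inter> {i + n..<K}"] by simp
    finally have "\<delta> * real (card (I \<inter> {i..<K})) \<le> \<delta> * real (n + card (I \<inter> {i + n..<K}))"
      using \<delta> by (intro mult_left_mono) simp_all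
    also have "\<dots> \<le> sum u {i..<i + n} + sum u {i + n..<K + N}"
    proof -
      have "\<delta> * real (card (I \<inter> {i + n..<K})) \<le> sum u {i + n..<K + N}" 
      proof (rule less)
        have "1 \<le> n" using n(1) by simp
        then show "K - (i + n) < K - i" using 3(1) by arith
      qed
      then show ?thesis using n(2) by (simp add: distrib_left)
    qed
    also have "\<dots> = sum u {i..<K + N}" using n 3 by (intro sum.atLeastLessThan_concat) auto
    finally show ?thesis .
  qed
qed

section \<open>Lattice sites along a direction and their rounding errors\<close>

lemma infn_lattice_point_add:
  "infn (lattice_point (x + y) - lattice_point x - lattice_point y) \<le> 1"
  unfolding infn_le_iff lattice_point_def
proof
  fix i
  have "\<bar>\<lfloor>x $ i + y $ i\<rfloor> - \<lfloor>x $ i\<rfloor> - \<lfloor>y $ i\<rfloor>\<bar> \<le> 1" by linarith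
  then show "\<bar>((\<chi> i. \<lfloor>(x + y) $ i\<rfloor>) - (\<chi> i. \<lfloor>x $ i\<rfloor>) - (\<chi> i. \<lfloor>y $ i\<rfloor>)) $ i\<bar> \<le> 1" by simp
qed

lemma infn_lattice_point_le:
  assumes "norm x \<le> r" shows "real_of_int (infn (lattice_point x)) \<le> r + 1"
proof -
  obtain i where i: "\<bar>lattice_point x $ i\<bar> = infn (lattice_point x)" by (rule infn_attained)
  have "\<bar>x $ i\<bar> \<le> r" using component_le_norm_cart[of x i] assms by linarith
  then have "\<bar>real_of_int \<lfloor>x $ i\<rfloor>\<bar> \<le> r + 1" by linarith
  then show ?thesis using i by (simp add: lattice_point_def flip: of_int_abs)
qed

lemma lattice_point_zero [simp]: "lattice_point 0 = 0"
  by (simp add: lattice_point_def vec_eq_iff)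

context fpp_law
begin

lemma shift_shift: "shift u (shift v \<tau>) = shift (u + v) \<tau>"
  by (auto simp: shift_def fun_eq_iff)

context
  fixes \<xi> :: "real ^ 'd" and h :: real
  assumes \<xi>: "norm \<xi> = 1" and h: "0 \<le> h"
begin

definition site :: "real \<Rightarrow> int ^ 'd" where
  "site n = lattice_point (n *\<^sub>R \<xi>)"

lemma site_zero: "site 0 = 0"
  by (simp add: site_def)

lemma site_add: "infn (site (m + n) - site m - site n) \<le> 1"
  unfolding site_def scaleR_add_left by (rule infn_lattice_point_add)

lemma infn_site: "0 \<le> n \<Longrightarrow> real_of_int (infn (site n)) \<le> n + 1"
  unfolding site_def using \<xi> by (intro infn_lattice_point_le) simp

text \<open>The sites are additive only up to rounding; summing over the unit cube compensates for this.\<close>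

lemma maximal_inequality:
  assumes b: "integrable PM b" "\<And>\<tau>. 0 \<le> b \<tau>" and \<delta>: "0 \<le> \<delta>"
  shows "\<delta> * P.prob {\<tau> \<in> space PM. \<exists>n\<ge>1. \<delta> * real n \<le> (\<Sum>k<n. b (shift (site (real k)) \<tau>))} \<le>
    card (cube (0 :: int ^ 'd) 1) * (\<integral>\<tau>. b \<tau> \<partial>PM)"
proof -
  define b' where "b' \<tau> = (\<Sum>z\<in>cube 0 1. b (shift z \<tau>))" for \<tau>
  define E where "E N = {\<tau> \<in> space PM. \<exists>n\<in>{1..N}. \<delta> * real n \<le> (\<Sum>k<n. b (shift (site (real k)) \<tau>))}"
      for N
  have [measurable]: "b \<in> borel_measurable PM" using b(1) by simp
  have E[measurable]: "E N \<in> sets PM" for N unfolding E_def by measurable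
  have b': "integrable PM b'" "\<And>\<tau>. 0 \<le> b' \<tau>"
    unfolding b'_def using b by (auto intro!: integrable_shift sum_nonneg)
  have Eb': "(\<integral>\<tau>. b' \<tau> \<partial>PM) = card (cube (0 :: int ^ 'd) 1) * (\<integral>\<tau>. b \<tau> \<partial>PM)"
    unfolding b'_def using b by (simp add: integrable_shift integral_shift)
  have le: "b (shift (site (real k)) (shift (site (real i)) \<tau>))
      \<le> b' (shift (site (real (i + k))) \<tau>)" for i k \<tau>
  proof -
    let ?w = "site (real k) + site (real i) - site (real (i + k))"
    have "infn (- ?w) \<le> 1" using site_add[of "real i" "real k"] by (simp add: algebra_simps)
    then have "?w \<in> cube 0 1" unfolding infn_minus by (simp add: cube_def)
    then have "b (shift ?w (shift (site (real (i + k))) \<tau>)) \<le> b' (shift (site (real (i + k))) \<tau>)"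
      unfolding b'_def using b(2) by (intro member_le_sum) auto
    then show ?thesis by (simp add: shift_shift)
  qed
  have fin: "\<delta> * P.prob (E N) \<le> (\<integral>\<tau>. b' \<tau> \<partial>PM)" for N
  proof (rule field_le_epsilon)
    fix \<epsilon> :: real assume \<epsilon>: "0 < \<epsilon>"
    let ?J = "\<integral>\<tau>. b' \<tau> \<partial>PM"
    \<comment> \<open>The covering blocks may overhang the first \<open>K\<close> indices by up to
      \<open>N\<close>; this choice makes the overhang negligible after division by
      \<open>K\<close>.\<close>
    have "\<exists>K. K > 0 \<and> real N * ?J \<le> \<epsilon> * real K"
    proof -
      obtain K where "real N * ?J / \<epsilon> < real K" using reals_Archimedean2 by blast
      then have "real N * ?J \<le> \<epsilon> * real (Suc K)" using \<epsilon> by (simp add: field_simps)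
      then show ?thesis by blast
    qed
    then obtain K where K: "K > 0" "real N * ?J \<le> \<epsilon> * real K" by blast
    have "\<delta> * (\<Sum>i<K. indicator (E N) (shift (site (real i)) \<tau>))
        \<le> (\<Sum>k<K + N. b' (shift (site (real k)) \<tau>))"
      if \<tau>: "\<tau> \<in> space PM" for \<tau>
    proof -
      let ?I = "{i. shift (site (real i)) \<tau> \<in> E N}"
      have "\<delta> * real (card (?I \<inter> {0..<K})) \<le> (\<Sum>k\<in>{0..<K + N}. b' (shift (site (real k)) \<tau>))"
      proof (rule greedy_covering[OF b'(2) \<delta>])
        fix i assume "i \<in> ?I"
        then obtain n where n: "n \<in> {1..N}"
          "\<delta> * real n \<le> (\<Sum>k<n. b (shift (site (real k)) (shift (site (real i)) \<tau>)))"
          by (auto simp: E_def)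
        note n(2)
        also have "(\<Sum>k<n. b (shift (site (real k)) (shift (site (real i)) \<tau>)))
            \<le> (\<Sum>k<n. b' (shift (site (real (i + k))) \<tau>))"
          by (intro sum_mono le)
        also have "\<dots> = (\<Sum>k\<in>{i..<i + n}. b' (shift (site (real k)) \<tau>))"
          using sum.shift_bounds_nat_ivl[of "\<lambda>k. b' (shift (site (real k)) \<tau>)" 0 i n]
          by (simp add: atLeast0LessThan add.commute)
        finally show "\<exists>n\<in>{1..N}. \<delta> * real n \<le> (\<Sum>k\<in>{i..<i + n}. b' (shift (site (real k)) \<tau>))"
          using n(1) by blast
      qed
      moreover have "(\<Sum>i<K. indicator (E N) (shift (site (real i)) \<tau>)) = real (card (?I \<inter> {0..<K}))"
      proof -
        have "(\<Sum>i<K. indicator (E N) (shift (site (real i)) \<tau>)) = (\<Sum>i<K. indicator ?I i :: real)"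
          by (intro sum.cong) (auto simp: indicator_def)
        also have "\<dots> = real (card (?I \<inter> {0..<K}))"
          by (simp add: indicator_def sum.If_cases lessThan_atLeast0 Int_commute)
        finally show ?thesis .
      qed
      ultimately show ?thesis by (simp add: atLeast0LessThan)
    qed
    then have "(\<integral>\<tau>. \<delta> * (\<Sum>i<K. indicator (E N) (shift (site (real i)) \<tau>)) \<partial>PM) \<le>
        (\<integral>\<tau>. (\<Sum>k<K + N. b' (shift (site (real k)) \<tau>)) \<partial>PM)"
      using b' by (intro integral_mono integrable_mult_right Bochner_Integration.integrable_sum
          integrable_shift)
        (auto intro!: P.integrable_const_bound[where B = 1])
    also have "(\<integral>\<tau>. \<delta> * (\<Sum>i<K. indicator (E N) (shift (site (real i)) \<tau>)) \<partial>PM) = real K * (\<delta> *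
        P.prob (E N))"
    proof -
      have i: "integrable PM (indicator (E N) :: _ \<Rightarrow> real)" by (simp add: P.emeasure_eq_measure)
      have "(\<integral>\<tau>. indicator (E N) (shift v \<tau>) \<partial>PM) = P.prob (E N)" for v
        by (subst integral_shift) (auto simp: sets.sets_into_space[OF E, THEN Int_absorb2])
      then show ?thesis using integrable_shift[OF i] by (simp add: mult_ac)
    qed
    also have "(\<integral>\<tau>. (\<Sum>k<K + N. b' (shift (site (real k)) \<tau>)) \<partial>PM) = (real K + real N) * ?J"
      using b' by (simp add: integrable_shift integral_shift borel_measurable_integrable)
    also have "\<dots> \<le> real K * (?J + \<epsilon>)" using K by (simp add: algebra_simps)
    finally show "\<delta> * P.prob (E N) \<le> ?J + \<epsilon>" using K(1) by simp
  qed
  have "(\<lambda>N. P.prob (E N)) \<longlonglongrightarrow> P.prob (\<Union>N. E N)"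
    by (intro P.finite_Lim_measure_incseq) (auto simp: incseq_def E_def intro: order_trans)
  then have "(\<lambda>N. \<delta> * P.prob (E N)) \<longlonglongrightarrow> \<delta> * P.prob (\<Union>N. E N)" by (intro tendsto_intros)
  then have "\<delta> * P.prob (\<Union>N. E N) \<le> (\<integral>\<tau>. b' \<tau> \<partial>PM)" by (rule LIMSEQ_le_const2) (use fin in blast)
  moreover have "(\<Union>N. E N) = {\<tau> \<in> space PM. \<exists>n\<ge>1. \<delta> * real n \<le> (\<Sum>k<n. b (shift (site (real k)) \<tau>))}"
    by (auto simp: E_def) (metis atLeastAtMost_iff order_refl One_nat_def)
  ultimately show ?thesis using Eb' by simp
qed

text \<open>The exceptional event of the maximal inequality has probability below one, so its
  complement meets every almost sure event. A single configuration is all that is needed to compare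
  almost surely constant limits.\<close>

lemma ex_small_averages:
  assumes b: "integrable PM b" "\<And>\<tau>. 0 \<le> b \<tau>" and \<delta>: "0 < \<delta>"
    and small: "card (cube (0 :: int ^ 'd) 1) * (\<integral>\<tau>. b \<tau> \<partial>PM) < \<delta>"
    and Q: "AE \<tau> in PM. Q \<tau>"
  obtains \<tau> where "\<tau> \<in> space PM" "Q \<tau>" "\<And>n. 1 \<le> n \<Longrightarrow> (\<Sum>k<n. b (shift (site (real k)) \<tau>)) < \<delta> * real n"
proof -
  let ?E = "{\<tau> \<in> space PM. \<exists>n\<ge>1. \<delta> * real n \<le> (\<Sum>k<n. b (shift (site (real k)) \<tau>))}"
  have [measurable]: "b \<in> borel_measurable PM" using b(1) by simp
  have E: "?E \<in> sets PM" by measurable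
  have "\<delta> * P.prob ?E < \<delta> * 1" using maximal_inequality[OF b less_imp_le[OF \<delta>]] small by linarith
  then have "P.prob ?E < 1" using \<delta> by (simp only: mult_less_cancel_left_pos)
  moreover have "P.prob ?E = 1" if "AE \<tau> in PM. \<tau> \<in> ?E" using that
      by (rule P.prob_eq_1[OF E, THEN iffD2])
  ultimately have "\<not> (AE \<tau> in PM. \<tau> \<in> ?E)" by auto
  then have "\<exists>\<tau>\<in>space PM. Q \<tau> \<and> \<tau> \<notin> ?E"
  proof (rule contrapos_np)
    assume "\<not> (\<exists>\<tau>\<in>space PM. Q \<tau> \<and> \<tau> \<notin> ?E)"
    then have "Q \<tau> \<longrightarrow> \<tau> \<in> ?E" if "\<tau> \<in> space PM" for \<tau> using that by blast
    then show "AE \<tau> in PM. \<tau> \<in> ?E" by (rule AE_mp[OF Q, OF AE_I2])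
  qed
  then obtain \<tau> where \<tau>: "\<tau> \<in> space PM" "Q \<tau>" "\<tau> \<notin> ?E" by blast
  show thesis
  proof (rule that[OF \<tau>(1,2)])
    fix n :: nat assume "1 \<le> n"
    then show "(\<Sum>k<n. b (shift (site (real k)) \<tau>)) < \<delta> * real n"
      using \<tau>(1,3) unfolding not_le[symmetric] by blast
  qed
qed

abbreviation time :: "((int ^ 'd) set \<Rightarrow> real) \<Rightarrow> nat \<Rightarrow> real" where
  "time \<tau> n \<equiv> dst h \<tau> 0 (site (real n)) / real n"

text \<open>Summing over \<open>z\<close> covers every rounding error that can occur between
  consecutive sites.\<close>

definition step_bound :: "((int ^ 'd) set \<Rightarrow> real) \<Rightarrow> real" where
  "step_bound \<tau> = (\<Sum>z\<in>cube 0 1. dst h \<tau> 0 (site 1 + z))"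

lemma step_bound: "integrable PM step_bound" "0 \<le> step_bound \<tau>"
  unfolding step_bound_def by (auto intro!: integrable_dst sum_nonneg dst_nonneg h)

lemma dst_site:
  obtains z where "z \<in> cube 0 1" "dst h \<tau> (site m) (site (m + n)) = dst h (shift (site m) \<tau>) 0 (site
      n + z)"
proof
  let ?z = "site (m + n) - site m - site n"
  show "?z \<in> cube 0 1" using site_add[of m n] by (simp add: cube_def)
  show "dst h \<tau> (site m) (site (m + n)) = dst h (shift (site m) \<tau>) 0 (site n + ?z)"
    by (simp add: dst_shift algebra_simps)
qed

lemma dst_step: "dst h \<tau> (site (real k)) (site (real (Suc k))) \<le> step_bound (shift (site (real k)) \<tau>)"
proof -
  obtain z where z: "z \<in> cube 0 1"
    "dst h \<tau> (site (real k)) (site (real k + 1)) = dst h (shift (site (real k)) \<tau>) 0 (site 1 + z)"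
    using dst_site by blast
  then have "dst h \<tau> (site (real k)) (site (real k + 1)) \<le> step_bound (shift (site (real k)) \<tau>)"
    unfolding step_bound_def z(2) by (intro member_le_sum) (auto intro: dst_nonneg h)
  then show ?thesis by (simp add: add.commute)
qed

lemma dst_near_site:
  assumes "regular \<tau>" "0 < \<epsilon>"
  shows "eventually (\<lambda>n. \<forall>v. infn (v - site n) \<le> r \<longrightarrow> dst h \<tau> (site n) v \<le> \<epsilon> * n) at_top"
proof -
  have "eventually (\<lambda>n. nat r \<le> scale n) at_top"
    using filterlim_scale unfolding filterlim_at_top by blast
  then show ?thesis
    using dst_small[OF assms(1) h assms(2)] eventually_ge_at_top[of 1]
  proof eventually_elim
    case (elim n)
    have "r \<le> int (scale n)" using elim by linarith
    also have "\<dots> \<le> 20 * 10 ^ scale n"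
      using of_nat_less_two_power[of "scale n", where 'a = int] power_mono[of "2 :: int" 10
          "scale n"] by linarith
    finally have "r \<le> 20 * 10 ^ scale n" .
    moreover have "real_of_int (infn (site n)) \<le> 4 * n" using infn_site[of n] elim by linarith
    ultimately show ?case using elim by (meson order_trans)
  qed
qed

lemma dst_near_site_nat:
  assumes "regular \<tau>" "0 < \<epsilon>"
  shows "eventually (\<lambda>n. \<forall>v. infn (v - site (real n)) \<le> r \<longrightarrow>
    dst h \<tau> (site (real n)) v \<le> \<epsilon> * real n) sequentially"
  using dst_near_site[OF assms] filterlim_real_sequentially by (rule eventually_compose_filterlim)

text \<open>Shifting the configuration moves both end points by \<open>v\<close>, at a cost of order
  less than \<open>n\<close>. This makes liminf and limsup shift invariant.\<close>

lemma time_shift_tendsto: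
  assumes "regular \<tau>"
  shows "(\<lambda>n. time (shift v \<tau>) n - time \<tau> n) \<longlonglongrightarrow> 0"
proof (rule LIMSEQ_I)
  fix r :: real assume r: "0 < r"
  have "eventually (\<lambda>n. \<forall>w. infn (w - site (real n)) \<le> infn v \<longrightarrow>
      dst h \<tau> (site (real n)) w \<le> r / 4 * real n) sequentially"
    using r by (intro dst_near_site_nat assms) auto
  moreover have "eventually (\<lambda>n. 4 * dst h \<tau> 0 v / r < real n) sequentially"
    using filterlim_real_sequentially by (simp add: filterlim_at_top_dense)
  moreover have "eventually (\<lambda>n. 0 < n) sequentially" by (rule eventually_gt_at_top)
  ultimately have "eventually (\<lambda>n. norm (time (shift v \<tau>) n - time \<tau> n - 0) < r) sequentially"
  proof eventually_elim
    case (elim n)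
    let ?s = "site (real n)"
    have 1: "dst h \<tau> ?s (?s + v) \<le> r / 4 * real n" using elim(1) by simp
    have 2: "dst h \<tau> 0 v \<le> r / 4 * real n" using elim r by (simp add: field_simps)
    have "dst h \<tau> v (?s + v) \<le> dst h \<tau> v 0 + dst h \<tau> 0 ?s + dst h \<tau> ?s (?s + v)"
      using dst_triangle[OF h, of \<tau> v "?s + v" 0] dst_triangle[OF h, of \<tau> 0 "?s + v" ?s] by linarith
    moreover have "dst h \<tau> 0 ?s \<le> dst h \<tau> 0 v + dst h \<tau> v (?s + v) + dst h \<tau> (?s + v) ?s"
      using dst_triangle[OF h, of \<tau> 0 ?s v] dst_triangle[OF h, of \<tau> v ?s "?s + v"] by linarith
    ultimately have "\<bar>dst h \<tau> v (?s + v) - dst h \<tau> 0 ?s\<bar> \<le> r / 2 * real n"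
      using 1 2 dst_sym[OF h, of \<tau> v 0] dst_sym[OF h, of \<tau> ?s "?s + v"] by linarith
    also have "\<dots> < r * real n" using r elim by simp
    finally have "\<bar>dst h \<tau> v (?s + v) - dst h \<tau> 0 ?s\<bar> / real n < r" using elim by (simp add: field_simps)
    then show ?case using elim by (simp add: dst_shift diff_divide_distrib[symmetric])
  qed
  then show "\<exists>no. \<forall>n\<ge>no. norm (time (shift v \<tau>) n - time \<tau> n - 0) < r"
    unfolding eventually_sequentially .
qed

lemma time_shift_liminf:
  assumes "regular \<tau>"
  shows "liminf (\<lambda>n. ereal (time (shift v \<tau>) n)) = liminf (\<lambda>n. ereal (time \<tau> n))"
    "limsup (\<lambda>n. ereal (time (shift v \<tau>) n)) = limsup (\<lambda>n. ereal (time \<tau> n))"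
proof -
  have lim: "(\<lambda>n. ereal (time (shift v \<tau>) n - time \<tau> n)) \<longlonglongrightarrow> ereal 0"
    using time_shift_tendsto[OF assms] by (intro tendsto_intros)
  show "liminf (\<lambda>n. ereal (time (shift v \<tau>) n)) = liminf (\<lambda>n. ereal (time \<tau> n))"
    using ereal_liminf_lim_add[OF lim, of "\<lambda>n. ereal (time \<tau> n)"] by simp
  show "limsup (\<lambda>n. ereal (time (shift v \<tau>) n)) = limsup (\<lambda>n. ereal (time \<tau> n))"
    using ereal_limsup_lim_add[OF lim, of "\<lambda>n. ereal (time \<tau> n)"] by simp
qed

text \<open>As the liminf is \<open>\<phi>\<close>, almost every configuration allows a jump of some
  length with slope at most \<open>\<phi> + \<epsilon>\<close>. Hence the integral of
  \<open>step_bound\<close> over the configurations without such a jump of length at most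
  \<open>N\<close> tends to zero. The greedy walk then pays \<open>\<phi> + \<epsilon>\<close> per
  site for jumps, at most \<open>\<epsilon>\<close> for steps at bad sites and at most
  \<open>\<epsilon>\<close> for the last \<open>N\<close> steps.\<close>

lemma time_bound:
  assumes \<phi>: "AE \<tau> in PM. liminf (\<lambda>n. ereal (time \<tau> n)) = ereal \<phi>" "0 \<le> \<phi>"
    and \<epsilon>: "0 < \<epsilon>" and Q: "AE \<tau> in PM. Q \<tau>"
  obtains \<tau> where "\<tau> \<in> space PM" "Q \<tau>" "limsup (\<lambda>n. ereal (time \<tau> n)) \<le> ereal (\<phi> + 3 * \<epsilon>)"
proof -
  \<comment> \<open>The rounding error met at a given site is not known in advance, so a length
    counts as cheap only if it is cheap for every \<open>z\<close>.\<close>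
  define B where "B N = {\<tau> \<in> space PM. \<forall>l\<in>{1..N}. \<exists>z\<in>cube 0 1. (\<phi> + \<epsilon>) * real l < dst h \<tau> 0 (site
      (real l) + z)}" for N :: nat
  define b where "b N \<tau> = indicator (B N) \<tau> * step_bound \<tau>" for N \<tau>
  have B[measurable]: "B N \<in> sets PM" for N unfolding B_def by measurable
  have sb[measurable]: "step_bound \<in> borel_measurable PM" using step_bound(1) by simp
  have b: "integrable PM (b N)" "0 \<le> b N \<tau>" for N \<tau>
    unfolding b_def using step_bound
    by (auto intro!: Bochner_Integration.integrable_bound[OF step_bound(1)] simp: indicator_def)
  have "(\<lambda>N. \<integral>\<tau>. b N \<tau> \<partial>PM) \<longlonglongrightarrow> (\<integral>\<tau>. 0 \<partial>PM)"
  proof (rule integral_dominated_convergence[where w = step_bound])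
    show "AE \<tau> in PM. (\<lambda>N. b N \<tau>) \<longlonglongrightarrow> 0"
      using \<phi>(1) AE_regular
    proof eventually_elim
      case (elim \<tau>)
      have "\<exists>l\<ge>1. \<forall>z\<in>cube 0 1. dst h \<tau> 0 (site (real l) + z) \<le> (\<phi> + \<epsilon>) * real l"
      proof (rule ccontr)
        assume no: "\<not> ?thesis"
        have "eventually (\<lambda>n. \<forall>w. infn (w - site (real n)) \<le> 1 \<longrightarrow>
            dst h \<tau> (site (real n)) w \<le> \<epsilon> / 2 * real n) sequentially"
          using \<epsilon> elim by (intro dst_near_site_nat) auto
        then have "eventually (\<lambda>n. ereal (\<phi> + \<epsilon> / 2) \<le> ereal (time \<tau> n)) sequentially"
          using eventually_ge_at_top[of 1]
        proof eventually_elim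
          case (elim n)
          obtain z where z: "z \<in> cube 0 1" "(\<phi> + \<epsilon>) * real n < dst h \<tau> 0 (site (real n) + z)"
            using no elim(2) not_le by blast
          have "dst h \<tau> (site (real n)) (site (real n) + z) \<le> \<epsilon> / 2 * real n"
            using elim(1) z(1) by (simp add: cube_def)
          then have "(\<phi> + \<epsilon>) * real n \<le> dst h \<tau> 0 (site (real n)) + \<epsilon> / 2 * real n"
            using z(2) dst_triangle[OF h, of \<tau> 0 "site (real n) + z" "site (real n)"] by linarith
          then show ?case using elim(2) by (simp add: field_simps)
        qed
        then have "ereal (\<phi> + \<epsilon> / 2) \<le> liminf (\<lambda>n. ereal (time \<tau> n))" by (rule Liminf_bounded)
        then show False using elim(1) \<epsilon> by simp
      qed
      then obtain l where l: "1 \<le> l" "\<forall>z\<in>cube 0 1. dst h \<tau> 0 (site (real l) + z) \<le> (\<phi> + \<epsilon>) * real l"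
          by blast
      have "b N \<tau> = 0" if "N \<ge> l" for N
      proof -
        have "\<tau> \<notin> B N"
        proof
          assume "\<tau> \<in> B N"
          moreover have "l \<in> {1..N}" using l that by simp
          ultimately obtain z where "z \<in> cube 0 1" "(\<phi> + \<epsilon>) * real l < dst h \<tau> 0 (site (real l) + z)"
            unfolding B_def by blast
          then show False using l(2) by (meson not_le)
        qed
        then show ?thesis by (simp add: b_def)
      qed
      then have "eventually (\<lambda>N. b N \<tau> = 0) sequentially" unfolding eventually_sequentially by blast
      then show ?case by (rule tendsto_eventually)
    qed
    show "AE \<tau> in PM. norm (b N \<tau>) \<le> step_bound \<tau>" for N
      using step_bound(2) by (auto simp: b_def indicator_def)
  qed (use step_bound in \<open>auto simp: b_def\<close>)
  then have "(\<lambda>N. card (cube (0 :: int ^ 'd) 1) * (\<integral>\<tau>. b N \<tau> \<partial>PM)) \<longlonglongrightarrow> real (card (cube (0 :: int ^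
      'd) 1)) * (\<integral>\<tau>. 0 \<partial>PM)"
    by (intro tendsto_intros)
  then have "eventually (\<lambda>N. card (cube (0 :: int ^ 'd) 1) * (\<integral>\<tau>. b N \<tau> \<partial>PM) < \<epsilon>) sequentially"
    using \<epsilon> by (intro order_tendstoD) auto
  then obtain N where N: "card (cube (0 :: int ^ 'd) 1) * (\<integral>\<tau>. b N \<tau> \<partial>PM) < \<epsilon>"
    unfolding eventually_sequentially by blast
  have Q': "AE \<tau> in PM. Q \<tau> \<and> regular \<tau>" using Q AE_regular by eventually_elim simp
  obtain \<tau> where "\<tau> \<in> space PM" "Q \<tau> \<and> regular \<tau>"
    and avg: "\<And>n. 1 \<le> n \<Longrightarrow> (\<Sum>k<n. b N (shift (site (real k)) \<tau>)) < \<epsilon> * real n"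
    by (rule ex_small_averages[OF b(1)[of N] b(2) \<epsilon> N Q']) blast
  then have \<tau>: "\<tau> \<in> space PM" "Q \<tau>" "regular \<tau>" by simp_all
  let ?F = "\<lambda>i j. dst h \<tau> (site (real i)) (site (real j))"
  let ?a = "\<lambda>i. ?F i (Suc i)"
  have main: "?F 0 n \<le> (\<phi> + \<epsilon>) * real (n - 0) + sum (\<lambda>k. b N (shift (site (real k)) \<tau>)) {0..<n} +
      sum ?a {j\<in>{0..<n}. n < j + N}" for n
  proof (rule greedy_subadditive)
    fix i
    show "?F i (Suc i) \<le> b N (shift (site (real i)) \<tau>) \<or> (\<exists>l\<in>{1..N}. ?F i (i + l) \<le> (\<phi> + \<epsilon>) * real l)"
    proof (cases "shift (site (real i)) \<tau> \<in> B N")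
      case True
      then show ?thesis using dst_step[of \<tau> i] by (simp add: b_def)
    next
      case False
      then obtain l where l: "l \<in> {1..N}" "\<And>z. z \<in> cube 0 1 \<Longrightarrow>
          dst h (shift (site (real i)) \<tau>) 0 (site (real l) + z) \<le> (\<phi> + \<epsilon>) * real l"
        using shift_space[OF \<tau>(1)] unfolding B_def by (auto simp: not_less)
      obtain z where "z \<in> cube 0 1" "dst h \<tau> (site (real i)) (site (real i + real l)) =
          dst h (shift (site (real i)) \<tau>) 0 (site (real l) + z)"
        using dst_site by blast
      then have "?F i (i + l) \<le> (\<phi> + \<epsilon>) * real l" using l(2) by simp
      then show ?thesis using l(1) by blast
    qed
  qed (use \<epsilon> \<phi>(2) b(2) h in \<open>auto intro: dst_triangle dst_refl dst_nonneg\<close>)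
  \<comment> \<open>Each of the last unit steps, of which there are at most \<open>N\<close>, is
    routed through \<open>site n\<close> at cost at most \<open>2 * ?\<epsilon> * n\<close>, so that
    together they cost at most \<open>\<epsilon> * n\<close>.\<close>
  let ?\<epsilon> = "\<epsilon> / (2 * (real N + 1))"
  have e': "0 < ?\<epsilon>" using \<epsilon> by simp
  have "eventually (\<lambda>n. \<forall>v. infn (v - site (real n)) \<le> 2 + int N \<longrightarrow>
      dst h \<tau> (site (real n)) v \<le> ?\<epsilon> * real n) sequentially"
    using \<tau>(3) e' by (rule dst_near_site_nat)
  then have "eventually (\<lambda>n. ereal (time \<tau> n) \<le> ereal (\<phi> + 3 * \<epsilon>)) sequentially"
    using eventually_ge_at_top[of 1]
  proof eventually_elim
    case (elim n)
    have a: "?a j \<le> \<epsilon> / (real N + 1) * real n" if j: "j \<in> {j\<in>{0..<n}. n < j + N}" for j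
    proof -
      have near: "infn (site (real i) - site (real n)) \<le> 2 + int N" if "i \<le> n" "n \<le> i + N" for i
      proof -
        have "infn (site (real (n - i))) \<le> int N + 1"
        proof -
          have "real_of_int (infn (site (real (n - i)))) \<le> real (n - i) + 1" by (rule infn_site) simp
          also have "\<dots> \<le> real_of_int (int N + 1)" using that by simp
          finally show ?thesis by (simp only: of_int_le_iff)
        qed
        moreover have "infn (site (real n) - site (real i) - site (real (n - i))) \<le> 1"
          using site_add[of "real i" "real (n - i)"] that by (simp add: of_nat_diff)
        moreover have "infn (site (real n) - site (real i)) \<le>
            infn (site (real n) - site (real i) - site (real (n - i))) + infn (site (real (n - i)))"
          using infn_triangle[of "site (real n) - site (real i) - site (real (n - i))"
              "site (real (n - i))"]
          by simp
        ultimately show ?thesis using infn_minus_commute[of "site (real n)" "site (real i)"] by linarith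
      qed
      have "dst h \<tau> (site (real n)) (site (real j)) \<le> ?\<epsilon> * real n"
        "dst h \<tau> (site (real n)) (site (real (Suc j))) \<le> ?\<epsilon> * real n"
        using elim(1) near[of j] near[of "Suc j"] j by simp_all
      then have "?a j \<le> ?\<epsilon> * real n + ?\<epsilon> * real n"
        using dst_triangle[OF h, of \<tau> "site (real j)" "site (real (Suc j))" "site (real n)"]
          dst_sym[OF h, of \<tau> "site (real j)" "site (real n)"] by linarith
      also have "\<dots> = \<epsilon> / (real N + 1) * real n"
      proof -
        have "x / (2 * K) * y + x / (2 * K) * y = x / K * y" for x y K :: real
          by (cases "K = 0") (simp_all add: field_simps)
        then show ?thesis .
      qed
      finally show ?thesis .
    qed
    have "sum ?a {j\<in>{0..<n}. n < j + N} \<le> real (card {j\<in>{0..<n}. n < j + N}) * (\<epsilon> / (real N + 1) *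
        real n)"
      using a by (rule sum_bounded_above)
    also have "\<dots> \<le> (real N + 1) * (\<epsilon> / (real N + 1) * real n)"
    proof (rule mult_right_mono)
      have "card {j\<in>{0..<n}. n < j + N} \<le> card {n - N..<n}" by (intro card_mono) auto
      then show "real (card {j\<in>{0..<n}. n < j + N}) \<le> real N + 1" by simp
    qed (use \<epsilon> in simp)
    also have "\<dots> = \<epsilon> * real n" by (simp add: field_simps)
    finally have "?F 0 n \<le> (\<phi> + \<epsilon>) * real n + \<epsilon> * real n + \<epsilon> * real n"
      using main[of n] avg[OF elim(2)] by (simp add: atLeast0LessThan)
    then have "dst h \<tau> 0 (site (real n)) \<le> (\<phi> + 3 * \<epsilon>) * real n"
      by (simp add: site_zero algebra_simps)
    then show ?case using elim(2) by (simp add: pos_divide_le_eq)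
  qed
  then have "limsup (\<lambda>n. ereal (time \<tau> n)) \<le> ereal (\<phi> + 3 * \<epsilon>)" by (rule Limsup_bounded)
  then show thesis using that \<tau> by blast
qed

text \<open>Walking by unit steps only, the distance grows at most linearly at a configuration where
  the averages of \<open>step_bound\<close> stay below \<open>c\<close>.\<close>

lemma time_finite:
  assumes Q: "AE \<tau> in PM. Q \<tau>"
  obtains \<tau> c where "\<tau> \<in> space PM" "Q \<tau>" "limsup (\<lambda>n. ereal (time \<tau> n)) \<le> ereal c"
proof -
  define c where "c = card (cube (0 :: int ^ 'd) 1) * (\<integral>\<tau>. step_bound \<tau> \<partial>PM) + 1"
  have "0 \<le> (\<integral>\<tau>. step_bound \<tau> \<partial>PM)" using step_bound(2) by simp
  then have c: "0 < c" by (simp add: c_def add_nonneg_pos)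
  have small: "card (cube (0 :: int ^ 'd) 1) * (\<integral>\<tau>. step_bound \<tau> \<partial>PM) < c" by (simp add: c_def)
  obtain \<tau> where \<tau>: "\<tau> \<in> space PM" "Q \<tau>"
    and avg: "\<And>n. 1 \<le> n \<Longrightarrow> (\<Sum>k<n. step_bound (shift (site (real k)) \<tau>)) < c * real n"
    by (rule ex_small_averages[OF step_bound c small Q]) blast
  have "dst h \<tau> 0 (site (real n)) \<le> (\<Sum>k<n. step_bound (shift (site (real k)) \<tau>))" for n
  proof (induction n)
    case 0
    then show ?case by (simp add: site_zero dst_refl h)
  next
    case (Suc n)
    then show ?case
      using dst_triangle[OF h, of \<tau> 0 "site (real (Suc n))" "site (real n)"] dst_step[of \<tau> n]
      by (simp only: sum.lessThan_Suc)
  qed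
  then have "eventually (\<lambda>n. dst h \<tau> 0 (site (real n)) \<le> (\<Sum>k<n. step_bound (shift (site (real k))
      \<tau>))) sequentially"
    by (rule always_eventually[OF allI])
  then have "eventually (\<lambda>n. ereal (time \<tau> n) \<le> ereal c) sequentially"
    using eventually_ge_at_top[of 1]
  proof eventually_elim
    case (elim n)
    then have "dst h \<tau> 0 (site (real n)) \<le> c * real n" using elim(1) avg[OF elim(2)] by linarith
    then show ?case using elim(2) by (simp add: pos_divide_le_eq)
  qed
  then have "limsup (\<lambda>n. ereal (time \<tau> n)) \<le> ereal c" by (rule Limsup_bounded)
  then show thesis by (rule that[OF \<tau>])
qed

text \<open>Liminf and limsup are almost surely constants \<open>c1\<close> and \<open>c2\<close>.
  \<open>time_finite\<close> makes \<open>c1\<close> finite, and \<open>time_bound\<close>, read at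
  one configuration for each error, gives \<open>c2 \<le> c1\<close>.\<close>

lemma time_constant:
  obtains \<phi> where "AE \<tau> in PM. time \<tau> \<longlonglongrightarrow> \<phi>"
proof -
  have meas: "(\<lambda>\<tau>. liminf (\<lambda>n. ereal (time \<tau> n))) \<in> borel_measurable PM"
    "(\<lambda>\<tau>. limsup (\<lambda>n. ereal (time \<tau> n))) \<in> borel_measurable PM" by measurable
  obtain c1 where c1: "AE \<tau> in PM. liminf (\<lambda>n. ereal (time \<tau> n)) = c1"
  proof (rule AE_constant[OF meas(1)])
    show "AE \<tau> in PM. liminf (\<lambda>n. ereal (time (shift v \<tau>) n)) = liminf (\<lambda>n. ereal (time \<tau> n))" for v
      using AE_regular by eventually_elim (rule time_shift_liminf(1))
  qed
  obtain c2 where c2: "AE \<tau> in PM. limsup (\<lambda>n. ereal (time \<tau> n)) = c2"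
  proof (rule AE_constant[OF meas(2)])
    show "AE \<tau> in PM. limsup (\<lambda>n. ereal (time (shift v \<tau>) n)) = limsup (\<lambda>n. ereal (time \<tau> n))" for v
      using AE_regular by eventually_elim (rule time_shift_liminf(2))
  qed
  have Q: "AE \<tau> in PM. liminf (\<lambda>n. ereal (time \<tau> n)) = c1 \<and> limsup (\<lambda>n. ereal (time \<tau> n)) = c2"
    using c1 c2 by eventually_elim simp
  obtain \<tau> c where \<tau>: "liminf (\<lambda>n. ereal (time \<tau> n)) = c1" "limsup (\<lambda>n. ereal (time \<tau> n)) = c2"
      "limsup (\<lambda>n. ereal (time \<tau> n)) \<le> ereal c"
    by (rule time_finite[OF Q]) blast
  have le: "c1 \<le> c2" using \<tau> Liminf_le_Limsup[of sequentially "\<lambda>n. ereal (time \<tau> n)"] by simp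
  have "0 \<le> c1" unfolding \<tau>(1)[symmetric] zero_ereal_def
    by (intro Liminf_bounded always_eventually) (simp add: dst_nonneg[OF h])
  moreover have "c1 \<le> ereal c" using le \<tau> by simp
  ultimately obtain \<phi> where \<phi>: "c1 = ereal \<phi>" "0 \<le> \<phi>" by (cases c1) auto
  have "c2 \<le> ereal \<phi> + ereal e" if "0 < e" for e
  proof -
    obtain \<tau> where "limsup (\<lambda>n. ereal (time \<tau> n)) = c2" "limsup (\<lambda>n. ereal (time \<tau> n))
        \<le> ereal (\<phi> + 3 * (e / 3))"
      by (rule time_bound[OF c1[unfolded \<phi>(1)] \<phi>(2) _ c2, of "e / 3"]) (use \<open>0 < e\<close> in auto)
    then show ?thesis by simp
  qed
  then have "c2 \<le> ereal \<phi>" by (rule ereal_le_epsilon2)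
  then have "c2 = ereal \<phi>" using le \<phi> by simp
  then have "AE \<tau> in PM. time \<tau> \<longlonglongrightarrow> \<phi>"
  proof (intro AE_mp[OF Q AE_I2] impI)
    fix \<tau> assume "liminf (\<lambda>n. ereal (time \<tau> n)) = c1 \<and> limsup (\<lambda>n. ereal (time \<tau> n)) = c2"
    then have "(\<lambda>n. ereal (time \<tau> n)) \<longlonglongrightarrow> ereal \<phi>"
      using \<phi>(1) \<open>c2 = ereal \<phi>\<close>
      by (intro tendsto_iff_Liminf_eq_Limsup[OF trivial_limit_sequentially, THEN iffD2]) simp
    then show "time \<tau> \<longlonglongrightarrow> \<phi>" by simp
  qed
  then show thesis by (rule that)
qed

text \<open>Replacing \<open>n\<close> by its integer part moves the site by at most 3 in each
  coordinate, which changes the distance by less than any multiple of \<open>n\<close>.\<close>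

lemma time_constant_real:
  obtains \<phi> where "AE \<tau> in PM. ((\<lambda>n. dst h \<tau> 0 (site n) / n) \<longlongrightarrow> \<phi>) at_top"
proof -
  obtain \<phi> where \<phi>: "AE \<tau> in PM. time \<tau> \<longlonglongrightarrow> \<phi>" by (rule time_constant)
  have fl: "filterlim (\<lambda>n. nat \<lfloor>n\<rfloor>) at_top (at_top :: real filter)"
    by (rule filterlim_compose[OF filterlim_nat_sequentially filterlim_floor_sequentially])
  have "AE \<tau> in PM. ((\<lambda>n. dst h \<tau> 0 (site n) / n) \<longlongrightarrow> \<phi>) at_top"
    using \<phi> AE_regular
  proof eventually_elim
    case (elim \<tau>)
    let ?m = "\<lambda>n::real. real (nat \<lfloor>n\<rfloor>)"
    have "((\<lambda>n :: real. time \<tau> (nat \<lfloor>n\<rfloor>)) \<longlongrightarrow> \<phi>) at_top"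
      by (rule filterlim_compose[OF elim(1) fl])
    moreover have "((\<lambda>n. ?m n / n) \<longlongrightarrow> 1) at_top"
    proof (rule tendsto_sandwich[of "\<lambda>n. 1 - 1 / n" _ _ "\<lambda>_. 1"])
      show "eventually (\<lambda>n. 1 - 1 / n \<le> ?m n / n) at_top"
        using eventually_gt_at_top[of 0]
      proof eventually_elim
        case (elim n)
        then have "n - 1 \<le> ?m n" by linarith
        then have "(n - 1) / n \<le> ?m n / n" using elim by (intro divide_right_mono) auto
        then show ?case using elim by (simp add: diff_divide_distrib)
      qed
      show "eventually (\<lambda>n. ?m n / n \<le> 1) at_top"
        using eventually_gt_at_top[of 0]
      proof eventually_elim
        case (elim n)
        then have "?m n \<le> n" by linarith
        then show ?case using elim by simp
      qed
      have "((\<lambda>n :: real. 1 - 1 / n) \<longlongrightarrow> 1 - 0) at_top"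
        by (intro tendsto_intros tendsto_divide_0[OF tendsto_const] filterlim_at_top_imp_at_infinity
            filterlim_ident)
      then show "((\<lambda>n :: real. 1 - 1 / n) \<longlongrightarrow> 1) at_top" by simp
    qed simp
    ultimately have "((\<lambda>n. time \<tau> (nat \<lfloor>n\<rfloor>) * (?m n / n)) \<longlongrightarrow> \<phi> * 1) at_top" by (rule tendsto_mult)
    moreover have "((\<lambda>n. dst h \<tau> 0 (site n) / n - time \<tau> (nat \<lfloor>n\<rfloor>) * (?m n / n)) \<longlongrightarrow> 0) at_top"
    proof (rule tendstoI)
      fix e :: real assume e: "0 < e"
      have "eventually (\<lambda>n. \<forall>v. infn (v - site n) \<le> 3 \<longrightarrow> dst h \<tau> (site n) v \<le> e / 2 * n) at_top"
        using e by (intro dst_near_site elim) auto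
      then show "eventually (\<lambda>n. dist (dst h \<tau> 0 (site n) / n - time \<tau> (nat \<lfloor>n\<rfloor>) * (?m n / n)) 0 <
          e) at_top"
        using eventually_ge_at_top[of 1]
      proof eventually_elim
        case (elim n)
        have m: "0 < ?m n" using elim(2) by linarith
        have r: "real_of_int (infn (site (n - ?m n))) \<le> (n - ?m n) + 1"
            by (rule infn_site) (use elim in linarith)
        also have "\<dots> < real_of_int 3" using elim by linarith
        finally have "infn (site (n - ?m n)) \<le> 2" by (simp only: of_int_less_iff)
        moreover have "infn (site n - site (?m n) - site (n - ?m n)) \<le> 1" using site_add[of "?m n"
            "n - ?m n"] by simp
        ultimately have "infn (site (?m n) - site n) \<le> 3"
          using infn_triangle[of "site n - site (?m n) - site (n - ?m n)" "site (n - ?m n)"]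
            infn_minus_commute[of "site (?m n)" "site n"] by simp
        then have d: "dst h \<tau> (site n) (site (?m n)) \<le> e / 2 * n" using elim(1) by blast
        have "\<bar>dst h \<tau> 0 (site n) - dst h \<tau> 0 (site (?m n))\<bar> \<le> e / 2 * n"
          using d dst_triangle[OF h, of \<tau> 0 "site n" "site (?m n)"] dst_triangle[OF h, of \<tau> 0
              "site (?m n)" "site n"]
            dst_sym[OF h, of \<tau> "site n" "site (?m n)"] by linarith
        also have "\<dots> < e * n" using e elim(2) by simp
        finally have "\<bar>dst h \<tau> 0 (site n) - dst h \<tau> 0 (site (?m n))\<bar> / n < e"
          using elim(2) by (simp add: field_simps)
        moreover have "dst h \<tau> 0 (site n) / n - time \<tau> (nat \<lfloor>n\<rfloor>) * (?m n / n) =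
            (dst h \<tau> 0 (site n) - dst h \<tau> 0 (site (?m n))) / n"
        proof -
          have "a / x * (x / n) = a / n" if "0 < x" for a x :: real using that by simp
          then show ?thesis unfolding diff_divide_distrib using m by metis
        qed
        ultimately show ?case using elim(2) by (simp add: dist_real_def)
      qed
    qed
    ultimately have "((\<lambda>n. (dst h \<tau> 0 (site n) / n - time \<tau> (nat \<lfloor>n\<rfloor>) * (?m n / n)) +
        time \<tau> (nat \<lfloor>n\<rfloor>) * (?m n / n)) \<longlongrightarrow> 0 + \<phi> * 1) at_top" by (intro tendsto_add)
    then show ?case by simp
  qed
  then show thesis by (rule that)
qed

end

end

section \<open>Comparison with geodesics\<close>

text \<open>Either \<open>p\<close> meets \<open>T\<close>, and its initial piece serves. Or
  \<open>p\<close> avoids \<open>T\<close>; then continuing from \<open>y\<close> back along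
  \<open>p\<close> and through \<open>A\<close> to a point outside the cube must cross
  \<open>T\<close> inside \<open>A\<close>, and the trivial walk serves.\<close>

lemma shell_connect:
  assumes T: "shell G x r T" and A: "\<And>u v. u \<in> A \<Longrightarrow> v \<in> A \<Longrightarrow> linked G A u v"
    and far: "\<not> A \<subseteq> cube x (2 * r)" and a: "a \<in> A" and y: "y \<in> cube x r" and p: "joins a y p"
  obtains a' u p' where "a' \<in> A" "u \<in> T" "joins a' u p'" "mset (steps p') \<subseteq># mset (steps p)"
proof (cases "set p \<inter> T = {}")
  case False
  then obtain u where u: "u \<in> set p" "u \<in> T" by blast
  obtain p1 p2 where "joins a u p1" "steps p = steps p1 @ steps p2"
    using joins_split[OF p u(1)] by metis
  then show thesis using that[OF a u(2)] by simp
next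
  case True
  obtain f where f: "f \<in> A" "f \<notin> cube x (2 * r)" using far by blast
  obtain q where q: "joins a f q" "set q \<subseteq> A" using A[OF a f(1)] unfolding linked_def by blast
  have pq: "joins y f (rev p @ tl q)" "set (rev p @ tl q) = set (rev p) \<union> set q"
    using joins_trans[OF joins_rev[OF p] q(1)] by simp_all
  obtain u where "u \<in> set (rev p @ tl q)" "u \<in> T" using shell_hit[OF T y f(2) pq(1)] by blast
  then have "u \<in> A" "u \<in> T" using True q(2) pq(2) by auto
  then show thesis using that[OF _ _ joins_single] by simp
qed

lemma steps_split:
  assumes "e \<in> set (steps p)"
  obtains c u v d where "p = c @ u # v # d" "e = {u, v}"
proof -
  have "\<exists>c u v d. p = c @ u # v # d \<and> e = {u, v}"
    using assms
  proof (induction p rule: steps.induct)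
    case (1 x y p)
    show ?case
    proof (cases "e = {x, y}")
      case True
      then show ?thesis by (intro exI[of _ "[]"]) auto
    next
      case False
      then obtain c u v d where "y # p = c @ u # v # d" "e = {u, v}" using 1 by auto
      then show ?thesis by (intro exI[of _ "x # c"]) auto
    qed
  qed auto
  then show thesis using that by blast
qed

text \<open>Induction on the number of edges at which \<open>t\<close> is smaller than \<open>f\<close>: the part of the walk inside a
  shell around such an edge is replaced by a walk along the shell, or along \<open>A\<close> or \<open>B\<close> if these
  intersect the shell.\<close>

lemma bypass:
  fixes t f :: "(int ^ 'd) set \<Rightarrow> real" and b :: real
  assumes t: "\<And>e. 0 \<le> t e" "\<And>e. t e \<le> f e" and b: "0 \<le> b"
    and G: "\<And>e. e \<in> G \<Longrightarrow> f e \<le> t e \<and> f e \<le> b"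
    and A: "\<And>u v. u \<in> A \<Longrightarrow> v \<in> A \<Longrightarrow> linked G A u v"
    and B: "\<And>u v. u \<in> B \<Longrightarrow> v \<in> B \<Longrightarrow> linked G B u v"
    and shells: "\<And>e. e \<in> lattice_edges \<Longrightarrow> t e < f e \<Longrightarrow> \<exists>x\<in>e. \<exists>r\<ge>1. \<exists>T. shell G x r T \<and>
      \<not> A \<subseteq> cube x (2 * r) \<and> \<not> B \<subseteq> cube x (2 * r) \<and> b * card T \<le> t e"
    and p: "joins a a' p" "a \<in> A" "a' \<in> B"
  shows "\<exists>u v q. u \<in> A \<and> v \<in> B \<and> joins u v q \<and> cost f q \<le> cost t p"
  using p
proof (induction "size (filter_mset (\<lambda>e. t e < f e) (mset (steps p)))" arbitrary: a a' p rule: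
    less_induct)
  case less
  show ?case
  proof (cases "\<exists>e\<in>set (steps p). t e < f e")
    case False
    then have "cost f p \<le> cost t p" by (intro cost_mono_fun) (auto simp: not_less)
    then show ?thesis using less.prems by blast
  next
    case True
    then obtain e where e: "e \<in> set (steps p)" "t e < f e" by blast
    then have "e \<in> lattice_edges" using joins_edges_lattice[OF less.prems(1)] by blast
    from shells[OF this e(2)] obtain x r T where x: "x \<in> e" "1 \<le> r" "shell G x r T"
      "\<not> A \<subseteq> cube x (2 * r)" "\<not> B \<subseteq> cube x (2 * r)" "b * card T \<le> t e" by blast
    obtain c u v d where p: "p = c @ u # v # d" "e = {u, v}" using e(1) by (rule steps_split)
    have j1: "joins a u (c @ [u])" and j2: "joins u a' (u # v # d)"
      using less.prems(1) joins_split_iff[of a a' c u "v # d"] by (simp_all add: p)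
    have adj: "lattice_adj u v" and j3: "joins v a' (v # d)"
      using j2 joins_split_iff[of u a' "[u]" v d] by (simp_all add: joins_def)
    have uv: "u \<in> cube x r" "v \<in> cube x r"
      using x(1,2) infn_adj[OF adj] infn_minus_commute[of u v] by (auto simp: p(2) cube_def)
    have steps: "steps p = steps (c @ [u]) @ e # steps (v # d)"
      unfolding p using steps_append[of c u "v # d"] by simp
    obtain a1 u1 p1 where p1: "a1 \<in> A" "u1 \<in> T" "joins a1 u1 p1"
        "mset (steps p1) \<subseteq># mset (steps (c @ [u]))"
      using shell_connect[OF x(3) A x(4) less.prems(2) uv(1) j1] by blast
    obtain a2 u2 p2 where p2: "a2 \<in> B" "u2 \<in> T" "joins a2 u2 p2"
        "mset (steps p2) \<subseteq># mset (steps (rev (v # d)))"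
      using shell_connect[OF x(3) B x(5) less.prems(3) uv(2) joins_rev[OF j3]] by blast
    have "linked G T u1 u2" using x(3) p1(2) p2(2) unfolding shell_def by blast
    moreover have "T \<subseteq> cube x (2 * r)" using x(3) by (auto simp: shell_def)
    then have "finite T" using finite_cube finite_subset by blast
    ultimately obtain g where g: "joins u1 u2 g" "set (steps g) \<subseteq> G" "cost f g \<le> b * card T"
      using cost_linked_le[of G T u1 u2 b f] b G by metis
    define q where "q = (p1 @ tl g) @ tl (rev p2)"
    have q: "joins a1 a2 q" "steps q = steps p1 @ steps g @ steps (rev p2)"
      using joins_trans[OF joins_trans(1)[OF p1(3) g(1)] joins_rev[OF p2(3)]] joins_trans(2)[OF
          p1(3) g(1)]
      by (simp_all add: q_def)
    have "cost t q = cost t p1 + cost t g + cost t p2"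
      using q(2) cost_rev[of t p2] by (simp add: cost_def)
    \<comment> \<open>The walk along the shell costs no more than the reduced weight
      \<open>t e\<close> of the edge that it replaces.\<close>
    also have "\<dots> \<le> cost t (c @ [u]) + t e + cost t (rev (v # d))"
    proof (intro add_mono cost_mset_mono p1(4) p2(4) t(1))
      have "cost t g \<le> cost f g" using t(2) by (intro cost_mono_fun)
      then show "cost t g \<le> t e" using g(3) x(6) by linarith
    qed
    also have "\<dots> = cost t p" unfolding cost_rev by (simp add: cost_def steps)
    finally have le: "cost t q \<le> cost t p" .
    let ?b = "\<lambda>l. size (filter_mset (\<lambda>e. t e < f e) (mset l))"
    have "?b (steps q) < ?b (steps p)"
    proof -
      have "\<forall>e\<in>set (steps g). \<not> t e < f e" using g(2) G by (auto simp: not_less)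
      then have "filter (\<lambda>e. t e < f e) (steps g) = []" by (simp add: filter_empty_conv)
      then have "?b (steps g) = 0" by (simp flip: mset_filter)
      moreover have "?b (steps p1) \<le> ?b (steps (c @ [u]))"
        by (intro size_mset_mono multiset_filter_mono p1(4))
      moreover have "?b (steps p2) \<le> ?b (steps (rev (v # d)))"
        by (intro size_mset_mono multiset_filter_mono p2(4))
      moreover have "?b (steps (rev (v # d))) = ?b (steps (v # d))" by (simp only: steps_rev mset_rev)
      moreover have "?b (steps q) = ?b (steps p1) + ?b (steps g) + ?b (steps p2)"
        unfolding q(2) steps_rev by simp
      moreover have "?b (steps p) = Suc (?b (steps (c @ [u])) + ?b (steps (v # d)))"
        using e(2) unfolding steps by simp
      ultimately show ?thesis by linarith
    qed
    from less.hyps[OF this q(1) p1(1) p2(1)] show ?thesis using le by (meson order_trans)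
  qed
qed

lemma cost_add: "cost (\<lambda>e. f e + c * g e) p = cost f p + c * cost g p"
  by (simp add: cost_def sum_list_addf sum_list_const_mult)

context fpp_law
begin

text \<open>The cap is inactive on good edges, since a detour costs at least \<open>M + h\<close> by
  \<open>vol_ge_1\<close>.\<close>

lemma good_wt: 
  assumes "0 \<le> h" "e \<in> good \<tau>"
  shows "wt h (\<tau> e) \<le> capped h \<tau> e" "wt h (\<tau> e) \<le> M + h"
proof -
  have e: "e \<in> lattice_edges" "\<tau> e \<le> M" using assms(2) by (auto simp: good_def)
  then show wt: "wt h (\<tau> e) \<le> M + h" using assms(1) M_ge_1 by (simp add: wt_def)
  obtain x y where xy: "e = {x, y}" using e(1) by (auto simp: lattice_edges_def)
  have "M + h \<le> (M + h) * vol x \<tau>" using vol_ge_1[of x \<tau>] M_ge_1 assms(1)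
    by (simp add: mult_le_cancel_left1)
  also have "\<dots> \<le> (\<Sum>x\<in>e. (M + h) * vol x \<tau>)"
    using xy detour_nonneg[OF assms(1)] by (intro member_le_sum) auto
  finally show "wt h (\<tau> e) \<le> capped h \<tau> e" using wt by (simp add: capped_def)
qed

text \<open>The shell \<open>A\<close> has diameter above \<open>20 * 10 ^ k\<close>. If
  \<open>x\<close> lies in the regular range of scale \<open>k\<close>, its detour cube has diameter
  at most \<open>4 * 10 ^ k\<close>. Otherwise \<open>x\<close> is so far out that its detour cube,
  though possibly larger, does not reach \<open>A\<close>.\<close>

lemma shell_not_in_detour:
  assumes k0: "\<And>j x. k0 \<le> j \<Longrightarrow> x \<in> cube 0 (10 ^ (expo * j)) \<Longrightarrow> has_shell (good \<tau>) x (10 ^ j)"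
    and k: "k0 \<le> k" "1 \<le> k" and c: "5 * infn c \<le> 10 ^ (expo * k)"
    and A: "shell G c (10 ^ Suc k) A"
  shows "has_shell (good \<tau>) x (10 ^ rad x \<tau>)" "\<not> A \<subseteq> cube x (2 * 10 ^ rad x \<tau>)"
proof -
  \<comment> \<open>The first scale from \<open>k\<close> on whose regular range contains
    \<open>x\<close>; it bounds the radius at \<open>x\<close>.\<close>
  define j where "j = (LEAST j. k \<le> j \<and> infn x \<le> 10 ^ (expo * j))"
  have "\<exists>j. k \<le> j \<and> infn x \<le> 10 ^ (expo * j)"
  proof (intro exI conjI)
    let ?j = "k + nat (infn x)"
    have "infn x \<le> int ?j" using infn_nonneg[of x] by simp
    also have "\<dots> \<le> 10 ^ ?j"
      using of_nat_less_two_power[of ?j, where 'a = int] power_mono[of "2 :: int" 10 ?j] by linarith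
    also have "\<dots> \<le> 10 ^ (expo * ?j)" using expo_ge by (intro power_increasing) auto
    finally show "infn x \<le> 10 ^ (expo * ?j)" .
  qed simp
  then have j: "k \<le> j" "infn x \<le> 10 ^ (expo * j)" unfolding j_def
      by (metis (mono_tags, lifting) LeastI_ex)+
  have sh: "has_shell (good \<tau>) x (10 ^ j)" using k0[of j x] j k by (simp add: cube_def)
  then show "has_shell (good \<tau>) x (10 ^ rad x \<tau>)" by (rule has_shell_rad)
  have rad: "(10 :: int) ^ rad x \<tau> \<le> 10 ^ j" using rad_le[OF sh] by (intro power_increasing) auto
  obtain t where t: "10 ^ Suc k < t" "c + axis undefined (1 * t) \<in> A"
    using shell_ray[OF A, of 1 undefined] by auto
  obtain t' where t': "10 ^ Suc k < t'" "c + axis undefined (-1 * t') \<in> A"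
    using shell_ray[OF A, of "-1" undefined] by auto
  show "\<not> A \<subseteq> cube x (2 * 10 ^ rad x \<tau>)"
  proof
    assume sub: "A \<subseteq> cube x (2 * 10 ^ rad x \<tau>)"
    show False
    proof (cases "j = k")
      case True
      let ?p = "c + axis undefined (1 * t)" and ?q = "c + axis undefined (-1 * t')"
      have "infn (?p - x) \<le> 2 * 10 ^ k" "infn (?q - x) \<le> 2 * 10 ^ k"
        using sub t(2) t'(2) rad True by (auto simp: cube_def intro: order_trans)
      moreover have "infn (?p - ?q) \<le> infn (?p - x) + infn (- (?q - x))"
        using infn_triangle[of "?p - x" "- (?q - x)"] by simp
      moreover have "?p - ?q = axis undefined (t + t')" by (simp add: vec_eq_iff axis_def)
      moreover have "0 \<le> t + t'" using t(1) t'(1) by (smt (verit) zero_less_power)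
      ultimately have "t + t' \<le> 4 * 10 ^ k" by (simp only: infn_minus infn_axis)
      moreover have "(0 :: int) < 10 ^ k" by simp
      ultimately show False using t(1) t'(1) unfolding power_Suc by linarith
    next
      case False
      define m where "m = j - 1"
      have m: "j = Suc m" "k \<le> m" "1 \<le> m" using j(1) False k(2) by (auto simp: m_def)
      have "\<not> infn x \<le> 10 ^ (expo * m)"
      proof
        assume "infn x \<le> 10 ^ (expo * m)"
        then have "j \<le> m" unfolding j_def using m(2) by (intro Least_le) simp
        then show False using m(1) by simp
      qed
      moreover
      let ?p = "c + axis undefined (1 * t)"
      have p: "?p \<in> cube x (2 * 10 ^ rad x \<tau>)" "?p \<in> cube c (2 * 10 ^ Suc k)"
        using sub t(2) A by (auto simp: shell_def)
      have "infn x \<le> infn (- (?p - x)) + infn ((?p - c) + c)"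
        using infn_triangle[of "- (?p - x)" "(?p - c) + c"] by simp
      then have "infn x \<le> infn (?p - x) + (infn (?p - c) + infn c)"
        unfolding infn_minus using infn_triangle[of "?p - c" c] by linarith
      then have "infn x \<le> 2 * 10 ^ j + 2 * 10 ^ Suc k + infn c"
        using p rad unfolding cube_def mem_Collect_eq by linarith
      moreover have "(10 :: int) ^ k \<le> 10 ^ m" "(10 :: int) ^ (expo * k) \<le> 10 ^ (expo * m)"
        using m(2) by (intro power_increasing; simp)+
      moreover have "(100 :: int) * 10 ^ m \<le> 10 ^ (expo * m)"
      proof -
        have "6 * m \<le> expo * m" using expo_ge by (rule mult_le_mono1)
        then have "m + 2 \<le> expo * m" using m(3) by linarith
        then have "(10 :: int) ^ (m + 2) \<le> 10 ^ (expo * m)" by (intro power_increasing) auto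
        then show ?thesis by (simp add: power_add)
      qed
      moreover have "(0 :: int) < 10 ^ m" by simp
      ultimately show False using c unfolding m(1) power_Suc by linarith
    qed
  qed
qed

lemma card_cube_le: "real (card (cube (c :: int ^ 'd) (2 * 10 ^ Suc k))) \<le> (50 * 10 ^ k) ^ CARD('d)"
proof -
  have "real (card (cube c (2 * 10 ^ Suc k))) = (40 * 10 ^ k + 1) ^ CARD('d)"
    by (simp add: card_cube nat_add_distrib nat_mult_distrib nat_power_eq add.commute)
  also have "\<dots> \<le> (50 * 10 ^ k) ^ CARD('d)"
  proof (rule power_mono)
    have "(1 :: real) \<le> 10 ^ k" by simp
    then show "40 * 10 ^ k + 1 \<le> (50 :: real) * 10 ^ k" by linarith
  qed simp
  finally show ?thesis .
qed

lemma distinct_walk_short: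
  fixes p :: "(int ^ 'd) list"
  assumes p: "distinct p" "set p \<subseteq> cube c (2 * 10 ^ Suc k)" and f: "\<And>e. 0 \<le> f e" "\<And>e. f e \<le> 1"
  shows "0 \<le> cost f p" "cost f p \<le> (50 * 10 ^ k) ^ CARD('d)"
proof -
  show "0 \<le> cost f p" using f(1) by (intro cost_nonneg)
  have "cost f p \<le> cost (\<lambda>_. 1) p" using f(2) by (intro cost_mono_fun)
  also have "\<dots> = real (length p - 1)" by (simp add: cost_def sum_list_triv length_steps)
  also have "\<dots> \<le> real (length p)" by simp
  also have "\<dots> = real (card (set p))" using p(1) by (simp add: distinct_card)
  also have "\<dots> \<le> real (card (cube c (2 * 10 ^ Suc k)))" using p(2) by (intro of_nat_mono card_mono) auto
  also have "\<dots> \<le> (50 * 10 ^ k) ^ CARD('d)" by (rule card_cube_le)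
  finally show "cost f p \<le> (50 * 10 ^ k) ^ CARD('d)" .
qed

text \<open>Before its first visit to \<open>A\<close> the walk cannot have left the cube of radius
  \<open>2 * r\<close>, as \<open>A\<close> separates.\<close>

lemma shell_first_hit:
  assumes A: "shell G c r A" and r: "0 \<le> r" and p: "joins c y p" "y \<notin> cube c (2 * r)"
  obtains p1 u p2 where "p = p1 @ u # p2" "u \<in> A" "set (p1 @ [u]) \<subseteq> cube c (2 * r)"
proof -
  have c: "c \<in> cube c r" using r by (simp add: cube_def)
  have "\<exists>u\<in>set p. u \<in> A" using shell_hit[OF A c p(2,1)] by blast
  then obtain p1 u p2 where s: "p = p1 @ u # p2" "u \<in> A" "\<forall>y\<in>set p1. y \<notin> A"
    by (rule split_list_first_propE) blast
  have "y \<in> cube c (2 * r)" if y1: "y \<in> set p1" for y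
  proof (rule ccontr)
    assume y: "y \<notin> cube c (2 * r)"
    obtain a b where ab: "p1 = a @ y # b" using y1 by (meson split_list)
    have "joins c y (a @ [y])" using p(1) joins_split_iff[of c _ a y "b @ u # p2"] by (simp add: s(1) ab)
    then obtain w where "w \<in> set (a @ [y])" "w \<in> A" using shell_hit[OF A c y] by blast
    then show False using s(3) ab by auto
  qed
  moreover have "u \<in> cube c (2 * r)" using s(2) A by (auto simp: shell_def)
  ultimately show thesis using that[OF s(1,2)] by auto
qed

end

section \<open>Geodesics in terms of walks\<close>

lemma joins_self_avoiding:
  "joins x y p \<and> distinct p \<longleftrightarrow> self_avoiding_walk p \<and> hd p = x \<and> last p = y"
  by (auto simp: joins_def self_avoiding_walk_def)

lemma passage_time_le:
  assumes f: "\<And>e. 0 \<le> f e" and p: "joins (lattice_point x) (lattice_point y) p"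
  shows "passage_time f x y \<le> cost f p"
proof -
  obtain q where q: "joins (lattice_point x) (lattice_point y) q" "distinct q" "set (steps q)
      \<subseteq> set (steps p)"
    using p by (rule loop_erasure)
  have "walk_edges q \<in> fpp_paths x y" using q joins_self_avoiding unfolding fpp_paths_def by blast
  then have "passage_time f x y \<le> passage_time_path f (walk_edges q)"
    unfolding passage_time_def
    by (intro cINF_lower bdd_belowI2[of _ 0]) (auto simp: passage_time_path_def intro: sum_nonneg f)
  also have "\<dots> \<le> sum f (set (steps p))"
    unfolding passage_time_path_def walk_edges_eq using q(3) f by (intro sum_mono2) auto
  also have "\<dots> \<le> cost f p" using f by (intro sum_steps_le_cost)
  finally show ?thesis .
qed

text \<open>Replacing the segment by \<open>q\<close> gives a walk with the same end points; loop
  erasure turns it into a competitor of the geodesic.\<close>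

lemma geodesic_segment:
  assumes f: "\<And>e. 0 \<le> f e" and geo: "walk_edges (p1 @ u # p2 @ v # p3) \<in> Geo f x y"
    and p: "joins (lattice_point x) (lattice_point y) (p1 @ u # p2 @ v # p3)"
        "distinct (p1 @ u # p2 @ v # p3)"
    and q: "joins u v q"
  shows "cost f (u # p2 @ [v]) \<le> cost f q"
proof -
  let ?p = "p1 @ u # p2 @ v # p3"
  have 1: "joins (lattice_point x) u (p1 @ [u])" and 2: "joins u (lattice_point y) ((u # p2) @ v # p3)"
    using p(1) joins_split_iff[of _ _ p1 u "p2 @ v # p3"] by simp_all
  have 3: "joins v (lattice_point y) (v # p3)" using 2 joins_split_iff[of u _ "u # p2" v p3] by simp
  have "cost f ?p = cost f (p1 @ [u]) + cost f (u # p2 @ [v]) + cost f (v # p3)"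
    using cost_split[of f p1 u "p2 @ v # p3"] cost_split[of f "u # p2" v p3] by simp
  moreover have "cost f ?p = passage_time f x y"
    using geo p(2) by (simp add: Geo_def passage_time_path_def walk_edges_eq cost_distinct)
  moreover have "passage_time f x y \<le> cost f (p1 @ [u]) + cost f q + cost f (v # p3)"
  proof -
    let ?q = "((p1 @ [u]) @ tl q) @ tl (v # p3)"
    have j: "joins (lattice_point x) v ((p1 @ [u]) @ tl q)" by (rule joins_trans(1)[OF 1 q])
    have "passage_time f x y \<le> cost f ?q"
      using joins_trans(1)[OF j 3] by (intro passage_time_le f)
    also have "\<dots> = cost f ((p1 @ [u]) @ tl q) + cost f (v # p3)"
      by (rule cost_steps_append[OF joins_trans(2)[OF j 3]])
    also have "cost f ((p1 @ [u]) @ tl q) = cost f (p1 @ [u]) + cost f q"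
      by (rule cost_steps_append[OF joins_trans(2)[OF 1 q]])
    finally show ?thesis .
  qed
  ultimately show ?thesis by linarith
qed

context fpp_law
begin

definition pos_edge :: "((int ^ 'd) set \<Rightarrow> real) \<Rightarrow> (int ^ 'd) set \<Rightarrow> real" where
  "pos_edge \<tau> e = (if 0 < \<tau> e then 1 else 0)"

text \<open>The exact affine dependence on \<open>h\<close> by which passage times detect the number
  of positive edges.\<close>

lemma wt_change: "wt h' (\<tau> e) = wt h (\<tau> e) + (h' - h) * pos_edge \<tau> e"
  by (simp add: wt_def pos_edge_def)

text \<open>The geodesic has the optimal weight between its first hit \<open>u\<close> of the shell around the origin and
  its last hit \<open>v\<close> of the shell around \<open>z\<close>, and the parts outside of these are negligible.\<close>

lemma geodesic_comparison_at_scale: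
  assumes k0: "\<And>j x. k0 \<le> j \<Longrightarrow> x \<in> cube 0 (10 ^ (expo * j)) \<Longrightarrow> has_shell (good \<tau>) x (10 ^ j)"
    and k: "k0 \<le> k" "1 \<le> k" and h: "0 \<le> h" "0 \<le> h'"
    and z: "5 * infn z \<le> 10 ^ (expo * k)" "40 * 10 ^ k < infn z"
    and near: "\<And>u v. infn u \<le> infn z \<Longrightarrow> infn (v - u) \<le> 20 * 10 ^ k \<Longrightarrow> dst h' \<tau> u v \<le> \<delta>"
    and x: "lattice_point x = 0" "lattice_point y = z"
    and geo: "\<gamma> \<in> Geo (\<lambda>e. wt h (\<tau> e)) x y"
  shows "dst h' \<tau> 0 z \<le> dst h \<tau> 0 z + (h' - h) * card {e \<in> \<gamma>. 0 < \<tau> e} + 2 * \<delta> + 1 +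
    2 * (M + h + \<bar>h' - h\<bar>) * (50 * 10 ^ k) ^ CARD('d)"
proof -
  \<comment> \<open>The end shells are taken one scale above \<open>k\<close>, so that no detour
    cube can contain them.\<close>
  let ?r = "(10 :: int) ^ Suc k" and ?K = "((50 :: real) * 10 ^ k) ^ CARD('d)"
  let ?w = "\<lambda>e. wt h (\<tau> e)"
  have le_k: "(10 :: int) ^ (expo * k) \<le> 10 ^ (expo * Suc k)" by (intro power_increasing) auto
  have "infn z \<le> 10 ^ (expo * Suc k)" using z(1) le_k infn_nonneg[of z] by linarith
  then have zc: "z \<in> cube 0 (10 ^ (expo * Suc k))" "0 \<in> cube (0 :: int ^ 'd) (10 ^ (expo * Suc k))"
    by (simp_all add: cube_def)
  obtain A where A: "shell (good \<tau>) 0 ?r A"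
    using k0[OF _ zc(2)] k unfolding has_shell_def by auto
  obtain B where B: "shell (good \<tau>) z ?r B"
    using k0[OF _ zc(1)] k unfolding has_shell_def by auto
  have Asub: "A \<subseteq> cube 0 (2 * ?r)" and Bsub: "B \<subseteq> cube z (2 * ?r)" using A B by (auto simp: shell_def)
  have p0: "(0 :: int) < 10 ^ k" by simp
  have "20 * 10 ^ k < infn z" using z(2) p0 by linarith
  then have z0: "z \<notin> cube 0 (2 * ?r)" by (simp add: cube_def)
  have Az: "u \<notin> cube z (2 * ?r)" if "u \<in> A" for u
  proof
    assume "u \<in> cube z (2 * ?r)"
    then have "infn (u - z) \<le> 20 * 10 ^ k" by (simp add: cube_def)
    moreover have "infn u \<le> 20 * 10 ^ k" using Asub that by (auto simp: cube_def)
    moreover have "infn z \<le> infn u + infn (- (u - z))" using infn_triangle[of u "- (u - z)"] by simp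
    ultimately show False using z(2) p0 unfolding infn_minus by linarith
  qed
  have linkA: "linked (good \<tau>) A u v" if "u \<in> A" "v \<in> A" for u v using A that by (auto simp: shell_def)
  have linkB: "linked (good \<tau>) B u v" if "u \<in> B" "v \<in> B" for u v using B that by (auto simp: shell_def)
  have cardAB: "real (card A) \<le> ?K" "real (card B) \<le> ?K"
    using Asub Bsub card_cube_le[of _ k] by (meson card_mono finite_cube of_nat_mono order_trans)+
  have w0: "0 \<le> ?w e" for e by (rule wt_nonneg[OF h(1)])
  obtain vs where vs: "joins 0 z vs" "distinct vs" "\<gamma> = walk_edges vs"
    using geo x unfolding Geo_def fpp_paths_def by (auto simp: joins_self_avoiding[symmetric])
  obtain p1 u p' where u: "vs = p1 @ u # p'" "u \<in> A" "set (p1 @ [u]) \<subseteq> cube 0 (2 * ?r)"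
    using shell_first_hit[OF A _ vs(1) z0] by auto
  have ju: "joins 0 u (p1 @ [u])" "joins u z (u # p')"
    using vs(1) joins_split_iff[of 0 z p1 u p'] by (simp_all add: u(1))
  obtain p3 v p2 where v: "rev (u # p') = p3 @ v # p2" "v \<in> B" "set (p3 @ [v]) \<subseteq> cube z (2 * ?r)"
    using shell_first_hit[OF B _ joins_rev[OF ju(2)] Az[OF u(2)]] by auto
  have up: "u # p' = rev p2 @ v # rev p3" using arg_cong[OF v(1), of rev] by simp
  have "u \<noteq> v" using Az[OF u(2)] v(2) Bsub by auto
  then obtain p2' where p2': "rev p2 = u # p2'" "p' = p2' @ v # rev p3"
    using up by (cases "rev p2") auto
  have vs_eq: "vs = p1 @ u # p2' @ v # rev p3" by (simp add: u(1) p2'(2))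
  let ?Q = "u # p2' @ [v]"
  have jQ: "joins u v ?Q"
    using ju(2) joins_split_iff[of u z "u # p2'" v "rev p3"] by (simp add: p2'(2))
  have split: "cost f vs = cost f (p1 @ [u]) + cost f ?Q + cost f (v # rev p3)" for f
    using cost_split[of f p1 u "p2' @ v # rev p3"] cost_split[of f "u # p2'" v "rev p3"]
        by (simp add: vs_eq)
  \<comment> \<open>Both end pieces are self-avoiding and confined to cubes of radius
    \<open>2 * ?r\<close>, hence have at most \<open>?K\<close> edges each.\<close>
  have pos: "\<bar>cost (pos_edge \<tau>) ?Q - card {e \<in> \<gamma>. 0 < \<tau> e}\<bar> \<le> 2 * ?K"
  proof -
    have P: "0 \<le> cost (pos_edge \<tau>) (p1 @ [u])" "cost (pos_edge \<tau>) (p1 @ [u]) \<le> ?K"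
      using vs(2) u(3) by (intro distinct_walk_short; auto simp: vs_eq pos_edge_def)+
    have "0 \<le> cost (pos_edge \<tau>) (p3 @ [v])" "cost (pos_edge \<tau>) (p3 @ [v]) \<le> ?K"
      using vs(2) v(3) by (intro distinct_walk_short; auto simp: vs_eq pos_edge_def)+
    then have P3: "0 \<le> cost (pos_edge \<tau>) (v # rev p3)" "cost (pos_edge \<tau>) (v # rev p3) \<le> ?K"
      using cost_rev[of "pos_edge \<tau>" "p3 @ [v]"] by simp_all
    have "cost (pos_edge \<tau>) vs = (\<Sum>e\<in>\<gamma>. pos_edge \<tau> e)"
      using vs(2,3) by (simp add: cost_distinct walk_edges_eq)
    also have "\<dots> = card {e \<in> \<gamma>. 0 < \<tau> e}"
      unfolding pos_edge_def vs(3) walk_edges_eq by (simp add: sum.If_cases Int_def)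
    finally show ?thesis using split[of "pos_edge \<tau>"] P P3 by linarith
  qed
  have "dst h' \<tau> 0 z \<le> dst h' \<tau> 0 u + dst h' \<tau> u v + dst h' \<tau> v z"
    using dst_triangle[OF h(2), of \<tau> 0 z u] dst_triangle[OF h(2), of \<tau> u z v] by linarith
  moreover have "dst h' \<tau> 0 u \<le> \<delta>" using u(2) Asub infn_nonneg[of z] by (intro near) (auto
      simp: cube_def)
  moreover have "dst h' \<tau> v z \<le> \<delta>"
    unfolding dst_sym[OF h(2), of \<tau> v z] using v(2) Bsub by (intro near) (auto simp: cube_def)
  moreover have "dst h' \<tau> u v \<le> cost ?w ?Q + (h' - h) * cost (pos_edge \<tau>) ?Q"
  proof -
    have "dst h' \<tau> u v \<le> cost (capped h' \<tau>) ?Q" using h(2) jQ by (rule dst_le)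
    also have "\<dots> \<le> cost (\<lambda>e. wt h' (\<tau> e)) ?Q" by (intro cost_mono_fun capped_le_wt)
    also have "\<dots> = cost ?w ?Q + (h' - h) * cost (pos_edge \<tau>) ?Q"
      unfolding wt_change[of h' \<tau> _ h] by (rule cost_add)
    finally show ?thesis .
  qed
  \<comment> \<open>A nearly optimal walk for the capped weights has to cross \<open>A\<close> and
    later \<open>B\<close>. \<open>bypass\<close> turns the part in between into a walk for the
    uncapped weights, whose ends are then joined to \<open>u\<close> and \<open>v\<close> inside the
    two shells.\<close>
  moreover have "cost ?w ?Q \<le> dst h \<tau> 0 z + 1 + 2 * (M + h) * ?K"
  proof -
    obtain p where p: "joins 0 z p" "cost (capped h \<tau>) p < dst h \<tau> 0 z + 1"
      using dst_approx[OF h(1) zero_less_one] by blast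
    have "0 \<in> cube (0 :: int ^ 'd) ?r" "z \<in> cube z ?r" by (simp_all add: cube_def)
    then obtain a where a: "a \<in> set p" "a \<in> A" using shell_hit[OF A _ z0 p(1)] by blast
    obtain q1 q2 where q: "joins 0 a q1" "joins a z q2" "steps p = steps q1 @ steps q2"
      using joins_split[OF p(1) a(1)] by metis
    obtain b where b: "b \<in> set (rev q2)" "b \<in> B"
      using shell_hit[OF B \<open>z \<in> cube z ?r\<close> Az[OF a(2)] joins_rev[OF q(2)]] by blast
    then have "b \<in> set q2" by simp
    then obtain q3 q4 where q': "joins a b q3" "joins b z q4" "steps q2 = steps q3 @ steps q4"
      using joins_split[OF q(2)] by metis
    have c0: "0 \<le> cost (capped h \<tau>) l" for l using capped_nonneg[OF h(1)] by (intro cost_nonneg)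
    have q3: "cost (capped h \<tau>) q3 \<le> cost (capped h \<tau>) p"
      using cost_steps_append[OF q(3), of "capped h \<tau>"] cost_steps_append[OF q'(3), of "capped h \<tau>"]
        c0[of q1] c0[of q4] by linarith
    have Mh: "0 \<le> M + h" using M_ge_1 h(1) by simp
    have "\<exists>a1 b1 q. a1 \<in> A \<and> b1 \<in> B \<and> joins a1 b1 q \<and> cost ?w q \<le> cost (capped h \<tau>) q3"
    proof (rule bypass[where G = "good \<tau>" and b = "M + h"])
      fix e :: "(int ^ 'd) set" assume e: "e \<in> lattice_edges" "capped h \<tau> e < ?w e"
      then obtain x x' where xx: "e = {x, x'}" by (auto simp: lattice_edges_def)
      have 0: "5 * infn (0 :: int ^ 'd) \<le> 10 ^ (expo * k)" by simp
      have "has_shell (good \<tau>) x (10 ^ rad x \<tau>)" using shell_not_in_detour[OF k0 k 0 A] by blast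
      then obtain T where T: "shell (good \<tau>) x (10 ^ rad x \<tau>) T" unfolding has_shell_def by blast
      have "card T \<le> card (cube x (2 * 10 ^ rad x \<tau>))"
        using T by (intro card_mono) (auto simp: shell_def)
      also have "\<dots> = nat (4 * 10 ^ rad x \<tau> + 1) ^ CARD('d)" by (simp add: card_cube)
      finally have "real (card T) \<le> real (nat (4 * 10 ^ rad x \<tau> + 1) ^ CARD('d))" by (rule of_nat_mono)
      also have "\<dots> = vol x \<tau>"
        by (simp add: vol_def nat_add_distrib nat_mult_distrib nat_power_eq add.commute)
      finally have "(M + h) * card T \<le> (M + h) * vol x \<tau>" using Mh by (rule mult_left_mono)
      also have "\<dots> \<le> (\<Sum>x\<in>e. (M + h) * vol x \<tau>)"
        using xx detour_nonneg[OF h(1)] by (intro member_le_sum) auto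
      also have "\<dots> \<le> capped h \<tau> e" using e(2) by (simp add: capped_def)
      finally have "(M + h) * card T \<le> capped h \<tau> e" .
      moreover have "\<not> A \<subseteq> cube x (2 * 10 ^ rad x \<tau>)" using shell_not_in_detour[OF k0 k 0 A] by blast
      moreover have "\<not> B \<subseteq> cube x (2 * 10 ^ rad x \<tau>)" using shell_not_in_detour[OF k0 k z(1) B] by blast
      moreover have "(1 :: int) \<le> 10 ^ rad x \<tau>" by simp
      ultimately show "\<exists>x\<in>e. \<exists>r\<ge>1. \<exists>T. shell (good \<tau>) x r T \<and> \<not> A \<subseteq> cube x (2 * r) \<and>
          \<not> B \<subseteq> cube x (2 * r) \<and> (M + h) * card T \<le> capped h \<tau> e"
        using T xx by blast
    qed (use capped_nonneg[OF h(1)] capped_le_wt good_wt[OF h(1)] Mh linkA linkB q'(1) a(2) b(2) in auto)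
    then obtain a1 b1 q where q1: "a1 \<in> A" "b1 \<in> B" "joins a1 b1 q" "cost ?w q \<le> cost (capped h \<tau>) q3"
      by blast
    have fin: "finite A" "finite B" using Asub Bsub finite_subset finite_cube by blast+
    have wle: "?w e \<le> M + h" if "e \<in> good \<tau>" for e by (rule good_wt(2)[OF h(1) that])
    obtain g1 where g1: "joins u a1 g1" "set g1 \<subseteq> A" "set (steps g1) \<subseteq> good \<tau>"
      "cost ?w g1 \<le> (M + h) * card A"
      by (rule cost_linked_le[where f = ?w, OF linkA[OF u(2) q1(1)] fin(1) Mh wle])
    obtain g2 where g2: "joins b1 v g2" "set g2 \<subseteq> B" "set (steps g2) \<subseteq> good \<tau>"
      "cost ?w g2 \<le> (M + h) * card B"
      by (rule cost_linked_le[where f = ?w, OF linkB[OF q1(2) v(2)] fin(2) Mh wle])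
    have j: "joins u b1 (g1 @ tl q)" by (rule joins_trans(1)[OF g1(1) q1(3)])
    have "cost ?w ?Q \<le> cost ?w ((g1 @ tl q) @ tl g2)"
      using geo vs x joins_trans(1)[OF j g2(1)] unfolding vs_eq
      by (intro geodesic_segment[OF w0]) auto
    also have "\<dots> = cost ?w (g1 @ tl q) + cost ?w g2" by (rule cost_steps_append[OF joins_trans(2)[OF
        j g2(1)]])
    also have "cost ?w (g1 @ tl q) = cost ?w g1 + cost ?w q"
        by (rule cost_steps_append[OF joins_trans(2)[OF g1(1) q1(3)]])
    finally have "cost ?w ?Q \<le> (M + h) * card A + (M + h) * card B + dst h \<tau> 0 z + 1"
      using g1(4) g2(4) q1(4) q3 p(2) by linarith
    moreover have "(M + h) * card A \<le> (M + h) * ?K" "(M + h) * card B \<le> (M + h) * ?K"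
      using cardAB Mh by (intro mult_left_mono; simp)+
    ultimately show ?thesis by (simp add: algebra_simps)
  qed
  moreover have "(h' - h) * cost (pos_edge \<tau>) ?Q \<le> (h' - h) * card {e \<in> \<gamma>. 0 < \<tau> e} + \<bar>h' - h\<bar> * (2
      * ?K)"
  proof -
    have "(h' - h) * (cost (pos_edge \<tau>) ?Q - card {e \<in> \<gamma>. 0 < \<tau> e}) \<le>
        \<bar>h' - h\<bar> * \<bar>cost (pos_edge \<tau>) ?Q - card {e \<in> \<gamma>. 0 < \<tau> e}\<bar>"
      unfolding abs_mult[symmetric] by (rule abs_ge_self)
    also have "\<dots> \<le> \<bar>h' - h\<bar> * (2 * ?K)" using pos by (intro mult_left_mono) auto
    finally show ?thesis unfolding right_diff_distrib by linarith
  qed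
  moreover have "2 * (M + h + \<bar>h' - h\<bar>) * ?K = 2 * (M + h) * ?K + \<bar>h' - h\<bar> * (2 * ?K)"
    by (simp add: distrib_right)
  ultimately show ?thesis by linarith
qed

text \<open>The scale is \<open>scale n\<close>, so that all errors are small against
  \<open>n\<close>. As \<open>h' - h\<close> may have either sign, this bounds the number of
  positive edges from below and from above.\<close>

lemma geodesic_comparison:
  fixes \<xi> :: "real ^ 'd"
  assumes \<xi>: "norm \<xi> = 1" and reg: "regular \<tau>" and h: "0 \<le> h" "0 \<le> h'" and \<epsilon>: "0 < \<epsilon>"
  shows "eventually (\<lambda>n. \<forall>\<gamma>\<in>Geo (\<lambda>e. wt h (\<tau> e)) 0 (n *\<^sub>R \<xi>).
    dst h' \<tau> 0 (site \<xi> n) \<le> dst h \<tau> 0 (site \<xi> n) + (h' - h) * card {e \<in> \<gamma>. 0 < \<tau> e} + \<epsilon> * n) at_top"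
proof -
  obtain k0 where k0: "\<And>k x. k0 \<le> k \<Longrightarrow> x \<in> cube 0 (10 ^ (expo * k)) \<Longrightarrow> has_shell (good \<tau>) x (10 ^ k)"
    using reg unfolding regular_def by blast
  define C where "C = 2 * (M + h + \<bar>h' - h\<bar>) * 50 ^ CARD('d)"
  have e4: "0 < \<epsilon> / 4" using \<epsilon> by simp
  \<comment> \<open>A unit vector has \<open>l1\<close> norm at least one, so some coordinate is
    bounded away from zero. Hence the sites move away linearly in the supremum norm, which keeps the
    two end shells apart.\<close>
  obtain i where i: "1 / (2 * real CARD('d)) < \<bar>\<xi> $ i\<bar>"
  proof (rule ccontr)
    assume *: "\<not> thesis"
    have "1 \<le> (\<Sum>i\<in>UNIV. \<bar>\<xi> $ i\<bar>)" using norm_le_l1_cart[of \<xi>] \<xi> by simp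
    also have "\<dots> \<le> (\<Sum>i\<in>(UNIV :: 'd set). 1 / (2 * real CARD('d)))"
      using * that by (intro sum_mono) (meson not_le)
    also have "\<dots> = 1 / 2" by simp
    finally show False by simp
  qed
  define c where "c = 1 / (2 * real CARD('d))"
  have c: "0 < c" by (simp add: c_def)
  have "eventually (\<lambda>n. max 1 k0 \<le> scale n) at_top"
    using filterlim_scale unfolding filterlim_at_top by blast
  then show ?thesis
    using scale_small[OF e4, of C] scale_small[OF c, of 41] dst_small[OF reg h(2) e4]
      eventually_ge_at_top[of 1] eventually_ge_at_top[of "4 / \<epsilon>"]
  proof eventually_elim
    case (elim n)
    let ?k = "scale n" and ?z = "site \<xi> n"
    have infz: "real_of_int (infn ?z) \<le> n + 1" using infn_site[OF \<xi> h(1), of n] elim(5) by simp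
    show ?case
    proof
      fix \<gamma> assume geo: "\<gamma> \<in> Geo (\<lambda>e. wt h (\<tau> e)) 0 (n *\<^sub>R \<xi>)"
      have pow: "(10 :: real) ^ ?k \<le> 10 ^ (2 * CARD('d) * ?k)" "(10 :: real) ^ (CARD('d) * ?k)
          \<le> 10 ^ (2 * CARD('d) * ?k)"
        by (intro power_increasing; simp add: Suc_le_eq)+
      have "dst h' \<tau> 0 ?z \<le> dst h \<tau> 0 ?z + (h' - h) * card {e \<in> \<gamma>. 0 < \<tau> e} + 2 * (\<epsilon> / 4 * n) + 1 +
          2 * (M + h + \<bar>h' - h\<bar>) * (50 * 10 ^ ?k) ^ CARD('d)"
      proof (rule geodesic_comparison_at_scale[OF k0 _ _ h _ _ _ _ _ geo])
        show "k0 \<le> ?k" "1 \<le> ?k" using elim(1) by auto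
        have "real_of_int (5 * infn ?z) \<le> real_of_int (10 ^ (expo * ?k))"
          using infz scale_ge[of n] elim(5) by simp
        then show "5 * infn ?z \<le> 10 ^ (expo * ?k)" by (simp only: of_int_le_iff)
        have "40 * 10 ^ ?k + 1 \<le> 41 * (10 :: real) ^ (2 * CARD('d) * ?k)"
        proof -
          have "(1 :: real) \<le> 10 ^ ?k" by simp
          then show ?thesis using pow(1) by linarith
        qed
        also have "\<dots> \<le> c * n" by (rule elim(3))
        also have "\<dots> < \<bar>\<xi> $ i\<bar> * n" using i elim(5) by (intro mult_strict_right_mono) (auto simp: c_def)
        also have "\<dots> = \<bar>(n *\<^sub>R \<xi>) $ i\<bar>" using elim(5) by (simp add: abs_mult mult.commute)
        also have "\<dots> \<le> \<bar>real_of_int (?z $ i)\<bar> + 1" by (simp add: site_def[OF \<xi> h(1)]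
            lattice_point_def) linarith
        finally have "real_of_int (40 * 10 ^ ?k) < real_of_int \<bar>?z $ i\<bar>" by simp
        then have "40 * 10 ^ ?k < \<bar>?z $ i\<bar>" by (simp only: of_int_less_iff)
        then show "40 * 10 ^ ?k < infn ?z" using comp_le_infn[of ?z i] by linarith
        show "dst h' \<tau> u v \<le> \<epsilon> / 4 * n" if "infn u \<le> infn ?z" "infn (v - u) \<le> 20 * 10 ^ ?k" for u v
        proof -
          have "real_of_int (infn u) \<le> real_of_int (infn ?z)" using that(1) by simp
          then have "real_of_int (infn u) \<le> 4 * n" using infz elim(5) by linarith
          then show ?thesis using elim(4) that(2) by blast
        qed
      qed (simp_all add: site_def[OF \<xi> h(1)])
      moreover have "1 \<le> \<epsilon> / 4 * n" using elim(6) \<epsilon> by (simp add: field_simps)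
      moreover have "2 * (M + h + \<bar>h' - h\<bar>) * (50 * 10 ^ ?k) ^ CARD('d) \<le> \<epsilon> / 4 * n"
      proof -
        have "2 * (M + h + \<bar>h' - h\<bar>) * (50 * 10 ^ ?k) ^ CARD('d) = C * 10 ^ (CARD('d) * ?k)"
          unfolding C_def power_mult_distrib by (simp add: mult_ac flip: power_mult)
        also have "\<dots> \<le> C * 10 ^ (2 * CARD('d) * ?k)"
          using pow(2) M_ge_1 h by (intro mult_left_mono) (simp_all add: C_def)
        finally show ?thesis using elim(2) by linarith
      qed
      ultimately show "dst h' \<tau> 0 ?z \<le> dst h \<tau> 0 ?z + (h' - h) * card {e \<in> \<gamma>. 0 < \<tau> e} + \<epsilon> * n"
        by linarith
    qed
  qed
qed

end

section \<open>Differentiability of the time constant\<close>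

text \<open>Taken as an infimum of chord slopes rather than as a limit, so that monotonicity of
  \<open>g\<close> is enough to make it meaningful.\<close>

definition left_slope :: "(real \<Rightarrow> real) \<Rightarrow> real \<Rightarrow> real" where
  "left_slope g h = (INF s\<in>{0..<h}. (g h - g s) / (h - s))"

definition slope_gap :: "(real \<Rightarrow> real) \<Rightarrow> real \<Rightarrow> bool" where
  "slope_gap g h \<longleftrightarrow> (\<exists>\<epsilon>>0. \<forall>h'>h. (g h' - g h) / (h' - h) \<le> left_slope g h - \<epsilon>)"

lemma left_slope_bdd:
  fixes g :: "real \<Rightarrow> real"
  assumes "mono_on {0..} g" "0 < h"
  shows "bdd_below ((\<lambda>s. (g h - g s) / (h - s)) ` {0..<h})"
proof (intro bdd_belowI2[of _ 0])
  fix s assume s: "s \<in> {0..<h}"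
  then have "0 \<le> s" "0 \<le> h" "s \<le> h" by auto
  then have "g s \<le> g h" using mono_onD[OF assms(1), of s h] by simp
  then show "0 \<le> (g h - g s) / (h - s)" using s by simp
qed

text \<open>Choose a rational \<open>q h\<close> in each gap. For \<open>h < h'\<close> the chord
  between them has slope below \<open>q h\<close> and at least \<open>left_slope g h'\<close>, which
  exceeds \<open>q h'\<close>. So \<open>q\<close> is strictly decreasing on the exceptional
  set.\<close>

lemma countable_slope_gap:
  fixes g :: "real \<Rightarrow> real"
  assumes g: "mono_on {0..} g"
  shows "countable {h. 0 < h \<and> slope_gap g h}"
proof -
  let ?B = "{h. 0 < h \<and> slope_gap g h}"
  have "\<forall>h\<in>?B. \<exists>q. (\<forall>h'>h. (g h' - g h) / (h' - h) < of_rat q) \<and> of_rat q < left_slope g h"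
  proof
    fix h assume "h \<in> ?B"
    then obtain \<epsilon> where \<epsilon>: "0 < \<epsilon>" "\<forall>h'>h. (g h' - g h) / (h' - h) \<le> left_slope g h - \<epsilon>"
      unfolding slope_gap_def by blast
    obtain q where "left_slope g h - \<epsilon> < of_rat q" "of_rat q < left_slope g h"
      using of_rat_dense[of "left_slope g h - \<epsilon>" "left_slope g h"] \<epsilon>(1) by auto
    then show "\<exists>q. (\<forall>h'>h. (g h' - g h) / (h' - h) < of_rat q) \<and> of_rat q < left_slope g h"
      using \<epsilon>(2) by (intro exI[of _ q]) (auto intro: le_less_trans)
  qed
  then obtain q :: "real \<Rightarrow> rat" where q: "\<And>h h'. h \<in> ?B \<Longrightarrow> h < h'
      \<Longrightarrow> (g h' - g h) / (h' - h) < of_rat (q h)"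
    "\<And>h. h \<in> ?B \<Longrightarrow> of_rat (q h) < left_slope g h"
    by metis
  have less: "q h' < q h" if "h \<in> ?B" "h' \<in> ?B" "h < h'" for h h'
  proof -
    have "left_slope g h' \<le> (g h' - g h) / (h' - h)"
      unfolding left_slope_def using that by (intro cINF_lower left_slope_bdd g) auto
    then have "real_of_rat (q h') < of_rat (q h)" using q(1)[OF that(1,3)] q(2)[OF that(2)] by linarith
    then show ?thesis by (simp add: of_rat_less)
  qed
  have "inj_on q ?B"
  proof (rule inj_onI)
    fix h h' assume *: "h \<in> ?B" "h' \<in> ?B" "q h = q h'"
    show "h = h'" using less[OF *(1,2)] less[OF *(2,1)] *(3) by (cases h h' rule: linorder_cases) auto
  qed
  then show ?thesis by (intro countable_image_inj_on[of q] countableI_type)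
qed

section \<open>Transfer of almost sure statements from \<open>L\<close> to the shifted law\<close>

lemma Geo_cong:
  assumes "\<And>e. e \<in> lattice_edges \<Longrightarrow> f e = g e"
  shows "Geo f x y = Geo g x y"
proof -
  have sub: "\<gamma> \<subseteq> lattice_edges" if "\<gamma> \<in> fpp_paths x y" for \<gamma>
    using that joins_edges_lattice unfolding fpp_paths_def walk_edges_eq
    by (auto simp: joins_self_avoiding[symmetric])
  have T: "passage_time_path f \<gamma> = passage_time_path g \<gamma>" if "\<gamma> \<in> fpp_paths x y" for \<gamma>
    unfolding passage_time_path_def using sub[OF that] assms by (intro sum.cong) auto
  then have "passage_time f x y = passage_time g x y"
    unfolding passage_time_def by (intro INF_cong) auto
  then show ?thesis using T by (auto simp: Geo_def)
qed

lemma Geo_subset: "\<gamma> \<in> Geo f x y \<Longrightarrow> \<gamma> \<subseteq> lattice_edges"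
  using joins_edges_lattice unfolding Geo_def fpp_paths_def walk_edges_eq
  by (auto simp: joins_self_avoiding[symmetric])

lemma shift_law_edge_laws:
  assumes "L \<in> edge_laws" "0 < h" shows "shift_law L h \<in> edge_laws"
proof -
  interpret prob_space L using assms(1) by (simp add: edge_laws_def)
  have [measurable_cong]: "sets L = sets borel" using assms(1) by (simp add: edge_laws_def)
  have m: "(\<lambda>t. t + h * indicator {0<..} t) \<in> measurable L borel" by measurable
  have "AE t in L. 0 \<le> t + h * indicator {0<..} t"
    using assms by (auto simp: edge_laws_def indicator_def elim!: eventually_mono)
  then have "AE t in shift_law L h. 0 \<le> t"
    unfolding shift_law_def by (subst AE_distr_iff[OF m]) auto
  then show ?thesis
    using prob_space_distr[OF m] unfolding edge_laws_def shift_law_def by simp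
qed

text \<open>Inverts the shift of positive weights; values in \<open>{0<..h}\<close> have probability
  zero under the shifted law.\<close>

definition unshift :: "real \<Rightarrow> real \<Rightarrow> real" where
  "unshift h t = (if 0 < t then t - h else 0)"

lemma distr_unshift:
  assumes "L \<in> edge_laws" "0 < h" shows "distr (shift_law L h) L (unshift h) = L"
proof -
  have sets[measurable_cong]: "sets L = sets borel" using assms(1) by (simp add: edge_laws_def)
  have [measurable]: "unshift h \<in> borel_measurable borel" unfolding unshift_def by measurable
  have "distr (shift_law L h) L (unshift h) = distr L L (unshift h \<circ> (\<lambda>t. t + h * indicator {0<..} t))"
    unfolding shift_law_def by (subst distr_distr) measurable
  also have "\<dots> = distr L L (\<lambda>t. t)"
  proof (rule distr_cong_AE)
    show "AE t in L. (unshift h \<circ> (\<lambda>t. t + h * indicator {0<..} t)) t = t"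
      using assms by (auto simp: edge_laws_def unshift_def indicator_def elim!: eventually_mono)
  qed measurable
  finally show ?thesis by (simp add: distr_id2)
qed

lemma AE_shift_law:
  assumes "L \<in> edge_laws" "0 < h" shows "AE t in shift_law L h. t = 0 \<or> h < t"
proof -
  have sets[measurable_cong]: "sets L = sets borel" using assms(1) by (simp add: edge_laws_def)
  have m: "(\<lambda>t. t + h * indicator {0<..} t) \<in> measurable L borel" by measurable
  have "AE t in L. t + h * indicator {0<..} t = 0 \<or> h < t + h * indicator {0<..} t"
    using assms by (auto simp: edge_laws_def indicator_def elim!: eventually_mono)
  then show ?thesis unfolding shift_law_def by (subst AE_distr_iff[OF m]) auto
qed

text \<open>Applying \<open>unshift h\<close> to every coordinate turns independent weights of law
  \<open>shift_law L h\<close> into independent weights of law \<open>L\<close>, so that almost sure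
  statements can be pulled back.\<close>

lemma AE_fpp_space_shift_law:
  assumes L: "L \<in> edge_laws" and h: "0 < h"
    and Q: "AE \<tau> in Pi\<^sub>M lattice_edges (\<lambda>_. L). Q \<tau>"
  shows "AE \<tau> in (fpp_space (shift_law L h) :: ((int ^ 'd) set \<Rightarrow> real) measure).
    Q (\<lambda>e\<in>lattice_edges. unshift h (\<tau> e)) \<and> (\<forall>e\<in>lattice_edges. \<tau> e = 0 \<or> h < \<tau> e)"
proof -
  let ?E = "lattice_edges :: (int ^ 'd) set set" and ?L = "shift_law L h"
  let ?P = "Pi\<^sub>M ?E (\<lambda>_. ?L)"
  have sets[measurable_cong]: "sets L = sets borel" "sets ?L = sets borel"
    using L by (simp_all add: edge_laws_def shift_law_def)
  interpret L: prob_space ?L using shift_law_edge_laws[OF L h] by (simp add: edge_laws_def)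
  interpret P: prob_space ?P by (rule prob_space_PiM) (rule L.prob_space_axioms)
  interpret product_prob_space "\<lambda>_. ?L" ?E
    by (simp add: product_prob_space_def product_prob_space_axioms_def
      product_sigma_finite_def L.prob_space_axioms L.sigma_finite_measure_axioms)
  have "unshift h \<in> borel_measurable borel" unfolding unshift_def by measurable
  then have us: "unshift h \<in> measurable ?L L" unfolding measurable_cong_sets[OF sets(2,1)] .
  have "P.indep_vars (\<lambda>_. ?L) (\<lambda>i \<omega>. \<omega> i) ?E"
    using indep_vars_coordinates[OF L.prob_space_axioms lattice_edges_nonempty] .
  then have "P.indep_vars (\<lambda>_. L) (\<lambda>i. unshift h \<circ> (\<lambda>\<omega>. \<omega> i)) ?E"
    by (rule P.indep_vars_compose) (rule us)
  then have "P.indep_vars (\<lambda>_. L) (\<lambda>i \<omega>. unshift h (\<omega> i)) ?E" by (simp add: comp_def)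
  moreover have m: "(\<lambda>\<omega>. unshift h (\<omega> i)) \<in> measurable ?P L" if "i \<in> ?E" for i
    using measurable_compose[OF measurable_component_singleton[OF that] us] .
  ultimately have "distr ?P (Pi\<^sub>M ?E (\<lambda>_. L)) (\<lambda>\<omega>. \<lambda>i\<in>?E. unshift h (\<omega> i)) =
      Pi\<^sub>M ?E (\<lambda>i. distr ?P L (\<lambda>\<omega>. unshift h (\<omega> i)))"
    using P.indep_vars_iff_distr_eq_PiM'[OF lattice_edges_nonempty, where X =
        "\<lambda>i \<omega>. unshift h (\<omega> i)" and M' = "\<lambda>_. L"]
    by blast
  also have "\<dots> = Pi\<^sub>M ?E (\<lambda>_. L)"
  proof (rule PiM_cong)
    fix i assume i: "i \<in> ?E"
    have "distr ?P L (\<lambda>\<omega>. unshift h (\<omega> i)) = distr (distr ?P ?L (\<lambda>\<omega>. \<omega> i)) L (unshift h)"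
      using i us by (subst distr_distr) (auto simp: comp_def)
    then show "distr ?P L (\<lambda>\<omega>. unshift h (\<omega> i)) = L"
      using PiM_component[OF i] distr_unshift[OF L h] by simp
  qed simp
  finally have distr: "distr ?P (Pi\<^sub>M ?E (\<lambda>_. L)) (\<lambda>\<omega>. \<lambda>i\<in>?E. unshift h (\<omega> i)) = Pi\<^sub>M ?E (\<lambda>_. L)" .
  have "AE \<tau> in distr ?P (Pi\<^sub>M ?E (\<lambda>_. L)) (\<lambda>\<omega>. \<lambda>i\<in>?E. unshift h (\<omega> i)). Q \<tau>"
    unfolding distr by (rule Q)
  then have 1: "AE \<tau> in ?P. Q (\<lambda>e\<in>?E. unshift h (\<tau> e))"
    by (rule AE_distrD[rotated]) (intro measurable_restrict m)
  have 2: "AE \<tau> in ?P. \<forall>e\<in>?E. \<tau> e = 0 \<or> h < \<tau> e"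
  proof (subst AE_ball_countable)
    have "?E \<subseteq> (\<lambda>(x, y). {x, y}) ` UNIV" by (auto simp: lattice_edges_def)
    then show "countable ?E" by (rule countable_subset) simp
    show "\<forall>e\<in>?E. AE \<tau> in ?P. \<tau> e = 0 \<or> h < \<tau> e"
      using AE_component AE_shift_law[OF L h] by blast
  qed
  have "AE \<tau> in ?P. Q (\<lambda>e\<in>?E. unshift h (\<tau> e)) \<and> (\<forall>e\<in>?E. \<tau> e = 0 \<or> h < \<tau> e)"
    using 1 2 by (rule AE_conjI)
  then show ?thesis unfolding fpp_space_def by (rule AE_completion)
qed

context fpp_law
begin

section \<open>Squeezing the number of positive edges between slopes of the time constant\<close>

lemma capped_mono: "0 \<le> h \<Longrightarrow> h \<le> h' \<Longrightarrow> capped h \<tau> e \<le> capped h' \<tau> e"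
  unfolding capped_def using vol_nonneg
  by (intro min.mono sum_mono mult_right_mono) (auto simp: wt_def)

lemma dst_mono: "0 \<le> h \<Longrightarrow> h \<le> h' \<Longrightarrow> dst h \<tau> x y \<le> dst h' \<tau> x y"
  unfolding dst_def
proof (rule cINF_mono)
  show "{p. joins x y p} \<noteq> {}" using ex_joins[of x y] by blast
  fix p assume h: "0 \<le> h" "h \<le> h'" and "p \<in> {p. joins x y p}"
  then show "\<exists>q\<in>{p. joins x y p}. cost (capped h \<tau>) q \<le> cost (capped h' \<tau>) p"
    by (intro bexI[of _ p] cost_mono_fun capped_mono) auto
qed (rule dst_bdd)

text \<open>A geodesic for \<open>h\<close> competes at the larger value \<open>h'\<close>, where it
  pays \<open>h' - h\<close> more per positive edge, so a large increase of the time constant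
  requires many of them.\<close>

lemma length_lower:
  fixes \<xi> :: "real ^ 'd"
  assumes \<xi>: "norm \<xi> = 1" and reg: "regular \<tau>" and h: "0 \<le> h" "h < h'"
    and lim: "((\<lambda>n. dst h \<tau> 0 (site \<xi> n) / n) \<longlongrightarrow> a) at_top"
        "((\<lambda>n. dst h' \<tau> 0 (site \<xi> n) / n) \<longlongrightarrow> a') at_top"
    and \<gamma>: "\<And>n. 0 < n \<Longrightarrow> \<gamma> n \<in> Geo (\<lambda>e. wt h (\<tau> e)) 0 (n *\<^sub>R \<xi>)" and q: "q < (a' - a) / (h' - h)"
  shows "eventually (\<lambda>n. q < card {e \<in> \<gamma> n. 0 < \<tau> e} / n) at_top"
proof -
  define \<epsilon> where "\<epsilon> = ((a' - a) - q * (h' - h)) / 2"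
  have \<epsilon>: "0 < \<epsilon>" using q h by (simp add: \<epsilon>_def pos_less_divide_eq)
  have h': "0 \<le> h'" using h by simp
  have "((\<lambda>n. dst h' \<tau> 0 (site \<xi> n) / n - dst h \<tau> 0 (site \<xi> n) / n) \<longlongrightarrow> a' - a) at_top"
    using lim by (intro tendsto_diff)
  then have "eventually (\<lambda>n. a' - a - \<epsilon> < dst h' \<tau> 0 (site \<xi> n) / n - dst h \<tau> 0 (site \<xi> n) / n) at_top"
    using \<epsilon> by (intro order_tendstoD) auto
  then show ?thesis
    using geodesic_comparison[OF \<xi> reg h(1) h' \<epsilon>] eventually_gt_at_top[of 0]
  proof eventually_elim
    case (elim n)
    let ?N = "real (card {e \<in> \<gamma> n. 0 < \<tau> e})"
    have "dst h' \<tau> 0 (site \<xi> n) - dst h \<tau> 0 (site \<xi> n) \<le> (h' - h) * ?N + \<epsilon> * n"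
      using elim(2) \<gamma>[OF elim(3)] by fastforce
    moreover have "(a' - a - \<epsilon>) * n < dst h' \<tau> 0 (site \<xi> n) - dst h \<tau> 0 (site \<xi> n)"
      using elim(1,3) by (simp add: field_simps)
    ultimately have "(a' - a - \<epsilon> - \<epsilon>) * n < (h' - h) * ?N" by (simp add: algebra_simps)
    then have "(h' - h) * (q * n) < (h' - h) * ?N" by (simp add: \<epsilon>_def algebra_simps)
    then have "q * n < ?N" using h by simp
    then show ?case using elim(3) by (simp add: pos_less_divide_eq)
  qed
qed

text \<open>At the smaller value \<open>s\<close> the same geodesic saves \<open>h - s\<close> per
  positive edge, and these savings cannot exceed the decrease of the time constant.\<close>

lemma length_upper:
  fixes \<xi> :: "real ^ 'd"
  assumes \<xi>: "norm \<xi> = 1" and reg: "regular \<tau>" and h: "0 \<le> s" "s < h"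
    and lim: "((\<lambda>n. dst h \<tau> 0 (site \<xi> n) / n) \<longlongrightarrow> a) at_top" "((\<lambda>n. dst s \<tau> 0 (site \<xi> n) / n) \<longlongrightarrow> a') at_top"
    and \<gamma>: "\<And>n. 0 < n \<Longrightarrow> \<gamma> n \<in> Geo (\<lambda>e. wt h (\<tau> e)) 0 (n *\<^sub>R \<xi>)" and q: "(a - a') / (h - s) < q"
  shows "eventually (\<lambda>n. card {e \<in> \<gamma> n. 0 < \<tau> e} / n < q) at_top"
proof -
  define \<epsilon> where "\<epsilon> = (q * (h - s) - (a - a')) / 2"
  have \<epsilon>: "0 < \<epsilon>" using q h by (simp add: \<epsilon>_def pos_divide_less_eq)
  have h0: "0 \<le> h" using h by simp
  have "((\<lambda>n. dst h \<tau> 0 (site \<xi> n) / n - dst s \<tau> 0 (site \<xi> n) / n) \<longlongrightarrow> a - a') at_top"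
    using lim by (intro tendsto_diff)
  then have "eventually (\<lambda>n. dst h \<tau> 0 (site \<xi> n) / n - dst s \<tau> 0 (site \<xi> n) / n < a - a' + \<epsilon>) at_top"
    using \<epsilon> by (intro order_tendstoD) auto
  then show ?thesis
    using geodesic_comparison[OF \<xi> reg h0 h(1) \<epsilon>] eventually_gt_at_top[of 0]
  proof eventually_elim
    case (elim n)
    let ?N = "real (card {e \<in> \<gamma> n. 0 < \<tau> e})"
    have "dst s \<tau> 0 (site \<xi> n) \<le> dst h \<tau> 0 (site \<xi> n) + (s - h) * ?N + \<epsilon> * n"
      using elim(2) \<gamma>[OF elim(3)] by fastforce
    then have "(h - s) * ?N \<le> dst h \<tau> 0 (site \<xi> n) - dst s \<tau> 0 (site \<xi> n) + \<epsilon> * n"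
      by (simp add: algebra_simps)
    moreover have "dst h \<tau> 0 (site \<xi> n) - dst s \<tau> 0 (site \<xi> n) < (a - a' + \<epsilon>) * n"
      using elim(1,3) by (simp add: field_simps)
    ultimately have "(h - s) * ?N < (a - a' + \<epsilon> + \<epsilon>) * n" by (simp add: algebra_simps)
    then have "(h - s) * ?N < (h - s) * (q * n)" by (simp add: \<epsilon>_def algebra_simps)
    then have "?N < q * n" using h by simp
    then show ?case using elim(3) by (simp add: pos_divide_less_eq)
  qed
qed

lemma ex_time_constant:
  fixes \<xi> :: "real ^ 'd"
  assumes \<xi>: "norm \<xi> = 1"
  obtains g where "\<And>h. 0 \<le> h \<Longrightarrow> AE \<tau> in PM. ((\<lambda>n. dst h \<tau> 0 (site \<xi> n) / n) \<longlongrightarrow> g h) at_top"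
    "mono_on {0..} g"
proof -
  let ?conv = "\<lambda>h \<phi>. AE \<tau> in PM. ((\<lambda>n. dst h \<tau> 0 (site \<xi> n) / n) \<longlongrightarrow> \<phi>) at_top"
  define g where "g h = (SOME \<phi>. ?conv h \<phi>)" for h
  have g: "?conv h (g h)" if h0: "0 \<le> h" for h
  proof -
    obtain \<phi> where "?conv h \<phi>" by (rule time_constant_real[OF \<xi> h0])
    then show ?thesis unfolding g_def by (rule someI[of "?conv h"])
  qed
  have "mono_on {0..} g"
  proof (rule mono_onI)
    fix h h' :: real assume h: "h \<in> {0..}" "h' \<in> {0..}" "h \<le> h'"
    have h0: "0 \<le> h" "0 \<le> h'" using h by auto
    have "AE \<tau> in PM. g h \<le> g h'"
      using g[OF h0(1)] g[OF h0(2)]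
    proof eventually_elim
      case (elim \<tau>)
      have "eventually (\<lambda>n. dst h \<tau> 0 (site \<xi> n) / n \<le> dst h' \<tau> 0 (site \<xi> n) / n) at_top"
        using eventually_gt_at_top[of 0] by eventually_elim (intro divide_right_mono dst_mono h0
            h(3), simp)
      then show ?case by (rule tendsto_le[OF trivial_limit_at_top_linorder elim(2,1)])
    qed
    then show "g h \<le> g h'" by simp
  qed
  with g show thesis by (rule that)
qed

text \<open>Countably many comparison values suffice, which keeps the exceptional set null: the
  \<open>s j\<close> approach the infimum in \<open>left_slope\<close>, and without a gap there are
  \<open>t j\<close> whose right chord slopes come within \<open>1 / real (Suc j)\<close> below
  it.\<close>

lemma AE_length_converges:
  fixes \<xi> :: "real ^ 'd"
  assumes \<xi>: "norm \<xi> = 1" and h: "0 < h"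
    and g: "\<And>h. 0 \<le> h \<Longrightarrow> AE \<tau> in PM. ((\<lambda>n. dst h \<tau> 0 (site \<xi> n) / n) \<longlongrightarrow> g h) at_top" "mono_on {0..} g"
    and gap: "\<not> slope_gap g h"
  shows "AE \<tau> in PM. \<forall>\<gamma>. (\<forall>n>0. \<gamma> n \<in> Geo (\<lambda>e. wt h (\<tau> e)) 0 (n *\<^sub>R \<xi>)) \<longrightarrow>
    ((\<lambda>n. card {e \<in> \<gamma> n. 0 < \<tau> e} / n) \<longlongrightarrow> left_slope g h) at_top"
proof -
  let ?l = "left_slope g h"
  have "\<exists>s. 0 \<le> s \<and> s < h \<and> (g h - g s) / (h - s) < ?l + 1 / real (Suc j)" for j
  proof -
    have "?l < ?l + 1 / real (Suc j)" by simp
    then have "\<exists>s\<in>{0..<h}. (g h - g s) / (h - s) < ?l + 1 / real (Suc j)"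
      unfolding left_slope_def using h by (subst (asm) cINF_less_iff[OF _ left_slope_bdd[OF g(2)
          h]]) auto
    then show ?thesis by auto
  qed
  then obtain s where s: "\<And>j. 0 \<le> s j" "\<And>j. s j < h" "\<And>j. (g h - g (s j)) / (h - s j) < ?l + 1 /
      real (Suc j)"
    by metis
  have "\<exists>h'>h. ?l - 1 / real (Suc j) < (g h' - g h) / (h' - h)" for j
    using gap unfolding slope_gap_def by (auto simp: not_le dest!: spec[of _ "1 / real (Suc j)"])
  then obtain t where t: "\<And>j. h < t j" "\<And>j. ?l - 1 / real (Suc j) < (g (t j) - g h) / (t j - h)"
    by metis
  have t0: "0 \<le> t j" for j using t(1)[of j] h by simp
  have "AE \<tau> in PM. \<forall>j. ((\<lambda>n. dst (s j) \<tau> 0 (site \<xi> n) / n) \<longlongrightarrow> g (s j)) at_top"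
    unfolding AE_all_countable using g(1) s(1) by blast
  moreover have "AE \<tau> in PM. \<forall>j. ((\<lambda>n. dst (t j) \<tau> 0 (site \<xi> n) / n) \<longlongrightarrow> g (t j)) at_top"
    unfolding AE_all_countable using g(1) t0 by blast
  moreover have "AE \<tau> in PM. ((\<lambda>n. dst h \<tau> 0 (site \<xi> n) / n) \<longlongrightarrow> g h) at_top"
    using g(1) h by simp
  ultimately show ?thesis
    using AE_regular
  proof eventually_elim
    case (elim \<tau>)
    show ?case
    proof (intro allI impI)
      fix \<gamma> :: "real \<Rightarrow> (int ^ 'd) set set"
      assume \<gamma>: "\<forall>n>0. \<gamma> n \<in> Geo (\<lambda>e. wt h (\<tau> e)) 0 (n *\<^sub>R \<xi>)"
      show "((\<lambda>n. card {e \<in> \<gamma> n. 0 < \<tau> e} / n) \<longlongrightarrow> ?l) at_top"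
      proof (rule order_tendstoI)
        fix q assume "q < ?l"
        then obtain j where "1 / real (Suc j) < ?l - q" using nat_approx_posE[of "?l - q"] by auto
        then have "q < (g (t j) - g h) / (t j - h)" using t(2)[of j] by linarith
        then show "eventually (\<lambda>n. q < card {e \<in> \<gamma> n. 0 < \<tau> e} / n) at_top"
          using length_lower[OF \<xi> elim(4) less_imp_le[OF h] t(1) elim(3) elim(2)[rule_format]] \<gamma> by blast
      next
        fix q assume "?l < q"
        then obtain j where "1 / real (Suc j) < q - ?l" using nat_approx_posE[of "q - ?l"] by auto
        then have "(g h - g (s j)) / (h - s j) < q" using s(3)[of j] by linarith
        then show "eventually (\<lambda>n. card {e \<in> \<gamma> n. 0 < \<tau> e} / n < q) at_top"
          using length_upper[OF \<xi> elim(4) s(1) s(2) elim(3) elim(1)[rule_format]] \<gamma> by blast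
      qed
    qed
  qed
qed

lemma shift_law_length_laws:
  fixes \<xi> :: "real ^ 'd"
  assumes \<xi>: "norm \<xi> = 1" and h: "0 < h"
    and g: "\<And>h. 0 \<le> h \<Longrightarrow> AE \<tau> in PM. ((\<lambda>n. dst h \<tau> 0 (site \<xi> n) / n) \<longlongrightarrow> g h) at_top" "mono_on {0..} g"
    and gap: "\<not> slope_gap g h"
  shows "shift_law L h \<in> length_laws \<xi>"
proof -
  have "AE \<tau> in PM. \<forall>\<gamma>. (\<forall>n>0. \<gamma> n \<in> Geo (\<lambda>e. wt h (\<tau> e)) 0 (n *\<^sub>R \<xi>)) \<longrightarrow>
      ((\<lambda>n. card {e \<in> \<gamma> n. 0 < \<tau> e} / n) \<longlongrightarrow> left_slope g h) at_top"
    by (rule AE_length_converges[OF \<xi> h g(1) g(2) gap])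
  note conv = AE_fpp_space_shift_law[OF edge_law h this]
  have "AE \<tau> in fpp_space (shift_law L h). \<forall>\<gamma>. (\<forall>n>0. \<gamma> n \<in> Geo \<tau> 0 (n *\<^sub>R \<xi>)) \<longrightarrow>
      ((\<lambda>n. real (pos_length \<tau> (\<gamma> n)) / n) \<longlongrightarrow> left_slope g h) at_top"
  proof (rule AE_mp[OF conv], intro AE_I2 impI allI)
    fix \<tau> :: "(int ^ 'd) set \<Rightarrow> real" and \<gamma> :: "real \<Rightarrow> (int ^ 'd) set set"
    let ?\<tau> = "\<lambda>e\<in>lattice_edges. unshift h (\<tau> e)"
    assume *: "(\<forall>\<gamma>. (\<forall>n>0. \<gamma> n \<in> Geo (\<lambda>e. wt h (?\<tau> e)) 0 (n *\<^sub>R \<xi>)) \<longrightarrow>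
        ((\<lambda>n. card {e \<in> \<gamma> n. 0 < ?\<tau> e} / n) \<longlongrightarrow> left_slope g h) at_top) \<and>
        (\<forall>e\<in>lattice_edges. \<tau> e = 0 \<or> h < \<tau> e)"
      and \<gamma>: "\<forall>n>0. \<gamma> n \<in> Geo \<tau> 0 (n *\<^sub>R \<xi>)"
    have pos: "0 < ?\<tau> e \<longleftrightarrow> 0 < \<tau> e" if "e \<in> lattice_edges" for e
      using * that h by (auto simp: unshift_def)
    \<comment> \<open>\<open>wt h (unshift h t) = t\<close> whenever \<open>t = 0\<close> or
      \<open>h < t\<close>.\<close>
    have "Geo (\<lambda>e. wt h (?\<tau> e)) 0 (n *\<^sub>R \<xi>) = Geo \<tau> 0 (n *\<^sub>R \<xi>)" for n
      using * h by (intro Geo_cong) (auto simp: wt_def unshift_def)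
    then have "((\<lambda>n. card {e \<in> \<gamma> n. 0 < ?\<tau> e} / n) \<longlongrightarrow> left_slope g h) at_top"
      using * \<gamma> by simp
    then show "((\<lambda>n. real (pos_length \<tau> (\<gamma> n)) / n) \<longlongrightarrow> left_slope g h) at_top"
    proof (rule tendsto_cong[THEN iffD1, rotated])
      show "eventually (\<lambda>n. card {e \<in> \<gamma> n. 0 < ?\<tau> e} / n = real (pos_length \<tau> (\<gamma> n)) / n) at_top"
        using eventually_gt_at_top[of 0]
      proof eventually_elim
        case (elim n)
        then have "\<gamma> n \<subseteq> lattice_edges" using \<gamma> Geo_subset by blast
        then have "{e \<in> \<gamma> n. 0 < ?\<tau> e} = {e \<in> \<gamma> n. 0 < \<tau> e}" using pos by blast
        then show ?case by (simp only: pos_length_def)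
      qed
    qed
  qed
  then show ?thesis using shift_law_edge_laws[OF edge_law h] unfolding length_laws_def by blast
qed

end

theorem theorem1p26:
  fixes \<xi> :: "real ^ 'd" and L :: "real measure"
  assumes "CARD('d) \<ge> 2"
    and "\<xi> \<in> sphere 0 1"
    and "L \<in> edge_laws"
  shows "countable {h::real. h > 0 \<and> shift_law L h \<notin> length_laws \<xi>}"
proof -
  obtain M where M: "1 \<le> M" "measure L {M<..} * (2 ^ (5 ^ CARD('d)) * (37 ^ CARD('d))\<^sup>2) \<le> 1 / 2"
    using ex_tail_bound[OF assms(3), of "2 ^ (5 ^ CARD('d)) * (37 ^ CARD('d))\<^sup>2"] by auto
  interpret fpp_law L M "TYPE('d)" using assms M by unfold_locales auto
  have \<xi>: "norm \<xi> = 1" using assms(2) by simp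
  obtain g where g: "\<And>h. 0 \<le> h \<Longrightarrow> AE \<tau> in PM. ((\<lambda>n. dst h \<tau> 0 (site \<xi> n) / n) \<longlongrightarrow> g h) at_top"
    "mono_on {0..} g"
    using ex_time_constant[OF \<xi>] by blast
  have "shift_law L h \<in> length_laws \<xi>" if "0 < h" "\<not> slope_gap g h" for h
    by (rule shift_law_length_laws[OF \<xi> that(1) g(1) g(2) that(2)])
  then have "{h. h > 0 \<and> shift_law L h \<notin> length_laws \<xi>} \<subseteq> {h. 0 < h \<and> slope_gap g h}" by blast
  then show ?thesis using countable_slope_gap[OF g(2)] by (rule countable_subset)
qed

end
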